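(* Let $\alpha\in\alpha_0\mathbb{Z}$ with $|\alpha|<\frac1{\sqrt2}$ and $\lambda\in\mathbb{R}$. Define on $\mathcal D$ the operators $$\ell_1=\hat L_1\otimes\mathbf 1+\mathbf 1\otimes\hat L_{-1}+\lambda(\Phi_{\alpha,1}+\Phi_{-\alpha,1}),\quad \ell_0=\hat L_0\otimes\mathbf 1-\mathbf 1\otimes\hat L_0,\quad \ell_{-1}=\hat L_{-1}\otimes\mathbf 1+\mathbf 1\otimes\hat L_{1}+\lambda(\Phi_{\alpha,-1}+\Phi_{-\alpha,-1}).$$ Then the Lorentz relations $[\ell_m,\ell_n]=(m-n)\ell_{m+n}$, $m,n\in\{-1,0,1\}$, hold weakly on $\mathcal D$: for all $m,n\in\{-1,0,1\}$ and $\Psi_1,\Psi_2\in\mathcal D$, $$\langle\ell_{-m}\Psi_1,\ell_n\Psi_2\rangle-\langle\ell_{-n}\Psi_1,\ell_m\Psi_2\rangle=(m-n)\langle\Psi_1,\ell_{m+n}\Psi_2\rangle$$ (where $\ell_{-m}$ plays the role of the formal adjoint of $\ell_m$). In particular $[\ell_1,\ell_{-1}]=2(\hat L_0\otimes\mathbf 1-\mathbf 1\otimes\hat L_0)$ and $[\ell_0,\ell_{\pm1}]=\mp\ell_{\pm1}$ weakly.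
   Context: For $\beta\in\mathbb{R}$ let $\mathcal H_\beta$ be the Hilbert space carrying a unitary representation of the Heisenberg algebra: operators $J_{\beta,n}$, $n\in\mathbb{Z}$, with $[J_{\beta,m},J_{\beta,n}]=m\,\delta_{m+n,0}$, $J_{\beta,n}^*=J_{\beta,-n}$, $J_{\beta,0}=\beta\cdot\mathbf 1$, and a cyclic unit vector $\Omega_\beta$ with $J_{\beta,n}\Omega_\beta=0$ for $n>0$; $\mathcal H_\beta$ is the closure of the span $\mathcal H_\beta^{\rm fin}$ of the vectors $J_{\beta,-n_1}\cdots J_{\beta,-n_k}\Omega_\beta$, $n_i>0$. On $\mathcal H_\beta$ the Virasoro operators (central charge $1$) are given by the Sugawara formula $L_{\beta,n}=\frac12\sum_{k\in\mathbb{Z}}{:}J_{\beta,n-k}J_{\beta,k}{:}$ (normal ordering puts $J_{\beta,k}$ with $k>0$ to the right); they satisfy $L_{\beta,n}^*=L_{\beta,-n}$. Fix $\alpha_0\in\mathbb{R}$ with $0<|\alpha_0|\le1$ and set $\hat{\mathcal H}=\bigoplus_{j\in\mathbb{Z}}\mathcal H_{j\alpha_0}$, $\hat J_n=\bigoplus_j J_{j\alpha_0,n}$, $\hat L_n=\bigoplus_j L_{j\alpha_0,n}$. For $\alpha\in\alpha_0\mathbb{Z}$ let $c_\alpha$ be the unitary on $\hat{\mathcal H}$ mapping $\mathcal H_\beta\to\mathcal H_{\beta+\alpha}$ by $c_\alpha \hat J_{-n_1}\cdots\hat J_{-n_k}\Omega_\beta=\hat J_{-n_1}\cdots\hat J_{-n_k}\Omega_{\beta+\alpha}$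 ($n_i>0$). Define the formal series $E^{\pm}(\alpha,z)=\exp\bigl(\mp\sum_{n>0}\frac{\alpha\hat J_{\pm n}}{n}z^{\mp n}\bigr)$ and $Y_\alpha(z)=c_\alpha E^-(\alpha,z)E^+(\alpha,z)z^{\alpha\hat J_0}$, where $z^{\alpha\hat J_0}$ acts as $z^{\alpha\beta}$ on $\mathcal H_\beta$. With $d=\alpha^2/2$ write $Y_\alpha(z)=\sum_{s\in\mathbb{R}}Y_{\alpha,s}z^{-s-d}$; the coefficient $Y_{\alpha,s}$ is a bounded operator (for $|\alpha|\le1$) mapping $\mathcal H_\beta$ into $\mathcal H_{\beta+\alpha}$, nonzero on $\mathcal H_\beta$ only for $s\in\mathbb{Z}-\alpha\beta-d$, and $Y_\alpha$ is primary of dimension $d$: $[\hat L_m,Y_{\alpha,s}]=((d-1)m-s)Y_{\alpha,m+s}$. The domain $\mathcal D$ is the algebraic direct sum $\bigoplus_{j\in\mathbb{Z},\mathrm{alg}}\mathcal H^{\rm fin}_{j\alpha_0}\otimes_{\mathrm{alg}}\mathcal H^{\rm fin}_{j\alpha_0}$. For $|\alpha|<1/\sqrt2$ and $s\in\mathbb{Z}$, $\Phi_{\alpha,s}$ denotes the operator on $\mathcal D$ given by the norm-convergent series $\Phi_{\alpha,s}\Psi=\sum_{t\in\mathbb{R}}(Y_{\alpha,t}\otimes Y_{\alpha,t-s})\Psi$ (the coefficient of $w^{-s}$ in $Y_\alpha(w)\otimes Y_\alpha(w^{-1})$). *)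

theory Defs
  imports "HOL-Analysis.Analysis" "HOL-Library.Multiset"
begin

text \<open>Concrete model. A basis vector of \<open>\<H>_{j \<alpha>0}\<close> is
  \<open>J_{-n_1} \<dots> J_{-n_k} \<Omega>_{j \<alpha>0}\<close>, indexed by the sector \<open>j\<close> and the
  multiset (partition) of positive parts \<open>{n_1,..,n_k}\<close>. Vectors are coefficient
  functions with respect to this (orthogonal, unnormalised) basis.\<close>

type_synonym fidx = "int \<times> nat multiset"
type_synonym vec = "fidx \<Rightarrow> complex"
type_synonym tidx = "fidx \<times> fidx"
type_synonym tvec = "tidx \<Rightarrow> complex"

text \<open>Squared norm of the basis vector with partition M: prod_k k^(m_k) m_k!.\<close>
definition zfac :: "nat multiset \<Rightarrow> real" where
  "zfac M = (\<Prod>k\<in>set_mset M. real k ^ count M k * fact (count M k))"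

definition Jop :: "real \<Rightarrow> int \<Rightarrow> vec \<Rightarrow> vec" where
  "Jop \<alpha>0 n c = (\<lambda>(j, N).
     if n < 0 then (if nat (-n) \<in># N then c (j, N - {#nat (-n)#}) else 0)
     else if n = 0 then complex_of_real (of_int j * \<alpha>0) * c (j, N)
     else of_int n * of_nat (count N (nat n) + 1) * c (j, add_mset (nat n) N))"

definition NOJJ :: "real \<Rightarrow> int \<Rightarrow> int \<Rightarrow> vec \<Rightarrow> vec" where
  "NOJJ \<alpha>0 a b c = (if b > 0 then Jop \<alpha>0 a (Jop \<alpha>0 b c) else Jop \<alpha>0 b (Jop \<alpha>0 a c))"

text \<open>Sugawara: L_n = 1/2 sum_k :J_{n-k} J_k: (finite sum on finite vectors).\<close>
definition Lop :: "real \<Rightarrow> int \<Rightarrow> vec \<Rightarrow> vec" where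
  "Lop \<alpha>0 n c = (\<lambda>i. (1/2) * (\<Sum>\<^sub>\<infinity>k::int. NOJJ \<alpha>0 (n - k) k c i))"

definition lift1 :: "(vec \<Rightarrow> vec) \<Rightarrow> tvec \<Rightarrow> tvec" where
  "lift1 T \<Psi> = (\<lambda>(i1, i2). T (\<lambda>i. \<Psi> (i, i2)) i1)"

definition lift2 :: "(vec \<Rightarrow> vec) \<Rightarrow> tvec \<Rightarrow> tvec" where
  "lift2 T \<Psi> = (\<lambda>(i1, i2). T (\<lambda>i. \<Psi> (i1, i)) i2)"

text \<open>Coefficient of the basis vector N in E^-(alpha,z) E^+(alpha,z) applied to the
  basis vector M (expanded: E^+ substitutes p_k -> p_k - alpha z^{-k},
  E^- = sum_K alpha^{len K} z^{|K|} / z_K J_{-K}).\<close>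
definition ycoef :: "real \<Rightarrow> nat multiset \<Rightarrow> nat multiset \<Rightarrow> real" where
  "ycoef \<alpha> M N = (if 0 \<notin># N then
     (\<Sum>S\<in>{S. S \<subseteq># M \<and> M - S \<subseteq># N}.
        (\<Prod>k\<in>set_mset M. real (count M k choose count S k))
        * (-\<alpha>) ^ size S * \<alpha> ^ size (N - (M - S)) / zfac (N - (M - S)))
     else 0)"

text \<open>Matrix element of Y_{alpha,s} (alpha = a * alpha0) from basis vector (j, M)
  of sector j to basis vector (j + a, N): Y_alpha(z) = sum_s Y_{alpha,s} z^{-s-d}.\<close>
definition Ymat :: "real \<Rightarrow> int \<Rightarrow> int \<Rightarrow> real \<Rightarrow> nat multiset \<Rightarrow> nat multiset \<Rightarrow> real" where
  "Ymat \<alpha>0 a j s M N =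
     (let \<alpha> = of_int a * \<alpha>0; \<beta> = of_int j * \<alpha>0; d = \<alpha>^2 / 2 in
      if s = real (sum_mset M) - real (sum_mset N) - \<alpha> * \<beta> - d then ycoef \<alpha> M N else 0)"

definition Phi :: "real \<Rightarrow> int \<Rightarrow> int \<Rightarrow> tvec \<Rightarrow> tvec" where
  "Phi \<alpha>0 a s \<Psi> = (\<lambda>((j1, N1), (j2, N2)).
     \<Sum>\<^sub>\<infinity>t::real. \<Sum>\<^sub>\<infinity>p::nat multiset \<times> nat multiset.
       complex_of_real (Ymat \<alpha>0 a (j1 - a) t (fst p) N1 * Ymat \<alpha>0 a (j2 - a) (t - of_int s) (snd p) N2)
       * \<Psi> ((j1 - a, fst p), (j2 - a, snd p)))"

definition tinner :: "tvec \<Rightarrow> tvec \<Rightarrow> complex" where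
  "tinner \<Psi> \<Phi> = (\<Sum>\<^sub>\<infinity>i::tidx. cnj (\<Psi> i) * \<Phi> i
      * complex_of_real (zfac (snd (fst i)) * zfac (snd (snd i))))"

definition inD :: "tvec \<Rightarrow> bool" where
  "inD \<Psi> = (finite {i. \<Psi> i \<noteq> 0} \<and>
     (\<forall>j1 M1 j2 M2. \<Psi> ((j1, M1), (j2, M2)) \<noteq> 0 \<longrightarrow> j1 = j2 \<and> 0 \<notin># M1 \<and> 0 \<notin># M2))"

text \<open>The operators ell_1, ell_0, ell_{-1} (alpha = a * alpha0, coupling lam);
  other indices give the zero map (they only occur with coefficient m - n = 0).\<close>
definition ell :: "real \<Rightarrow> int \<Rightarrow> real \<Rightarrow> int \<Rightarrow> tvec \<Rightarrow> tvec" where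
  "ell \<alpha>0 a lam m \<Psi> =
    (if m = 1 then (\<lambda>i. lift1 (Lop \<alpha>0 1) \<Psi> i + lift2 (Lop \<alpha>0 (-1)) \<Psi> i
                      + complex_of_real lam * (Phi \<alpha>0 a 1 \<Psi> i + Phi \<alpha>0 (-a) 1 \<Psi> i))
     else if m = 0 then (\<lambda>i. lift1 (Lop \<alpha>0 0) \<Psi> i - lift2 (Lop \<alpha>0 0) \<Psi> i)
     else if m = -1 then (\<lambda>i. lift1 (Lop \<alpha>0 (-1)) \<Psi> i + lift2 (Lop \<alpha>0 1) \<Psi> i
                      + complex_of_real lam * (Phi \<alpha>0 a (-1) \<Psi> i + Phi \<alpha>0 (-a) (-1) \<Psi> i))
     else (\<lambda>i. 0))"

end

theory Submission
  imports Defs "HOL-Real_Asymp.Real_Asymp"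
begin

text \<open>The matrix elements of \<open>Y\<^sub>\<alpha>\<close> are determined by \<open>[J\<^sub>k, Y\<^sub>\<alpha>(z)] = \<alpha> z\<^sup>k Y\<^sub>\<alpha>(z)\<close>, which yields the
  adjoint relation \<open>Y\<^sub>\<alpha>\<^sup>* \<sim> Y\<^sub>-\<^sub>\<alpha>\<close> and the commutators with \<open>L\<^sub>\<plusminus>\<^sub>1\<close>.  Write \<open>A\<^sub>\<plusminus>\<^sub>1\<close> for the free part
  \<open>L\<^sub>\<plusminus>\<^sub>1 \<otimes> 1 + 1 \<otimes> L\<^sub>\<mp>\<^sub>1\<close> of \<open>\<ell>\<^sub>\<plusminus>\<^sub>1\<close>.  In the commutator of \<open>\<ell>\<^sub>1\<close> and \<open>\<ell>\<^sub>-\<^sub>1\<close> the order \<open>\<lambda>\<^sup>0\<close> is the Virasoro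
  relation; the order \<open>\<lambda>\<close> cancels because \<open>[A\<^sub>1, \<Phi>\<^sub>\<alpha>\<^sub>,\<^sub>-\<^sub>1] = [A\<^sub>-\<^sub>1, \<Phi>\<^sub>\<alpha>\<^sub>,\<^sub>1]\<close>.  At order \<open>\<lambda>\<^sup>2\<close> the fields must
  commute weakly.  Normal ordering shows that a matrix element of a product of two fields is a
  Laurent polynomial, symmetric under exchange of the fields, times
  \<open>(1 - z/w)\<^sup>\<gamma> (1 - w/z)\<^sup>\<gamma>\<close> with \<open>\<gamma> = \<plusminus>\<alpha>\<^sup>2\<close>.  For \<open>\<bar>\<gamma>\<bar> < 1/2\<close> the coefficients of \<open>(1 - x)\<^sup>\<gamma>\<close> are square
  summable, so the product converges absolutely, and it is visibly symmetric in \<open>z\<close> and \<open>w\<close>.\<close>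

section \<open>Matrix elements of the vertex operator\<close>

text \<open>A field sends a finite vector to an infinite one, so the product of two fields is never
  formed; every relation is tested as a pairing. A pairing that involves a free generator reduces to
  a finite sum, because \<open>L_1\<close> and \<open>L_-1\<close> act on arbitrary coefficient
  functions and can be moved off the finitely supported vector. Only the pairing of two field images
  is a genuine infinite sum, and this is where \<alpha>^2 < 1/2 enters. The symmetry of that sum
  belongs to the two chiralities jointly. With x recording the level of the intermediate state, one
  chirality contributes a factor (1 - x)^(-\<gamma>), which is not invariant under x -> 1/x; the
  other chirality contributes the same factor at 1/x, and the product is invariant. Exchanging the
  fields reflects the remaining polynomial, p(x) becoming x^w p(1/x). This is an identity between
  coefficient sequences, proved by recursion on partitions without any analysis of functions. A
  similar balance holds at order \<lambda>: the covariances under \<open>L_1\<close> and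
  \<open>L_-1\<close> differ by \<alpha>^2, but each free generator applies one of them to each
  factor, so the sum is the same for both signs.\<close>

lemma zfac_prod:
  assumes "finite A" "set_mset M \<subseteq> A"
  shows "zfac M = (\<Prod>k\<in>A. real k ^ count M k * fact (count M k))"
  unfolding zfac_def using assms
  by (intro prod.mono_neutral_left) (auto simp: not_in_iff)

lemma zfac_empty [simp]: "zfac {#} = 1"
  by (simp add: zfac_def)

lemma zfac_add_mset: "zfac (add_mset k M) = real (k * (count M k + 1)) * zfac M"
proof -
  let ?A = "insert k (set_mset M)"
  let ?f = "\<lambda>M k. real k ^ count M k * fact (count M k)"
  have "zfac (add_mset k M) = (\<Prod>i\<in>?A. ?f (add_mset k M) i)"
    by (rule zfac_prod) auto
  also have "\<dots> = ?f (add_mset k M) k * (\<Prod>i\<in>?A - {k}. ?f (add_mset k M) i)"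
    by (rule prod.remove) auto
  also have "(\<Prod>i\<in>?A - {k}. ?f (add_mset k M) i) = (\<Prod>i\<in>?A - {k}. ?f M i)"
    by (rule prod.cong) auto
  also have "?f (add_mset k M) k = real (k * (count M k + 1)) * ?f M k"
    by (simp add: algebra_simps)
  also have "\<dots> * (\<Prod>i\<in>?A - {k}. ?f M i) = real (k * (count M k + 1)) * (\<Prod>i\<in>?A. ?f M i)"
    by (subst (2) prod.remove[of _ k]) (auto simp: mult.assoc)
  also have "(\<Prod>i\<in>?A. ?f M i) = zfac M"
    by (rule zfac_prod[symmetric]) auto
  finally show ?thesis .
qed

lemma zfac_pos: "0 \<notin># M \<Longrightarrow> zfac M > 0"
  unfolding zfac_def by (intro prod_pos) (auto intro!: mult_pos_pos zero_less_power gr0I)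

text \<open>A multiset containing 0 names no basis vector. The factor \<open>0 ^ count M 0\<close>
  gives it weight zero, so such indices drop out of every inner product.\<close>

lemma zfac_eq_0: "0 \<in># M \<Longrightarrow> zfac M = 0"
  unfolding zfac_def by (rule prod_zero) (auto simp: zero_power)

lemma zfac_nonneg: "zfac M \<ge> 0"
  by (metis less_eq_real_def zfac_eq_0 zfac_pos)

text \<open>The product runs over both supports, so it vanishes unless R is contained in M. Sums can
  then range over the submultisets of N alone, for every M at once.\<close>

definition mset_binomial :: "'b multiset \<Rightarrow> 'b multiset \<Rightarrow> real" where
  "mset_binomial M R = (\<Prod>k\<in>set_mset M \<union> set_mset R. real (count M k choose count R k))"

lemma mset_binomial_prod:
  assumes "finite A" "set_mset M \<union> set_mset R \<subseteq> A"
  shows "mset_binomial M R = (\<Prod>k\<in>A. real (count M k choose count R k))"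
  unfolding mset_binomial_def using assms
  by (intro prod.mono_neutral_left) (auto simp: not_in_iff)

lemma mset_binomial_eq_0: "\<not> R \<subseteq># M \<Longrightarrow> mset_binomial M R = 0"
proof -
  assume "\<not> R \<subseteq># M"
  then obtain k where k: "count M k < count R k"
    by (auto simp: subseteq_mset_def not_le)
  then have "k \<in># R" by (metis count_inI less_nat_zero_code)
  with k show ?thesis
    unfolding mset_binomial_def by (intro prod_zero) auto
qed

lemma mset_binomial_Pascal:
  "mset_binomial (add_mset k M) R
     = mset_binomial M R + of_bool (k \<in># R) * mset_binomial M (R - {#k#})"
proof -
  let ?A = "insert k (set_mset M \<union> set_mset R)"
  have *: "mset_binomial M' R' = real (count M' k choose count R' k)
            * (\<Prod>i\<in>?A - {k}. real (count M' i choose count R' i))"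
    if "set_mset M' \<union> set_mset R' \<subseteq> ?A" for M' R'
    using that by (simp add: mset_binomial_prod[of ?A] prod.remove[of ?A k])
  have 1: "(\<Prod>i\<in>?A - {k}. real (count (add_mset k M) i choose count R i))
     = (\<Prod>i\<in>?A - {k}. real (count M i choose count R i))"
    by (rule prod.cong) auto
  have 2: "(\<Prod>i\<in>?A - {k}. real (count M i choose count (R - {#k#}) i))
     = (\<Prod>i\<in>?A - {k}. real (count M i choose count R i))"
    by (rule prod.cong) auto
  have 3: "real (Suc (count M k) choose count R k)
     = real (count M k choose count R k) + of_bool (k \<in># R) * real (count M k choose (count R k - 1))"
    by (cases "count R k") (auto simp: not_in_iff count_eq_zero_iff[symmetric] simp del: count_eq_zero_iff)
  show ?thesis
    apply (subst *, force)
    apply (subst *, force)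
    apply (subst *, force dest: in_diffD)
    apply (subst 1)
    apply (subst 2)
    apply (simp add: 3 algebra_simps)
    done
qed

lemma mset_binomial_absorb:
  assumes "k \<in># M"
  shows "real (count R k + 1) * mset_binomial M (add_mset k R)
           = real (count M k) * mset_binomial (M - {#k#}) R"
proof -
  let ?A = "insert k (set_mset M \<union> set_mset R)"
  have *: "mset_binomial M' R' = real (count M' k choose count R' k)
            * (\<Prod>i\<in>?A - {k}. real (count M' i choose count R' i))"
    if "set_mset M' \<union> set_mset R' \<subseteq> ?A" for M' R'
    using that by (simp add: mset_binomial_prod[of ?A] prod.remove[of ?A k])
  have 1: "(\<Prod>i\<in>?A - {k}. real (count M i choose count (add_mset k R) i))
     = (\<Prod>i\<in>?A - {k}. real (count M i choose count R i))"
    by (rule prod.cong) auto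
  have 2: "(\<Prod>i\<in>?A - {k}. real (count (M - {#k#}) i choose count R i))
     = (\<Prod>i\<in>?A - {k}. real (count M i choose count R i))"
    by (rule prod.cong) auto
  obtain c where c: "count M k = Suc c"
    using assms by (metis count_greater_zero_iff gr0_conv_Suc)
  have 3: "real (count R k + 1) * real (count M k choose (Suc (count R k)))
     = real (count M k) * real ((count M k - 1) choose count R k)"
    unfolding c of_nat_mult[symmetric] of_nat_eq_iff
    using Suc_times_binomial[of "count R k" c] by (simp only: Suc_eq_plus1 diff_add_inverse2)
  show ?thesis
    apply (subst *, force)
    apply (subst *, force dest: in_diffD)
    apply (subst 1)
    apply (subst 2)
    using 3 apply (simp add: mult.assoc[symmetric])
    done
qed

lemma finite_submultisets: "finite {R. R \<subseteq># (N::'b multiset)}"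
proof (induction N)
  case (add x N)
  have "{R. R \<subseteq># add_mset x N} \<subseteq> {R. R \<subseteq># N} \<union> add_mset x ` {R. R \<subseteq># N}"
  proof
    fix R assume R: "R \<in> {R. R \<subseteq># add_mset x N}"
    show "R \<in> {R. R \<subseteq># N} \<union> add_mset x ` {R. R \<subseteq># N}"
    proof (cases "x \<in># R")
      case True
      then obtain R' where "R = add_mset x R'" by (metis multi_member_split)
      with R show ?thesis by auto
    next
      case False
      have "count R i \<le> count N i" for i
        using False R mset_subset_eq_count[of R "add_mset x N" i]
        by (cases "i = x") (auto simp: not_in_iff)
      then have "R \<subseteq># N" by (simp add: subseteq_mset_def)
      then show ?thesis by simp
    qed
  qed
  then show ?case by (rule finite_subset) (use add in auto)
qed simp

text \<open>R collects the parts of M that pass through to N. The parts of M - R (the index S in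
  \<open>ycoef\<close>) are absorbed by E^+, each with factor -\<alpha>; those of N - R are created
  by E^-.\<close>

definition yterm :: "real \<Rightarrow> nat multiset \<Rightarrow> nat multiset \<Rightarrow> nat multiset \<Rightarrow> real" where
  "yterm \<alpha> M N R = mset_binomial M R * (-\<alpha>) ^ (size M - size R)
      * \<alpha> ^ (size N - size R) / zfac (N - R)"

lemma ycoef_eq_sum_yterm:
  assumes "0 \<notin># N"
  shows "ycoef \<alpha> M N = (\<Sum>R | R \<subseteq># N. yterm \<alpha> M N R)"
proof -
  have "ycoef \<alpha> M N = (\<Sum>S\<in>{S. S \<subseteq># M \<and> M - S \<subseteq># N}.
        (\<Prod>k\<in>set_mset M. real (count M k choose count S k))
        * (-\<alpha>) ^ size S * \<alpha> ^ size (N - (M - S)) / zfac (N - (M - S)))"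
    using assms by (simp add: ycoef_def)
  also have "\<dots> = (\<Sum>R | R \<subseteq># M \<and> R \<subseteq># N. yterm \<alpha> M N R)"
  proof (rule sum.reindex_bij_witness[of _ "\<lambda>R. M - R" "\<lambda>S. M - S"])
    fix S assume S: "S \<in> {S. S \<subseteq># M \<and> M - S \<subseteq># N}"
    have "mset_binomial M (M - S) = (\<Prod>k\<in>set_mset M. real (count M k choose count (M - S) k))"
      by (rule mset_binomial_prod) (auto dest: in_diffD)
    also have "\<dots> = (\<Prod>k\<in>set_mset M. real (count M k choose count S k))"
      using S by (intro prod.cong) (auto simp: subseteq_mset_def binomial_symmetric[symmetric])
    finally have "mset_binomial M (M - S) = \<dots>" .
    moreover have "size M - size (M - S) = size S"
      using S by (metis (no_types, lifting) diff_diff_cancel mem_Collect_eq size_Diff_submset size_mset_mono)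
    moreover have "size N - size (M - S) = size (N - (M - S))"
      using S by (simp add: size_Diff_submset)
    ultimately show "yterm \<alpha> M N (M - S) =
      (\<Prod>k\<in>set_mset M. real (count M k choose count S k))
        * (-\<alpha>) ^ size S * \<alpha> ^ size (N - (M - S)) / zfac (N - (M - S))"
      by (simp add: yterm_def)
  qed (auto simp: multiset_eq_iff subseteq_mset_def)
  also have "\<dots> = (\<Sum>R | R \<subseteq># N. yterm \<alpha> M N R)"
    by (rule sum.mono_neutral_left)
       (auto simp: finite_submultisets yterm_def mset_binomial_eq_0)
  finally show ?thesis .
qed

lemma ycoef_eq_0: "0 \<in># N \<Longrightarrow> ycoef \<alpha> M N = 0"
  by (simp add: ycoef_def)

lemma sum_submultisets_add_mset:
  "(\<Sum>R | R \<subseteq># add_mset k N. of_bool (k \<in># R) * f R) = (\<Sum>R | R \<subseteq># N. (f (add_mset k R) :: real))"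
proof -
  have "(\<Sum>R | R \<subseteq># add_mset k N. of_bool (k \<in># R) * f R)
      = (\<Sum>R | R \<subseteq># add_mset k N \<and> k \<in># R. f R)"
    by (rule sum.mono_neutral_cong_right) (auto simp: finite_submultisets)
  also have "\<dots> = (\<Sum>R | R \<subseteq># N. f (add_mset k R))"
    by (rule sum.reindex_bij_witness[of _ "add_mset k" "\<lambda>R. R - {#k#}"])
       (auto simp: subset_eq_diff_conv)
  finally show ?thesis .
qed

text \<open>The matrix form of \<open>[J\<^sub>k, Y\<^sub>\<alpha>(z)] = \<alpha> z\<^sup>k Y\<^sub>\<alpha>(z)\<close> for \<open>k > 0\<close> at \<open>z = 1\<close>.\<close>
lemma ycoef_annihilate:
  assumes "k > 0" "0 \<notin># N"
  shows "real (k * (count N k + 1)) * ycoef \<alpha> M (add_mset k N)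
     = real (k * count M k) * ycoef \<alpha> (M - {#k#}) N + \<alpha> * ycoef \<alpha> M N"
proof -
  let ?S = "{R. R \<subseteq># add_mset k N}"
  let ?t = "yterm \<alpha> M (add_mset k N)"
  \<comment> \<open>Each copy of k in \<open>add_mset k N\<close> is either created (outside R) or
    passed on from M (inside R). The former yield the \<alpha> term, the latter the term with k
    removed from M.\<close>
  have "real (k * (count N k + 1)) * ycoef \<alpha> M (add_mset k N)
     = (\<Sum>R\<in>?S. real (k * (count N k + 1 - count R k)) * ?t R + real (k * count R k) * ?t R)"
  proof -
    have "real (k * (count N k + 1)) * ?t R
        = real (k * (count N k + 1 - count R k)) * ?t R + real (k * count R k) * ?t R"
      if "R \<in> ?S" for R
    proof -
      have "count R k \<le> count N k + 1"
        using that mset_subset_eq_count[of R "add_mset k N" k] by simp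
      then have "k * (count N k + 1) = k * (count N k + 1 - count R k) + k * count R k"
        by (simp only: distrib_left[symmetric] le_add_diff_inverse2)
      then show ?thesis by (simp only: of_nat_add distrib_right)
    qed
    moreover have "0 \<notin># add_mset k N" using assms by simp
    ultimately show ?thesis
      unfolding ycoef_eq_sum_yterm[OF \<open>0 \<notin># add_mset k N\<close>] sum_distrib_left
      by (intro sum.cong) auto
  qed
  also have "\<dots> = (\<Sum>R\<in>?S. real (k * (count N k + 1 - count R k)) * ?t R)
       + (\<Sum>R\<in>?S. real (k * count R k) * ?t R)"
    by (rule sum.distrib)
  also have "(\<Sum>R\<in>?S. real (k * (count N k + 1 - count R k)) * ?t R)
     = (\<Sum>R | R \<subseteq># N. \<alpha> * yterm \<alpha> M N R)"
  proof (rule sum.mono_neutral_cong_right)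
    \<comment> \<open>An R not contained in N uses all \<open>count N k + 1\<close> copies of k, so
      none is left to be created and the factor is zero.\<close>
    show "\<forall>R\<in>?S - {R. R \<subseteq># N}. real (k * (count N k + 1 - count R k)) * ?t R = 0"
    proof
      fix R assume R: "R \<in> ?S - {R. R \<subseteq># N}"
      have "count R i \<le> count N i" if "i \<noteq> k" for i
        using R that mset_subset_eq_count[of R "add_mset k N" i] by simp
      then have "count R k > count N k"
        using R by (auto simp: subseteq_mset_def not_le) (metis leD)
      then show "real (k * (count N k + 1 - count R k)) * ?t R = 0" by simp
    qed
    fix R assume "R \<in> {R. R \<subseteq># N}"
    then have R: "R \<subseteq># N" by simp
    have z: "zfac (N - R) > 0" using assms by (auto intro!: zfac_pos dest: in_diffD)
    have e: "add_mset k N - R = add_mset k (N - R)"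
      using R by (simp add: multiset_eq_iff subseteq_mset_def Suc_diff_le)
    have s: "size (add_mset k N) - size R = Suc (size N - size R)"
      using R by (simp add: Suc_diff_le size_mset_mono)
    have c: "count N k + 1 - count R k = count (N - R) k + 1"
      using R by (simp add: subseteq_mset_def Suc_diff_le)
    have p: "real (k * (count (N - R) k + 1)) > 0"
      unfolding of_nat_0_less_iff using assms by simp
    show "real (k * (count N k + 1 - count R k)) * ?t R = \<alpha> * yterm \<alpha> M N R"
      unfolding yterm_def e s c zfac_add_mset using z p by (simp add: divide_simps)
  qed (auto simp: finite_submultisets intro: subset_mset.order_trans)
  also have "\<dots> = \<alpha> * ycoef \<alpha> M N"
    using assms by (simp add: ycoef_eq_sum_yterm sum_distrib_left)
  also have "(\<Sum>R\<in>?S. real (k * count R k) * ?t R)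
      = (\<Sum>R\<in>?S. of_bool (k \<in># R) * (real (k * count R k) * ?t R))"
    by (rule sum.cong) (auto simp: not_in_iff)
  also have "\<dots> = (\<Sum>R | R \<subseteq># N. real (k * count (add_mset k R) k) * ?t (add_mset k R))"
    by (rule sum_submultisets_add_mset)
  also have "\<dots> = (\<Sum>R | R \<subseteq># N. real (k * count M k) * yterm \<alpha> (M - {#k#}) N R)"
  proof (rule sum.cong)
    fix R
    show "real (k * count (add_mset k R) k) * ?t (add_mset k R)
       = real (k * count M k) * yterm \<alpha> (M - {#k#}) N R"
    proof (cases "k \<in># M")
      case True
      have *: "x * (b * p * q / z) = (x * b) * p * q / z" for x b p q z :: real by simp
      have "real (k * count (add_mset k R) k) * mset_binomial M (add_mset k R)
           = real (k * count M k) * mset_binomial (M - {#k#}) R"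
        unfolding of_nat_mult mult.assoc using mset_binomial_absorb[OF True, of R] by simp
      moreover have "size M - size (add_mset k R) = size (M - {#k#}) - size R"
        using True by (simp add: size_Diff_singleton)
      moreover have "size (add_mset k N) - size (add_mset k R) = size N - size R"
         "add_mset k N - add_mset k R = N - R" by simp_all
      ultimately show ?thesis
        unfolding yterm_def * by (simp only:)
    next
      case False
      then have "\<not> add_mset k R \<subseteq># M" by (meson mset_subset_eqD union_single_eq_member)
      then show ?thesis
        using False by (simp add: yterm_def mset_binomial_eq_0 not_in_iff)
    qed
  qed simp
  also have "\<dots> = real (k * count M k) * ycoef \<alpha> (M - {#k#}) N"
    using assms by (simp add: ycoef_eq_sum_yterm sum_distrib_left)
  finally show ?thesis by simp
qed

text \<open>The matrix form of \<open>[J\<^sub>-\<^sub>k, Y\<^sub>\<alpha>(z)] = \<alpha> z\<^sup>-\<^sup>k Y\<^sub>\<alpha>(z)\<close> for \<open>k > 0\<close> at \<open>z = 1\<close>.\<close>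
lemma ycoef_create:
  assumes "0 \<notin># N"
  shows "ycoef \<alpha> (add_mset k M) N
     = of_bool (k \<in># N) * ycoef \<alpha> M (N - {#k#}) - \<alpha> * ycoef \<alpha> M N"
proof -
  let ?S = "{R. R \<subseteq># N}"
  \<comment> \<open>By Pascal's rule the new part k is either absorbed, with factor -\<alpha>, or
    belongs to R. The second contribution is g, which reproduces \<open>yterm\<close> for N with k
    removed.\<close>
  define g where "g R = mset_binomial M (R - {#k#}) * (-\<alpha>) ^ (Suc (size M) - size R)
      * \<alpha> ^ (size N - size R) / zfac (N - R)" for R
  have "ycoef \<alpha> (add_mset k M) N = (\<Sum>R\<in>?S. - \<alpha> * yterm \<alpha> M N R + of_bool (k \<in># R) * g R)"
    unfolding ycoef_eq_sum_yterm[OF assms]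
  proof (rule sum.cong)
    fix R
    have "mset_binomial M R * (-\<alpha>) ^ (Suc (size M) - size R)
        = mset_binomial M R * (- \<alpha> * (-\<alpha>) ^ (size M - size R))"
    proof (cases "R \<subseteq># M")
      case True
      then show ?thesis by (simp add: Suc_diff_le size_mset_mono)
    qed (simp add: mset_binomial_eq_0)
    moreover have "yterm \<alpha> (add_mset k M) N R
      = (mset_binomial M R * (-\<alpha>) ^ (Suc (size M) - size R)) * \<alpha> ^ (size N - size R) / zfac (N - R)
        + of_bool (k \<in># R) * g R"
      unfolding yterm_def g_def mset_binomial_Pascal by (simp add: distrib_right add_divide_distrib)
    ultimately show "yterm \<alpha> (add_mset k M) N R = - \<alpha> * yterm \<alpha> M N R + of_bool (k \<in># R) * g R"
      unfolding yterm_def by (simp add: mult_ac)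
  qed simp
  also have "\<dots> = - \<alpha> * ycoef \<alpha> M N + (\<Sum>R\<in>?S. of_bool (k \<in># R) * g R)"
    by (simp only: sum.distrib ycoef_eq_sum_yterm[OF assms] sum_distrib_left)
  also have "(\<Sum>R\<in>?S. of_bool (k \<in># R) * g R) = of_bool (k \<in># N) * ycoef \<alpha> M (N - {#k#})"
  proof (cases "k \<in># N")
    case True
    then obtain N' where N: "N = add_mset k N'" by (metis multi_member_split)
    have "(\<Sum>R\<in>?S. of_bool (k \<in># R) * g R) = (\<Sum>R | R \<subseteq># N'. g (add_mset k R))"
      unfolding N by (rule sum_submultisets_add_mset)
    also have "\<dots> = ycoef \<alpha> M N'"
      using assms by (subst ycoef_eq_sum_yterm) (auto simp: N g_def yterm_def)
    finally show ?thesis by (simp add: N)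
  next
    case False
    then have "(\<Sum>R\<in>?S. of_bool (k \<in># R) * g R) = 0"
      by (intro sum.neutral) (auto dest: mset_subset_eqD)
    then show ?thesis using False by simp
  qed
  finally show ?thesis by simp
qed

lemma ycoef_empty: "0 \<notin># N \<Longrightarrow> ycoef \<alpha> {#} N = \<alpha> ^ size N / zfac N"
proof -
  assume N: "0 \<notin># N"
  have "(\<Sum>R | R \<subseteq># N. yterm \<alpha> {#} N R) = (\<Sum>R\<in>{{#}}. yterm \<alpha> {#} N R)"
    by (rule sum.mono_neutral_right)
       (auto simp: finite_submultisets yterm_def mset_binomial_eq_0)
  then show ?thesis using N by (simp add: ycoef_eq_sum_yterm yterm_def mset_binomial_def)
qed

text \<open>With respect to the weights, \<open>ycoef_annihilate\<close> for \<alpha> is the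
  transpose of \<open>ycoef_create\<close> for -\<alpha>. Induction over the parts of N therefore
  leaves only N empty, where all of M is absorbed.\<close>

lemma ycoef_adjoint:
  assumes "0 \<notin># M" "0 \<notin># N"
  shows "ycoef \<alpha> M N * zfac N = ycoef (-\<alpha>) N M * zfac M"
  using assms(2,1)
proof (induction N arbitrary: M)
  case empty
  have "ycoef \<alpha> M {#} = (-\<alpha>) ^ size M"
  proof (induction M)
    case empty
    then show ?case by (simp add: ycoef_empty)
  next
    case (add k M)
    then show ?case by (simp add: ycoef_create)
  qed
  then show ?case using empty zfac_pos[of M] by (simp add: ycoef_empty)
next
  case (add k N)
  have k: "k > 0" using add.prems by auto
  have "ycoef \<alpha> M (add_mset k N) * zfac (add_mset k N)
     = (real (k * (count N k + 1)) * ycoef \<alpha> M (add_mset k N)) * zfac N"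
    by (simp add: zfac_add_mset)
  also have "\<dots> = real (k * count M k) * (ycoef \<alpha> (M - {#k#}) N * zfac N) + \<alpha> * (ycoef \<alpha> M N * zfac N)"
    using add.prems k by (subst ycoef_annihilate) (auto simp: algebra_simps)
  also have "\<dots> = real (k * count M k) * (ycoef (-\<alpha>) N (M - {#k#}) * zfac (M - {#k#}))
       + \<alpha> * (ycoef (-\<alpha>) N M * zfac M)"
    using add.prems add.IH[of M] add.IH[of "M - {#k#}"] by (auto dest: in_diffD)
  also have "real (k * count M k) * (ycoef (-\<alpha>) N (M - {#k#}) * zfac (M - {#k#}))
     = of_bool (k \<in># M) * ycoef (-\<alpha>) N (M - {#k#}) * zfac M"
  proof (cases "k \<in># M")
    case True
    then obtain M' where "M = add_mset k M'" by (metis multi_member_split)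
    then show ?thesis by (simp add: zfac_add_mset)
  qed (simp add: not_in_iff)
  also have "\<dots> + \<alpha> * (ycoef (-\<alpha>) N M * zfac M) = ycoef (-\<alpha>) (add_mset k N) M * zfac M"
    using add.prems by (simp add: ycoef_create algebra_simps)
  finally show ?case .
qed

section \<open>Virasoro generators on a charge sector\<close>

definition cre :: "nat \<Rightarrow> (nat multiset \<Rightarrow> 'a::comm_ring_1) \<Rightarrow> nat multiset \<Rightarrow> 'a" where
  "cre k f N = of_bool (k \<in># N) * f (N - {#k#})"

definition ann :: "nat \<Rightarrow> (nat multiset \<Rightarrow> 'a::comm_ring_1) \<Rightarrow> nat multiset \<Rightarrow> 'a" where
  "ann k f N = of_nat (k * (count N k + 1)) * f (add_mset k N)"

text \<open>\<open>L\<^sub>1\<close> and \<open>L\<^sub>-\<^sub>1\<close> on the sector of charge \<open>\<beta>\<close>.  A term creating \<open>k\<close> vanishes at \<open>N\<close> unless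
  \<open>k \<in># N\<close>, so the Sugawara series is pointwise finite, on arbitrary coefficient functions.\<close>
definition vir_dn :: "'a \<Rightarrow> (nat multiset \<Rightarrow> 'a::comm_ring_1) \<Rightarrow> nat multiset \<Rightarrow> 'a" where
  "vir_dn \<beta> f N = \<beta> * ann 1 f N + (\<Sum>k=1..sum_mset N. cre k (ann (k + 1) f) N)"

definition vir_up :: "'a \<Rightarrow> (nat multiset \<Rightarrow> 'a::comm_ring_1) \<Rightarrow> nat multiset \<Rightarrow> 'a" where
  "vir_up \<beta> f N = \<beta> * cre 1 f N + (\<Sum>k=1..sum_mset N. cre (k + 1) (ann k f) N)"

lemma member_le_sum_mset: "k \<in># N \<Longrightarrow> k \<le> sum_mset (N :: nat multiset)"
  by (metis le_add1 multi_member_split sum_mset.add_mset)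

lemma sum_mset_minus_single: "k \<in># N \<Longrightarrow> sum_mset (N - {#k#}) + k = sum_mset (N :: nat multiset)"
  by (metis add.commute insert_DiffM sum_mset.add_mset)

lemma cre_eq_0: "k > sum_mset N \<Longrightarrow> cre k f N = 0"
  using member_le_sum_mset[of k N] by (auto simp: cre_def)

lemma vir_dn_upto:
  assumes "sum_mset N \<le> K"
  shows "vir_dn \<beta> f N = \<beta> * ann 1 f N + (\<Sum>k=1..K. cre k (ann (k + 1) f) N)"
proof -
  have "(\<Sum>k=1..sum_mset N. cre k (ann (k + 1) f) N) = (\<Sum>k=1..K. cre k (ann (k + 1) f) N)"
    using assms by (intro sum.mono_neutral_left) (auto simp: cre_eq_0)
  then show ?thesis by (simp add: vir_dn_def)
qed

lemma vir_up_upto: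
  assumes "sum_mset N \<le> K"
  shows "vir_up \<beta> f N = \<beta> * cre 1 f N + (\<Sum>k=1..K. cre (k + 1) (ann k f) N)"
proof -
  have "(\<Sum>k=1..sum_mset N. cre (k + 1) (ann k f) N) = (\<Sum>k=1..K. cre (k + 1) (ann k f) N)"
    using assms by (intro sum.mono_neutral_left) (auto simp: cre_eq_0)
  then show ?thesis by (simp add: vir_up_def)
qed

text \<open>Locality in the level: \<open>L_1\<close> at N reads f only one level higher. So
  truncated sums may replace the operators inside composites, and level-dependent factors can be
  pulled out.\<close>

lemma vir_dn_cong:
  assumes "\<And>M. sum_mset M = sum_mset N + 1 \<Longrightarrow> f M = g M"
  shows "vir_dn \<beta> f N = vir_dn \<beta> g N"
proof -
  have "ann 1 f N = ann 1 g N" by (simp add: ann_def assms)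
  moreover have "cre k (ann (k + 1) f) N = cre k (ann (k + 1) g) N" for k
  proof (cases "k \<in># N")
    case True
    then have "sum_mset (add_mset (k + 1) (N - {#k#})) = sum_mset N + 1"
      using sum_mset_minus_single[OF True] by simp
    then show ?thesis by (simp add: cre_def ann_def assms)
  qed (simp add: cre_def)
  ultimately show ?thesis by (simp add: vir_dn_def)
qed

lemma vir_up_cong:
  assumes "\<And>M. sum_mset M + 1 = sum_mset N \<Longrightarrow> f M = g M"
  shows "vir_up \<beta> f N = vir_up \<beta> g N"
proof -
  have "cre 1 f N = cre 1 g N"
  proof (cases "1 \<in># N")
    case True
    then show ?thesis using sum_mset_minus_single[OF True] by (simp add: cre_def assms)
  qed (simp add: cre_def)
  moreover have "cre (k + 1) (ann k f) N = cre (k + 1) (ann k g) N" for k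
  proof (cases "k + 1 \<in># N")
    case True
    then have "sum_mset (add_mset k (N - {#k + 1#})) + 1 = sum_mset N"
      using sum_mset_minus_single[OF True] by simp
    then show ?thesis by (simp add: cre_def ann_def assms)
  qed (simp add: cre_def)
  ultimately show ?thesis by (simp add: vir_up_def)
qed

lemma ann_ann: "ann k (ann l f) = ann l (ann k f)"
  by (rule ext, cases "k = l") (auto simp: ann_def add_mset_commute algebra_simps)

lemma cre_cre: "cre k (cre l f) = cre l (cre k f)"
proof (rule ext)
  fix N
  show "cre k (cre l f) N = cre l (cre k f) N"
  proof (cases "k = l")
    case False
    then have "l \<in># N - {#k#} \<longleftrightarrow> l \<in># N" "k \<in># N - {#l#} \<longleftrightarrow> k \<in># N"
      by (auto simp: in_diff_count simp flip: count_greater_zero_iff)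
    then show ?thesis by (auto simp: cre_def diff_right_commute add_mset_commute)
  qed simp
qed

lemma cre_ann: "cre k (ann k f) N = of_nat (k * count N k) * f N"
  by (cases "k \<in># N") (auto simp: cre_def ann_def count_eq_zero_iff[THEN iffD2])

lemma ann_cre: "ann k (cre l f) = (\<lambda>N. cre l (ann k f) N + (if k = l then of_nat k * f N else 0))"
proof (rule ext)
  fix N
  show "ann k (cre l f) N = cre l (ann k f) N + (if k = l then of_nat k * f N else 0)"
  proof (cases "k = l")
    case True
    then show ?thesis by (simp add: cre_ann) (simp add: ann_def cre_def algebra_simps)
  next
    case False
    then have "count (N - {#l#}) k = count N k" by simp
    moreover have "l \<in># N \<Longrightarrow> add_mset k N - {#l#} = add_mset k (N - {#l#})"
      using False by (simp add: multiset_eq_iff)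
    ultimately show ?thesis using False by (auto simp: ann_def cre_def)
  qed
qed

lemma ann_add: "ann k (\<lambda>N. f N + g N) = (\<lambda>N. ann k f N + ann k g N)"
  and ann_mult: "ann k (\<lambda>N. c * f N) = (\<lambda>N. c * ann k f N)"
  and ann_sum: "ann k (\<lambda>N. \<Sum>x\<in>A. h x N) = (\<lambda>N. \<Sum>x\<in>A. ann k (h x) N)"
  and cre_add: "cre k (\<lambda>N. f N + g N) = (\<lambda>N. cre k f N + cre k g N)"
  and cre_mult: "cre k (\<lambda>N. c * f N) = (\<lambda>N. c * cre k f N)"
  and cre_sum: "cre k (\<lambda>N. \<Sum>x\<in>A. h x N) = (\<lambda>N. \<Sum>x\<in>A. cre k (h x) N)"
  by (auto simp: ann_def cre_def fun_eq_iff algebra_simps sum_distrib_left sum.distrib)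

lemma sum_mset_eq_sum_count:
  assumes "sum_mset N \<le> K"
  shows "sum_mset N = (\<Sum>k=1..K. k * count N k)"
  using assms
proof (induction N)
  case (add x N)
  have "(\<Sum>k=1..K. k * count (add_mset x N) k) = (\<Sum>k=1..K. k * count N k + (if k = x then x else 0))"
    by (rule sum.cong) auto
  also have "\<dots> = sum_mset N + (if x \<in> {1..K} then x else 0)"
    using add by (simp add: sum.distrib)
  finally show ?case using add.prems by auto
qed simp

text \<open>This is [L_1, L_-1] = 2 L_0; the central term, proportional to m^3 - m, vanishes at m =
  1. In the double sum only the diagonal terms fail to commute, and they telescope to twice the
  level operator.\<close>

lemma vir_commutator:
  "vir_dn \<beta> (vir_up \<beta> f) N - vir_up \<beta> (vir_dn \<beta> f) N = (\<beta> * \<beta> + 2 * of_nat (sum_mset N)) * f N"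
proof -
  \<comment> \<open>One more than the level of N, because \<open>L_1\<close> evaluates its argument
    one level higher; a single truncation then serves both composites.\<close>
  define K where "K = sum_mset N + 1"
  define D where "D = (\<lambda>f N. \<beta> * ann 1 f N + (\<Sum>k=1..K. cre k (ann (k + 1) f) N))"
  define U where "U = (\<lambda>f N. \<beta> * cre 1 f N + (\<Sum>k=1..K. cre (k + 1) (ann k f) N))"
  have D: "sum_mset M \<le> K \<Longrightarrow> vir_dn \<beta> g M = D g M" for g M
    unfolding D_def by (rule vir_dn_upto)
  have U: "sum_mset M \<le> K \<Longrightarrow> vir_up \<beta> g M = U g M" for g M
    unfolding U_def by (rule vir_up_upto)
  have "vir_dn \<beta> (vir_up \<beta> f) N = vir_dn \<beta> (U f) N"
    by (rule vir_dn_cong) (simp add: U K_def)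
  also have "\<dots> = D (U f) N" by (simp add: D K_def)
  finally have 1: "vir_dn \<beta> (vir_up \<beta> f) N = D (U f) N" .
  have "vir_up \<beta> (vir_dn \<beta> f) N = vir_up \<beta> (D f) N"
    by (rule vir_up_cong) (simp add: D K_def)
  also have "\<dots> = U (D f) N" by (simp add: U K_def)
  finally have 2: "vir_up \<beta> (vir_dn \<beta> f) N = U (D f) N" .
  let ?E = "\<lambda>k l. cre k (ann (k + 1) (cre (l + 1) (ann l f))) N"
  let ?F = "\<lambda>k l. cre (l + 1) (ann l (cre k (ann (k + 1) f))) N"
  have DU: "D (U f) N = \<beta> * (\<beta> * ann 1 (cre 1 f) N) + \<beta> * (\<Sum>l=1..K. ann 1 (cre (l + 1) (ann l f)) N)
     + \<beta> * (\<Sum>k=1..K. cre k (ann (k + 1) (cre 1 f)) N) + (\<Sum>k=1..K. \<Sum>l=1..K. ?E k l)"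
    unfolding D_def U_def
    by (simp only: ann_add ann_mult ann_sum cre_add cre_mult cre_sum sum.distrib sum_distrib_left
        distrib_left add.assoc)
  have UD: "U (D f) N = \<beta> * (\<beta> * cre 1 (ann 1 f) N) + \<beta> * (\<Sum>l=1..K. cre (l + 1) (ann l (ann 1 f)) N)
     + \<beta> * (\<Sum>k=1..K. cre 1 (cre k (ann (k + 1) f)) N) + (\<Sum>l=1..K. \<Sum>k=1..K. ?F k l)"
    unfolding D_def U_def
    by (simp only: ann_add ann_mult ann_sum cre_add cre_mult cre_sum sum.distrib sum_distrib_left
        distrib_left add.assoc add.commute add.left_commute)
  have swap: "(\<Sum>l=1..K. \<Sum>k=1..K. ?F k l) = (\<Sum>k=1..K. \<Sum>l=1..K. ?F k l)"
    by (rule sum.swap)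
  have a1: "(\<Sum>l=1..K. ann 1 (cre (l + 1) (ann l f)) N) = (\<Sum>l=1..K. cre (l + 1) (ann l (ann 1 f)) N)"
    by (rule sum.cong) (auto simp: ann_cre ann_ann[of "Suc 0"])
  have a2: "(\<Sum>k=1..K. cre k (ann (k + 1) (cre 1 f)) N) = (\<Sum>k=1..K. cre 1 (cre k (ann (k + 1) f)) N)"
    by (rule sum.cong) (auto simp: ann_cre cre_cre[of _ "Suc 0"])
  have a3: "ann 1 (cre 1 f) N = cre 1 (ann 1 f) N + f N" by (simp add: ann_cre)
  have EF: "?E k l - ?F k l = (if l = k then of_nat (k + 1) * cre k (ann k f) N
               - of_nat k * cre (k + 1) (ann (k + 1) f) N else 0)" for k l
  proof (cases "k = l")
    case True
    have "?E k k = cre k (cre (k + 1) (ann (k + 1) (ann k f))) N + of_nat (k + 1) * cre k (ann k f) N"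
      by (simp only: ann_cre cre_add cre_mult if_True simp_thms)
    moreover have "?F k k = cre (k + 1) (cre k (ann k (ann (k + 1) f))) N
         + of_nat k * cre (k + 1) (ann (k + 1) f) N"
      by (simp only: ann_cre cre_add cre_mult if_True simp_thms)
    ultimately show ?thesis
      using True by (simp add: cre_cre[of l "Suc l"] ann_ann[of l "Suc l"])
  next
    case False
    then have "ann (k + 1) (cre (l + 1) (ann l f)) = cre (l + 1) (ann (k + 1) (ann l f))"
      "ann l (cre k (ann (k + 1) f)) = cre k (ann l (ann (k + 1) f))"
      by (auto simp: ann_cre)
    then show ?thesis using False by (simp add: cre_cre[of k] ann_ann[of l])
  qed
  let ?T = "\<lambda>k. cre k (ann k f) N"
  have tele: "(\<Sum>k=1..L. of_nat (k + 1) * ?T k - of_nat k * ?T (k + 1))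
      = 2 * (\<Sum>k=1..L. ?T k) - of_nat L * ?T (L + 1)" for L
    by (induction L) (auto simp: algebra_simps)
  have "(\<Sum>k=1..K. \<Sum>l=1..K. ?E k l) - (\<Sum>k=1..K. \<Sum>l=1..K. ?F k l)
     = (\<Sum>k=1..K. of_nat (k + 1) * ?T k - of_nat k * ?T (k + 1))"
    by (simp only: sum_subtractf[symmetric] EF, intro sum.cong) auto
  \<comment> \<open>The boundary term would create a part K + 1, which exceeds the level of
    N.\<close>
  also have "\<dots> = 2 * (\<Sum>k=1..K. ?T k)"
    unfolding tele by (simp add: K_def cre_eq_0)
  also have "(\<Sum>k=1..K. ?T k) = of_nat (\<Sum>k=1..K. k * count N k) * f N"
    by (simp only: cre_ann of_nat_sum sum_distrib_right)
  also have "(\<Sum>k=1..K. k * count N k) = sum_mset N"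
    by (rule sum_mset_eq_sum_count[symmetric]) (simp add: K_def)
  finally show ?thesis unfolding 1 2 DU UD swap a1 a2 a3 by (simp add: algebra_simps)
qed

text \<open>The normally ordered product of J_(n-k) and J_k is invariant under k -> n - k. Hence the
  Sugawara terms above and below a central block agree in pairs, which compensates the prefactor
  1/2. The block holds the terms containing J_0.\<close>

lemma infsum_int_reflection:
  fixes g :: "int \<Rightarrow> complex" and h :: "nat \<Rightarrow> complex"
  assumes "q \<le> p" and "\<And>k. k \<ge> 1 \<Longrightarrow> g (p + int k) = h k" and "\<And>k. k \<ge> 1 \<Longrightarrow> g (q - int k) = h k"
    and "\<And>k. k > K \<Longrightarrow> h k = 0"
  shows "infsum g UNIV = (\<Sum>i=q..p. g i) + 2 * (\<Sum>k=1..K. h k)"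
proof -
  let ?B = "{q - int K..p + int K}"
  have "g i = 0" if "i \<notin> ?B" for i
  proof (cases "i > p")
    case True
    then show ?thesis using that assms(1) assms(2)[of "nat (i - p)"] assms(4)[of "nat (i - p)"] by auto
  next
    case False
    then show ?thesis using that assms(1) assms(3)[of "nat (q - i)"] assms(4)[of "nat (q - i)"] by auto
  qed
  then have "(g has_sum (\<Sum>i\<in>?B. g i)) UNIV"
    by (intro has_sum_finite_neutralI) auto
  then have "infsum g UNIV = (\<Sum>i\<in>?B. g i)" by (rule infsumI)
  also have "?B = {q..p} \<union> ({p + 1..p + int K} \<union> {q - int K..q - 1})" using assms(1) by auto
  also have "(\<Sum>i\<in>\<dots>. g i) = (\<Sum>i=q..p. g i) + ((\<Sum>i=p + 1..p + int K. g i) + (\<Sum>i=q - int K..q - 1. g i))"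
    using assms(1) by (subst sum.union_disjoint; force simp: sum.union_disjoint)+
  also have "(\<Sum>i=p + 1..p + int K. g i) = (\<Sum>k=1..K. h k)"
    by (rule sum.reindex_bij_witness[of _ "\<lambda>k. p + int k" "\<lambda>i. nat (i - p)"])
       (auto simp: assms(2)[symmetric])
  also have "(\<Sum>i=q - int K..q - 1. g i) = (\<Sum>k=1..K. h k)"
    by (rule sum.reindex_bij_witness[of _ "\<lambda>k. q - int k" "\<lambda>i. nat (q - i)"])
       (auto simp: assms(3)[symmetric])
  finally show ?thesis by simp
qed

lemma Jop_ann: "k > 0 \<Longrightarrow> Jop \<alpha>0 (int k) c (j, N) = ann k (\<lambda>M. c (j, M)) N"
  by (simp add: Jop_def ann_def algebra_simps)

lemma Jop_cre: "k > 0 \<Longrightarrow> Jop \<alpha>0 (- int k) c (j, N) = cre k (\<lambda>M. c (j, M)) N"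
  by (simp add: Jop_def cre_def)

lemma Jop_0: "Jop \<alpha>0 0 c (j, N) = complex_of_real (of_int j * \<alpha>0) * c (j, N)"
  by (simp add: Jop_def)

lemma Lop_1:
  "Lop \<alpha>0 1 c (j, N) = vir_dn (complex_of_real (of_int j * \<alpha>0)) (\<lambda>M. c (j, M)) N"
proof -
  let ?f = "\<lambda>M. c (j, M)"
  let ?\<beta> = "complex_of_real (of_int j * \<alpha>0)"
  have "(\<Sum>\<^sub>\<infinity>k::int. NOJJ \<alpha>0 (1 - k) k c (j, N))
      = (\<Sum>k=0..1. NOJJ \<alpha>0 (1 - k) k c (j, N)) + 2 * (\<Sum>k=1..sum_mset N. cre k (ann (k + 1) ?f) N)"
  proof (rule infsum_int_reflection)
    fix k :: nat assume k: "k \<ge> 1"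
    show "NOJJ \<alpha>0 (1 - (1 + int k)) (1 + int k) c (j, N) = cre k (ann (k + 1) ?f) N"
      using k Jop_ann[of "k + 1" \<alpha>0 c j] by (simp add: NOJJ_def Jop_cre add.commute)
    show "NOJJ \<alpha>0 (1 - (0 - int k)) (0 - int k) c (j, N) = cre k (ann (k + 1) ?f) N"
      using k Jop_ann[of "k + 1" \<alpha>0 c j] by (simp add: NOJJ_def Jop_cre add.commute)
  qed (auto simp: cre_eq_0)
  also have "{0..1::int} = {0, 1}" by auto
  also have "(\<Sum>k\<in>{0,1}. NOJJ \<alpha>0 (1 - k) k c (j, N)) = 2 * (?\<beta> * ann 1 ?f N)"
    using Jop_ann[of 1 \<alpha>0 c j] by (simp add: NOJJ_def Jop_0)
  finally show ?thesis by (simp add: Lop_def vir_dn_def)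
qed

lemma Lop_m1:
  "Lop \<alpha>0 (-1) c (j, N) = vir_up (complex_of_real (of_int j * \<alpha>0)) (\<lambda>M. c (j, M)) N"
proof -
  let ?f = "\<lambda>M. c (j, M)"
  let ?\<beta> = "complex_of_real (of_int j * \<alpha>0)"
  have "(\<Sum>\<^sub>\<infinity>k::int. NOJJ \<alpha>0 (-1 - k) k c (j, N))
      = (\<Sum>k=-1..0. NOJJ \<alpha>0 (-1 - k) k c (j, N)) + 2 * (\<Sum>k=1..sum_mset N. cre (k + 1) (ann k ?f) N)"
  proof (rule infsum_int_reflection)
    fix k :: nat assume k: "k \<ge> 1"
    show "NOJJ \<alpha>0 (-1 - (0 + int k)) (0 + int k) c (j, N) = cre (k + 1) (ann k ?f) N"
      using k Jop_cre[of "k + 1" \<alpha>0 _ j] by (simp add: NOJJ_def Jop_ann)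
    show "NOJJ \<alpha>0 (-1 - (-1 - int k)) (-1 - int k) c (j, N) = cre (k + 1) (ann k ?f) N"
      using k Jop_cre[of "k + 1" \<alpha>0 _ j] by (simp add: NOJJ_def Jop_ann)
  qed (auto simp: cre_eq_0)
  also have "{-1..0::int} = {-1, 0}" by auto
  also have "(\<Sum>k\<in>{-1,0}. NOJJ \<alpha>0 (-1 - k) k c (j, N)) = 2 * (?\<beta> * cre 1 ?f N)"
    using Jop_cre[of 1 \<alpha>0 _ j] by (simp add: NOJJ_def Jop_0 cre_mult)
  finally show ?thesis by (simp add: Lop_def vir_up_def)
qed

lemma Lop_0:
  "Lop \<alpha>0 0 c (j, N) = complex_of_real ((of_int j * \<alpha>0)\<^sup>2 / 2 + real (sum_mset N)) * c (j, N)"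
proof -
  let ?f = "\<lambda>M. c (j, M)"
  let ?\<beta> = "complex_of_real (of_int j * \<alpha>0)"
  have "(\<Sum>\<^sub>\<infinity>k::int. NOJJ \<alpha>0 (0 - k) k c (j, N))
      = (\<Sum>k=0..0. NOJJ \<alpha>0 (0 - k) k c (j, N)) + 2 * (\<Sum>k=1..sum_mset N. cre k (ann k ?f) N)"
  proof (rule infsum_int_reflection)
    fix k :: nat assume k: "k \<ge> 1"
    show "NOJJ \<alpha>0 (0 - (0 + int k)) (0 + int k) c (j, N) = cre k (ann k ?f) N"
      using k by (simp add: NOJJ_def Jop_ann Jop_cre)
    show "NOJJ \<alpha>0 (0 - (0 - int k)) (0 - int k) c (j, N) = cre k (ann k ?f) N"
      using k by (simp add: NOJJ_def Jop_ann Jop_cre)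
  qed (auto simp: cre_eq_0)
  also have "(\<Sum>k=1..sum_mset N. cre k (ann k ?f) N) = of_nat (\<Sum>k=1..sum_mset N. k * count N k) * ?f N"
    by (simp only: cre_ann of_nat_sum sum_distrib_right)
  also have "(\<Sum>k=1..sum_mset N. k * count N k) = sum_mset N"
    by (rule sum_mset_eq_sum_count[symmetric]) simp
  also have "(\<Sum>k=0..0. NOJJ \<alpha>0 (0 - k) k c (j, N)) = ?\<beta>\<^sup>2 * ?f N"
    by (simp add: NOJJ_def Jop_0 power2_eq_square)
  finally show ?thesis by (simp add: Lop_def algebra_simps del: of_nat_sum_mset)
qed

section \<open>Covariance of the vertex operator\<close>

declare of_nat_sum_mset [simp del]

lemma vir_dn_scaled:
  assumes "\<And>M. sum_mset M = sum_mset N + 1 \<Longrightarrow> g M = c * f M"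
  shows "vir_dn \<beta> g N = c * vir_dn \<beta> f N"
proof -
  have "vir_dn \<beta> g N = vir_dn \<beta> (\<lambda>M. c * f M) N"
    by (rule vir_dn_cong) (rule assms)
  also have "\<dots> = c * vir_dn \<beta> f N"
    by (simp add: vir_dn_def ann_mult cre_mult sum_distrib_left algebra_simps)
  finally show ?thesis .
qed

lemma vir_up_scaled:
  assumes "\<And>M. sum_mset M + 1 = sum_mset N \<Longrightarrow> g M = c * f M"
  shows "vir_up \<beta> g N = c * vir_up \<beta> f N"
proof -
  have "vir_up \<beta> g N = vir_up \<beta> (\<lambda>M. c * f M) N"
    by (rule vir_up_cong) (rule assms)
  also have "\<dots> = c * vir_up \<beta> f N"
    by (simp add: vir_up_def ann_mult cre_mult sum_distrib_left algebra_simps)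
  finally show ?thesis .
qed

text \<open>The scalar c stands for factors that are constant on the one level being read, in
  particular the selection rule of a field kernel.\<close>

lemma vir_dn_scaled_real:
  assumes "\<And>M. sum_mset M = sum_mset N + 1 \<Longrightarrow> g M = complex_of_real (c * f M)"
  shows "vir_dn (of_real \<beta>) g N = of_real (c * vir_dn \<beta> f N)"
proof -
  have "vir_dn (of_real \<beta>) g N = of_real c * vir_dn (of_real \<beta>) (\<lambda>M. of_real (f M)) N"
    by (rule vir_dn_scaled) (simp add: assms)
  also have "vir_dn (of_real \<beta>) (\<lambda>M. complex_of_real (f M)) N = of_real (vir_dn \<beta> f N)"
    by (simp add: vir_dn_def ann_def cre_def)
  finally show ?thesis by simp
qed

lemma vir_up_scaled_real:
  assumes "\<And>M. sum_mset M + 1 = sum_mset N \<Longrightarrow> g M = complex_of_real (c * f M)"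
  shows "vir_up (of_real \<beta>) g N = of_real (c * vir_up \<beta> f N)"
proof -
  have "vir_up (of_real \<beta>) g N = of_real c * vir_up (of_real \<beta>) (\<lambda>M. of_real (f M)) N"
    by (rule vir_up_scaled) (simp add: assms)
  also have "vir_up (of_real \<beta>) (\<lambda>M. complex_of_real (f M)) N = of_real (vir_up \<beta> f N)"
    by (simp add: vir_up_def ann_def cre_def)
  finally show ?thesis by simp
qed

text \<open>The adjoint of J_-k Y_-\<alpha> is Y_\<alpha> J_k, and J_k removes a part k from M with
  k times its multiplicity as coefficient.\<close>

lemma zfac_cre_ycoef:
  assumes "0 \<notin># M" "0 \<notin># N"
  shows "zfac M * cre k (ycoef (-\<alpha>) N) M = real (k * count M k) * ycoef \<alpha> (M - {#k#}) N * zfac N"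
proof (cases "k \<in># M")
  case True
  then obtain M' where M: "M = add_mset k M'" by (metis multi_member_split)
  have "ycoef \<alpha> M' N * zfac N = ycoef (-\<alpha>) N M' * zfac M'"
    using assms by (intro ycoef_adjoint) (auto simp: M)
  then show ?thesis by (simp add: M cre_def zfac_add_mset)
qed (simp add: cre_def not_in_iff count_eq_zero_iff[THEN iffD2])

lemma zfac_cre_ann_ycoef:
  assumes "0 \<notin># M" "0 \<notin># N" "k > 0"
  shows "zfac M * cre l (ann k (ycoef (-\<alpha>) N)) M
     = real (l * count M l) * ycoef \<alpha> (add_mset k (M - {#l#})) N * zfac N"
proof (cases "l \<in># M")
  case True
  then obtain M' where M: "M = add_mset l M'" by (metis multi_member_split)
  have "ycoef \<alpha> (add_mset k M') N * zfac N = ycoef (-\<alpha>) N (add_mset k M') * zfac (add_mset k M')"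
    using assms by (intro ycoef_adjoint) (auto simp: M)
  then show ?thesis by (simp add: M cre_def ann_def zfac_add_mset)
qed (simp add: cre_def count_eq_zero_iff[THEN iffD2])

lemma cre_ann_ycoef:
  assumes "0 \<notin># N" "l > 0"
  shows "cre k (ann l (ycoef \<alpha> M)) N = of_bool (k \<in># N) *
     (real (l * count M l) * ycoef \<alpha> (M - {#l#}) (N - {#k#}) + \<alpha> * ycoef \<alpha> M (N - {#k#}))"
proof -
  have "0 \<notin># N - {#k#}" using assms by (meson in_diffD)
  from ycoef_annihilate[OF assms(2) this] show ?thesis unfolding cre_def ann_def by (simp only:)
qed

text \<open>Sum over k of [J_-k J_k, Y] = \<alpha> (J_-k Y + Y J_k), the commutator with the level
  operator. In the proof \<open>?R\<close> is the matrix element of J_-k Y J_k, which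
  cancels.\<close>

lemma ycoef_degree:
  assumes "0 \<notin># M" "0 \<notin># N" "sum_mset M \<le> K" "sum_mset N \<le> K"
  shows "(real (sum_mset N) - real (sum_mset M)) * ycoef \<alpha> M N
     = \<alpha> * (\<Sum>k=1..K. of_bool (k \<in># N) * ycoef \<alpha> M (N - {#k#}))
       + \<alpha> * (\<Sum>k=1..K. real (k * count M k) * ycoef \<alpha> (M - {#k#}) N)"
proof -
  let ?R = "\<lambda>k. of_bool (k \<in># N) * real (k * count M k) * ycoef \<alpha> (M - {#k#}) (N - {#k#})"
  have "real (sum_mset N) * ycoef \<alpha> M N = real (\<Sum>k=1..K. k * count N k) * ycoef \<alpha> M N"
    using sum_mset_eq_sum_count[OF assms(4)] by simp
  also have "\<dots> = (\<Sum>k=1..K. cre k (ann k (ycoef \<alpha> M)) N)"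
    by (simp only: cre_ann of_nat_sum sum_distrib_right)
  also have "\<dots> = (\<Sum>k=1..K. ?R k + \<alpha> * (of_bool (k \<in># N) * ycoef \<alpha> M (N - {#k#})))"
    using assms by (intro sum.cong) (auto simp: cre_ann_ycoef)
  finally have 1: "real (sum_mset N) * ycoef \<alpha> M N
     = (\<Sum>k=1..K. ?R k) + \<alpha> * (\<Sum>k=1..K. of_bool (k \<in># N) * ycoef \<alpha> M (N - {#k#}))"
    by (simp only: sum.distrib sum_distrib_left)
  have "real (sum_mset M) * ycoef \<alpha> M N = real (\<Sum>k=1..K. k * count M k) * ycoef \<alpha> M N"
    using sum_mset_eq_sum_count[OF assms(3)] by simp
  also have "\<dots> = (\<Sum>k=1..K. real (k * count M k) * ycoef \<alpha> M N)"
    by (simp only: of_nat_sum sum_distrib_right)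
  also have "\<dots> = (\<Sum>k=1..K. ?R k - \<alpha> * (real (k * count M k) * ycoef \<alpha> (M - {#k#}) N))"
  proof (rule sum.cong)
    fix k
    show "real (k * count M k) * ycoef \<alpha> M N
        = ?R k - \<alpha> * (real (k * count M k) * ycoef \<alpha> (M - {#k#}) N)"
    proof (cases "k \<in># M")
      case True
      then have *: "ycoef \<alpha> M N = of_bool (k \<in># N) * ycoef \<alpha> (M - {#k#}) (N - {#k#})
           - \<alpha> * ycoef \<alpha> (M - {#k#}) N"
        using ycoef_create[OF assms(2), of \<alpha> k "M - {#k#}"] by simp
      show ?thesis unfolding * by (simp only: algebra_simps)
    qed (simp add: count_eq_zero_iff[THEN iffD2])
  qed simp
  finally have 2: "real (sum_mset M) * ycoef \<alpha> M N
     = (\<Sum>k=1..K. ?R k) - \<alpha> * (\<Sum>k=1..K. real (k * count M k) * ycoef \<alpha> (M - {#k#}) N)"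
    by (simp only: sum_subtractf sum_distrib_left)
  show ?thesis unfolding left_diff_distrib 1 2 by simp
qed

text \<open>The covariance \<open>[L\<^sub>1, Y\<^sub>\<alpha>(z)] = (z\<^sup>2 \<partial> + \<alpha>\<^sup>2 z) Y\<^sub>\<alpha>(z)\<close> in matrix form; the second summand is
  \<open>Y\<^sub>\<alpha> L\<^sub>1\<close>, moved to the row index by taking adjoints.\<close>
lemma ycoef_vir_dn:
  assumes "0 \<notin># M" "0 \<notin># N"
  shows "zfac N * vir_dn (\<beta> + \<alpha>) (ycoef \<alpha> M) N - zfac M * vir_up \<beta> (ycoef (-\<alpha>) N) M
     = (real (sum_mset N) - real (sum_mset M) + \<alpha> * \<beta> + \<alpha>\<^sup>2) * (ycoef \<alpha> M N * zfac N)"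
proof -
  let ?y = "ycoef \<alpha> M N"
  define K where "K = sum_mset M + sum_mset N"
  \<comment> \<open>Matrix elements at z = 1: P is J_-k Y, Q is Y J_k and R is J_-k Y J_(k+1). R
    occurs in both L_1 Y and Y L_1 and cancels; what remains is \<open>ycoef_degree\<close> up to an
    index shift in Q.\<close>
  define P where "P k = of_bool (k \<in># N) * ycoef \<alpha> M (N - {#k#})" for k
  define Q where "Q k = real (k * count M k) * ycoef \<alpha> (M - {#k#}) N" for k
  define R where "R k = of_bool (k \<in># N) * real ((k + 1) * count M (k + 1))
       * ycoef \<alpha> (M - {#k + 1#}) (N - {#k#})" for k
  have a1: "ann 1 (ycoef \<alpha> M) N = Q 1 + \<alpha> * ?y"
    using ycoef_annihilate[of 1 N \<alpha> M] assms by (simp add: ann_def Q_def)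
  have a2: "cre k (ann (k + 1) (ycoef \<alpha> M)) N = R k + \<alpha> * P k" for k
    using assms by (subst cre_ann_ycoef) (auto simp: R_def P_def)
  have dn: "vir_dn (\<beta> + \<alpha>) (ycoef \<alpha> M) N = (\<beta> + \<alpha>) * (Q 1 + \<alpha> * ?y) + ((\<Sum>k=1..K. R k) + \<alpha> * (\<Sum>k=1..K. P k))"
    by (subst vir_dn_upto[of _ K]) (simp_all only: a1 a2 sum.distrib sum_distrib_left K_def le_add2)
  have b1: "zfac M * cre 1 (ycoef (-\<alpha>) N) M = Q 1 * zfac N"
    using zfac_cre_ycoef[OF assms, of 1 \<alpha>] by (simp add: Q_def)
  have b2: "zfac M * cre (k + 1) (ann k (ycoef (-\<alpha>) N)) M = (R k - \<alpha> * Q (k + 1)) * zfac N"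
    if "k \<in> {1..K}" for k
  proof -
    have "zfac M * cre (k + 1) (ann k (ycoef (-\<alpha>) N)) M
       = real ((k + 1) * count M (k + 1)) * ycoef \<alpha> (add_mset k (M - {#k + 1#})) N * zfac N"
      using assms that by (intro zfac_cre_ann_ycoef) auto
    also have "real ((k + 1) * count M (k + 1)) * ycoef \<alpha> (add_mset k (M - {#k + 1#})) N
       = R k - \<alpha> * Q (k + 1)"
      unfolding ycoef_create[OF assms(2)] R_def Q_def by (simp only: algebra_simps)
    finally show ?thesis .
  qed
  have "zfac M * vir_up \<beta> (ycoef (-\<alpha>) N) M
      = \<beta> * (zfac M * cre 1 (ycoef (-\<alpha>) N) M) + (\<Sum>k=1..K. zfac M * cre (k + 1) (ann k (ycoef (-\<alpha>) N)) M)"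
    by (subst vir_up_upto[of _ K]) (simp_all add: K_def sum_distrib_left distrib_left)
  also have "(\<Sum>k=1..K. zfac M * cre (k + 1) (ann k (ycoef (-\<alpha>) N)) M)
      = (\<Sum>k=1..K. (R k - \<alpha> * Q (k + 1)) * zfac N)"
    by (rule sum.cong[OF refl b2])
  also have "\<dots> = ((\<Sum>k=1..K. R k) - \<alpha> * (\<Sum>k=1..K. Q (k + 1))) * zfac N"
    by (simp only: sum_distrib_right[symmetric] sum_distrib_left sum_subtractf)
  also have "\<beta> * (zfac M * cre 1 (ycoef (-\<alpha>) N) M) = \<beta> * Q 1 * zfac N"
    by (simp only: b1 mult.assoc)
  finally have up: "zfac M * vir_up \<beta> (ycoef (-\<alpha>) N) M
      = \<beta> * Q 1 * zfac N + ((\<Sum>k=1..K. R k) - \<alpha> * (\<Sum>k=1..K. Q (k + 1))) * zfac N" .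
  have "K + 1 \<notin># M" using member_le_sum_mset[of "K + 1" M] by (auto simp: K_def)
  then have "Q (K + 1) = 0" by (simp only: Q_def not_in_iff mult_zero_right of_nat_0 mult_zero_left)
  moreover have "Q 1 + (\<Sum>k=1..L. Q (k + 1)) = (\<Sum>k=1..L. Q k) + Q (L + 1)" for L
    by (induction L) simp_all
  from this[of K] have "Q 1 + (\<Sum>k=1..K. Q (k + 1)) = (\<Sum>k=1..K. Q k) + Q (K + 1)" .
  ultimately have QQ: "(\<Sum>k=1..K. Q (k + 1)) = (\<Sum>k=1..K. Q k) - Q 1"
    by linarith
  have "(real (sum_mset N) - real (sum_mset M)) * ?y = \<alpha> * (\<Sum>k=1..K. P k) + \<alpha> * (\<Sum>k=1..K. Q k)"
    unfolding P_def Q_def by (rule ycoef_degree) (use assms in \<open>auto simp: K_def\<close>)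
  then have "(real (sum_mset N) - real (sum_mset M) + \<alpha> * \<beta> + \<alpha>\<^sup>2) * (?y * zfac N)
     = (\<alpha> * (\<Sum>k=1..K. P k) + \<alpha> * (\<Sum>k=1..K. Q k) + (\<alpha> * \<beta> + \<alpha>\<^sup>2) * ?y) * zfac N"
    by (simp add: distrib_right mult.assoc[symmetric])
  then show ?thesis unfolding dn up QQ by (simp add: algebra_simps power2_eq_square)
qed

text \<open>The transpose of \<open>ycoef_vir_dn\<close>, taken for -\<alpha> at charge \<beta> +
  \<alpha>; the charge shift cancels \<alpha>^2.\<close>

lemma ycoef_vir_up:
  assumes "0 \<notin># M" "0 \<notin># N"
  shows "zfac N * vir_up (\<beta> + \<alpha>) (ycoef \<alpha> M) N - zfac M * vir_dn \<beta> (ycoef (-\<alpha>) N) M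
     = (real (sum_mset N) - real (sum_mset M) + \<alpha> * \<beta>) * (ycoef \<alpha> M N * zfac N)"
  using ycoef_vir_dn[OF assms(2,1), of "\<beta> + \<alpha>" "-\<alpha>"] ycoef_adjoint[OF assms, of \<alpha>]
  by (simp add: algebra_simps power2_eq_square)

section \<open>The two-chirality fields as explicit kernels\<close>

definition tweight :: "tidx \<Rightarrow> real" where
  "tweight i = zfac (snd (fst i)) * zfac (snd (snd i))"

text \<open>The first index is the column. The exponents \<alpha>\<beta> + d cancel between two
  factors of equal charge, so the selection rule is a condition on integers.\<close>

definition phi_kernel :: "real \<Rightarrow> int \<Rightarrow> int \<Rightarrow> tidx \<Rightarrow> tidx \<Rightarrow> real" where
  "phi_kernel \<alpha>0 a s = (\<lambda>((j1, M1), (j2, M2)) ((k1, N1), (k2, N2)).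
     of_bool (k1 = j1 + a \<and> k2 = j2 + a \<and>
       s = int (sum_mset M1) - int (sum_mset N1) - int (sum_mset M2) + int (sum_mset N2))
     * (ycoef (of_int a * \<alpha>0) M1 N1 * ycoef (of_int a * \<alpha>0) M2 N2))"

definition good :: "tidx \<Rightarrow> bool" where
  "good e \<longleftrightarrow> fst (fst e) = fst (snd e) \<and> 0 \<notin># snd (fst e) \<and> 0 \<notin># snd (snd e)"

text \<open>For a given row and column at most one mode t contributes, so both infinite sums
  collapse to a finite sum over the support of \<Psi>.\<close>

lemma Phi_eq_sum_kernel:
  assumes "inD \<Psi>"
  shows "Phi \<alpha>0 a s \<Psi> i = (\<Sum>e | \<Psi> e \<noteq> 0. \<Psi> e * complex_of_real (phi_kernel \<alpha>0 a s e i))"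
proof -
  obtain k1 N1 k2 N2 where i: "i = ((k1, N1), (k2, N2))" by (metis prod.collapse)
  let ?S = "{e. \<Psi> e \<noteq> 0}"
  have fin: "finite ?S" using assms by (simp add: inD_def)
  define h where "h = (\<lambda>p. ((k1 - a, fst p), (k2 - a, snd p)) :: tidx)"
  have inj: "inj h" by (auto simp: h_def inj_on_def prod_eq_iff)
  define P where "P = {p. \<Psi> (h p) \<noteq> 0}"
  have finP: "finite P"
    unfolding P_def using finite_vimageI[OF fin inj] by (simp add: vimage_def)
  define \<alpha> where "\<alpha> = of_int a * \<alpha>0"
  \<comment> \<open>The only mode at which the first factor can map the partition of p to
    N1.\<close>
  define tt where "tt p = real (sum_mset (fst p)) - real (sum_mset N1)
      - \<alpha> * (of_int (k1 - a) * \<alpha>0) - \<alpha>\<^sup>2 / 2" for p :: "nat multiset \<times> nat multiset"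
  let ?F = "\<lambda>t p. complex_of_real (Ymat \<alpha>0 a (k1 - a) t (fst p) N1 * Ymat \<alpha>0 a (k2 - a) (t - of_int s) (snd p) N2)
       * \<Psi> (h p)"
  let ?G = "\<lambda>p. \<Psi> (h p) * complex_of_real (phi_kernel \<alpha>0 a s (h p) i)"
  have F: "?F t p = (if t = tt p then ?G p else 0)"
    if "p \<in> P" for t p
  proof -
    let ?c = "s = int (sum_mset (fst p)) - int (sum_mset N1) - int (sum_mset (snd p)) + int (sum_mset N2)"
    have k: "k1 = k2" using assms that unfolding P_def inD_def h_def by force
    have "(tt p - of_int s = real (sum_mset (snd p)) - real (sum_mset N2)
      - \<alpha> * (of_int (k2 - a) * \<alpha>0) - \<alpha>\<^sup>2 / 2) \<longleftrightarrow>
      real_of_int s = real_of_int (int (sum_mset (fst p)) - int (sum_mset N1) - int (sum_mset (snd p)) + int (sum_mset N2))"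
      unfolding tt_def k by auto
    then have "Ymat \<alpha>0 a (k2 - a) (tt p - of_int s) (snd p) N2 = (if ?c then ycoef \<alpha> (snd p) N2 else 0)"
      unfolding of_int_eq_iff by (simp add: Ymat_def Let_def \<alpha>_def)
    moreover have "Ymat \<alpha>0 a (k1 - a) t (fst p) N1 = (if t = tt p then ycoef \<alpha> (fst p) N1 else 0)"
      by (simp add: Ymat_def Let_def \<alpha>_def tt_def)
    moreover have "phi_kernel \<alpha>0 a s (h p) i = of_bool ?c * (ycoef \<alpha> (fst p) N1 * ycoef \<alpha> (snd p) N2)"
      by (simp add: phi_kernel_def h_def i \<alpha>_def)
    ultimately show ?thesis by (cases "t = tt p"; cases ?c) (simp_all add: h_def)
  qed
  have inner: "(\<Sum>\<^sub>\<infinity>p. ?F t p) = (\<Sum>p\<in>P. ?F t p)" for t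
  proof (rule infsumI, rule has_sum_finite_neutralI)
    fix p assume "p \<in> UNIV - P"
    then show "?F t p = 0" by (simp add: P_def)
  qed (use finP in auto)
  have "Phi \<alpha>0 a s \<Psi> i = (\<Sum>\<^sub>\<infinity>t. \<Sum>\<^sub>\<infinity>p. ?F t p)"
    by (simp add: Phi_def i h_def)
  also have "\<dots> = (\<Sum>\<^sub>\<infinity>t. \<Sum>p\<in>P. if t = tt p then ?G p else 0)"
    unfolding inner by (intro infsum_cong sum.cong refl F)
  also have "\<dots> = (\<Sum>t\<in>tt ` P. \<Sum>p\<in>P. if t = tt p then ?G p else 0)"
  proof (rule infsumI, rule has_sum_finite_neutralI)
    fix t assume "t \<in> UNIV - tt ` P"
    then show "(\<Sum>p\<in>P. if t = tt p then ?G p else 0) = 0" by (intro sum.neutral) auto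
  qed (use finP in auto)
  also have "\<dots> = (\<Sum>p\<in>P. \<Sum>t\<in>tt ` P. if t = tt p then ?G p else 0)" by (rule sum.swap)
  also have "\<dots> = (\<Sum>p\<in>P. ?G p)"
    using finP by (intro sum.cong) auto
  also have "\<dots> = (\<Sum>e\<in>h ` P. \<Psi> e * complex_of_real (phi_kernel \<alpha>0 a s e i))"
    using inj by (subst sum.reindex) (auto intro: inj_on_subset)
  also have "\<dots> = (\<Sum>e | \<Psi> e \<noteq> 0. \<Psi> e * complex_of_real (phi_kernel \<alpha>0 a s e i))"
  proof (rule sum.mono_neutral_left[OF fin])
    show "h ` P \<subseteq> ?S" by (auto simp: P_def)
    show "\<forall>e\<in>?S - h ` P. \<Psi> e * complex_of_real (phi_kernel \<alpha>0 a s e i) = 0"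
    proof
      fix e assume e: "e \<in> ?S - h ` P"
      obtain j1 M1 j2 M2 where e': "e = ((j1, M1), (j2, M2))" by (metis prod.collapse)
      have "\<not> (k1 = j1 + a \<and> k2 = j2 + a)"
      proof
        assume "k1 = j1 + a \<and> k2 = j2 + a"
        then have "e = h (M1, M2)" by (simp add: h_def e')
        with e show False by (auto simp: P_def)
      qed
      then show "\<Psi> e * complex_of_real (phi_kernel \<alpha>0 a s e i) = 0"
        by (auto simp: phi_kernel_def e' i)
    qed
  qed
  finally show ?thesis .
qed

lemma inD_good: "inD \<Psi> \<Longrightarrow> \<Psi> e \<noteq> 0 \<Longrightarrow> good e"
  unfolding inD_def good_def by (metis prod.collapse)

definition A_dn :: "real \<Rightarrow> tvec \<Rightarrow> tvec" where
  "A_dn \<alpha>0 \<Psi> = (\<lambda>i. lift1 (Lop \<alpha>0 1) \<Psi> i + lift2 (Lop \<alpha>0 (-1)) \<Psi> i)"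

definition A_up :: "real \<Rightarrow> tvec \<Rightarrow> tvec" where
  "A_up \<alpha>0 \<Psi> = (\<lambda>i. lift1 (Lop \<alpha>0 (-1)) \<Psi> i + lift2 (Lop \<alpha>0 1) \<Psi> i)"

lemma A_dn_eq:
  "A_dn \<alpha>0 g ((j1, N1), (j2, N2)) =
     vir_dn (of_real (of_int j1 * \<alpha>0)) (\<lambda>M. g ((j1, M), (j2, N2))) N1
     + vir_up (of_real (of_int j2 * \<alpha>0)) (\<lambda>M. g ((j1, N1), (j2, M))) N2"
  by (simp only: A_dn_def lift1_def lift2_def Lop_1 Lop_m1 prod.case)

lemma A_up_eq:
  "A_up \<alpha>0 g ((j1, N1), (j2, N2)) =
     vir_up (of_real (of_int j1 * \<alpha>0)) (\<lambda>M. g ((j1, M), (j2, N2))) N1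
     + vir_dn (of_real (of_int j2 * \<alpha>0)) (\<lambda>M. g ((j1, N1), (j2, M))) N2"
  by (simp only: A_up_def lift1_def lift2_def Lop_1 Lop_m1 prod.case)

text \<open>Matrix elements of \<open>[A\<^sub>\<plusminus>\<^sub>1, \<Phi>\<^sub>a\<^sub>,\<^sub>\<mp>\<^sub>1]\<close>, which do not depend on the sign.\<close>
definition comm_kernel :: "real \<Rightarrow> int \<Rightarrow> tidx \<Rightarrow> tidx \<Rightarrow> real" where
  "comm_kernel \<alpha>0 a e i = tweight i * phi_kernel \<alpha>0 a 0 e i *
     (2 * (real (sum_mset (snd (fst i))) - real (sum_mset (snd (fst e))))
      + 2 * (of_int a * \<alpha>0) * (of_int (fst (fst e)) * \<alpha>0) + (of_int a * \<alpha>0)\<^sup>2)"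

text \<open>A free generator acts on one tensor factor at a time, and the adjoint relation carries
  the matrix element of the other factor from e to i. One factor then contributes
  \<open>ycoef_vir_dn\<close>, the other \<open>ycoef_vir_up\<close>; the sign decides
  which.\<close>

lemma comm_kernel_eq:
  assumes "good e" "good i"
  shows "of_real (tweight i) * A_dn \<alpha>0 (\<lambda>i. of_real (phi_kernel \<alpha>0 a (-1) e i)) i
           - of_real (tweight e) * A_up \<alpha>0 (\<lambda>e. of_real (phi_kernel \<alpha>0 (-a) 1 i e)) e
         = of_real (comm_kernel \<alpha>0 a e i)" (is ?dn)
    and "of_real (tweight i) * A_up \<alpha>0 (\<lambda>i. of_real (phi_kernel \<alpha>0 a 1 e i)) i
           - of_real (tweight e) * A_dn \<alpha>0 (\<lambda>e. of_real (phi_kernel \<alpha>0 (-a) (-1) i e)) e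
         = of_real (comm_kernel \<alpha>0 a e i)" (is ?up)
proof -
  obtain j M1 M2 where e: "e = ((j, M1), (j, M2))" and M: "0 \<notin># M1" "0 \<notin># M2"
    using assms(1) unfolding good_def by (metis prod.collapse)
  obtain k N1 N2 where i: "i = ((k, N1), (k, N2))" and N: "0 \<notin># N1" "0 \<notin># N2"
    using assms(2) unfolding good_def by (metis prod.collapse)
  have "?dn \<and> ?up"
  proof (cases "k = j + a")
    case False
    then have "phi_kernel \<alpha>0 a s e ((k, N), x) = 0" "phi_kernel \<alpha>0 a s e (x, (k, N)) = 0"
      "phi_kernel \<alpha>0 (-a) s i ((j, N), x) = 0" "phi_kernel \<alpha>0 (-a) s i (x, (j, N)) = 0" for s N x
      by (auto simp: phi_kernel_def e i split: prod.splits)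
    moreover have "vir_dn \<beta> (\<lambda>_. 0) N = (0::complex)" "vir_up \<beta> (\<lambda>_. 0) N = (0::complex)" for \<beta> N
      by (auto simp: vir_dn_def vir_up_def ann_def cre_def)
    ultimately show ?thesis
      unfolding e i A_dn_eq A_up_eq comm_kernel_def by (simp add: e i)
  next
    case True
    define \<alpha> where "\<alpha> = of_int a * \<alpha>0"
    define \<beta> where "\<beta> = of_int j * \<alpha>0"
    have k: "of_int k * \<alpha>0 = \<beta> + \<alpha>" by (simp add: True \<alpha>_def \<beta>_def algebra_simps)
    \<comment> \<open>The generator changes one level by one and the field mode compensates this, so
      all terms share the selection rule of mode 0: equal level changes in both factors.\<close>
    define q :: real where "q = of_bool (int (sum_mset M1) - int (sum_mset N1) = int (sum_mset M2) - int (sum_mset N2))"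
    let ?y = "ycoef \<alpha>" let ?y' = "ycoef (-\<alpha>)"
    have dn1: "vir_dn (of_real (of_int k * \<alpha>0)) (\<lambda>N. complex_of_real (phi_kernel \<alpha>0 a (-1) e ((k, N), (k, N2)))) N1
        = of_real (q * ?y M2 N2 * vir_dn (\<beta> + \<alpha>) (?y M1) N1)"
      unfolding k by (rule vir_dn_scaled_real)
         (auto simp: phi_kernel_def e True q_def \<alpha>_def)
    have dn2: "vir_up (of_real (of_int k * \<alpha>0)) (\<lambda>N. complex_of_real (phi_kernel \<alpha>0 a (-1) e ((k, N1), (k, N)))) N2
        = of_real (q * ?y M1 N1 * vir_up (\<beta> + \<alpha>) (?y M2) N2)"
      unfolding k by (rule vir_up_scaled_real)
         (auto simp: phi_kernel_def e True q_def \<alpha>_def)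
    have dn3: "vir_up (of_real (of_int j * \<alpha>0)) (\<lambda>N. complex_of_real (phi_kernel \<alpha>0 (-a) 1 i ((j, N), (j, M2)))) M1
        = of_real (q * ?y' N2 M2 * vir_up \<beta> (?y' N1) M1)"
      unfolding \<beta>_def[symmetric] by (rule vir_up_scaled_real)
         (auto simp: phi_kernel_def i True q_def \<alpha>_def)
    have dn4: "vir_dn (of_real (of_int j * \<alpha>0)) (\<lambda>N. complex_of_real (phi_kernel \<alpha>0 (-a) 1 i ((j, M1), (j, N)))) M2
        = of_real (q * ?y' N1 M1 * vir_dn \<beta> (?y' N2) M2)"
      unfolding \<beta>_def[symmetric] by (rule vir_dn_scaled_real)
         (auto simp: phi_kernel_def i True q_def \<alpha>_def)
    have up1: "vir_up (of_real (of_int k * \<alpha>0)) (\<lambda>N. complex_of_real (phi_kernel \<alpha>0 a 1 e ((k, N), (k, N2)))) N1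
        = of_real (q * ?y M2 N2 * vir_up (\<beta> + \<alpha>) (?y M1) N1)"
      unfolding k by (rule vir_up_scaled_real)
         (auto simp: phi_kernel_def e True q_def \<alpha>_def)
    have up2: "vir_dn (of_real (of_int k * \<alpha>0)) (\<lambda>N. complex_of_real (phi_kernel \<alpha>0 a 1 e ((k, N1), (k, N)))) N2
        = of_real (q * ?y M1 N1 * vir_dn (\<beta> + \<alpha>) (?y M2) N2)"
      unfolding k by (rule vir_dn_scaled_real)
         (auto simp: phi_kernel_def e True q_def \<alpha>_def)
    have up3: "vir_dn (of_real (of_int j * \<alpha>0)) (\<lambda>N. complex_of_real (phi_kernel \<alpha>0 (-a) (-1) i ((j, N), (j, M2)))) M1
        = of_real (q * ?y' N2 M2 * vir_dn \<beta> (?y' N1) M1)"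
      unfolding \<beta>_def[symmetric] by (rule vir_dn_scaled_real)
         (auto simp: phi_kernel_def i True q_def \<alpha>_def)
    have up4: "vir_up (of_real (of_int j * \<alpha>0)) (\<lambda>N. complex_of_real (phi_kernel \<alpha>0 (-a) (-1) i ((j, M1), (j, N)))) M2
        = of_real (q * ?y' N1 M1 * vir_up \<beta> (?y' N2) M2)"
      unfolding \<beta>_def[symmetric] by (rule vir_up_scaled_real)
         (auto simp: phi_kernel_def i True q_def \<alpha>_def)
    have adj1: "?y' N1 M1 * zfac M1 = ?y M1 N1 * zfac N1" and adj2: "?y' N2 M2 * zfac M2 = ?y M2 N2 * zfac N2"
      using ycoef_adjoint[OF M(1) N(1), of \<alpha>] ycoef_adjoint[OF M(2) N(2), of \<alpha>] by simp_all
    let ?\<nu>1 = "real (sum_mset N1) - real (sum_mset M1)" and ?\<nu>2 = "real (sum_mset N2) - real (sum_mset M2)"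
    \<comment> \<open>Where q is nonzero the two level changes agree, so their sum replaces twice
      the first. This form is symmetric in the factors, as both signs require.\<close>
    have C: "comm_kernel \<alpha>0 a e i = q * ((?y M1 N1 * zfac N1) * (?y M2 N2 * zfac N2) * (?\<nu>1 + ?\<nu>2 + 2 * \<alpha> * \<beta> + \<alpha>\<^sup>2))"
    proof (cases "q = 0")
      case True
      then have "phi_kernel \<alpha>0 a 0 e i = 0" by (auto simp: phi_kernel_def e i q_def split: if_splits)
      then show ?thesis by (simp add: comm_kernel_def True)
    next
      case False
      then have q: "int (sum_mset M1) - int (sum_mset N1) = int (sum_mset M2) - int (sum_mset N2)" "q = 1"
        by (auto simp: q_def split: if_splits)
      have "real_of_int (int (sum_mset M1) - int (sum_mset N1)) = real_of_int (int (sum_mset M2) - int (sum_mset N2))"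
        by (simp only: q(1))
      then have \<nu>: "?\<nu>1 = ?\<nu>2" by (simp)
      have "phi_kernel \<alpha>0 a 0 e i = ?y M1 N1 * ?y M2 N2"
        using q(1) by (simp add: phi_kernel_def e i True \<alpha>_def)
      then show ?thesis
        unfolding comm_kernel_def q(2) tweight_def \<nu>[symmetric] by (simp add: e i \<alpha>_def \<beta>_def algebra_simps)
    qed
    have "zfac N1 * zfac N2 * (q * ?y M2 N2 * vir_dn (\<beta> + \<alpha>) (?y M1) N1 + q * ?y M1 N1 * vir_up (\<beta> + \<alpha>) (?y M2) N2)
       - zfac M1 * zfac M2 * (q * ?y' N2 M2 * vir_up \<beta> (?y' N1) M1 + q * ?y' N1 M1 * vir_dn \<beta> (?y' N2) M2)
       = q * ((?y M2 N2 * zfac N2) * (zfac N1 * vir_dn (\<beta> + \<alpha>) (?y M1) N1)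
            - (?y' N2 M2 * zfac M2) * (zfac M1 * vir_up \<beta> (?y' N1) M1)
            + (?y M1 N1 * zfac N1) * (zfac N2 * vir_up (\<beta> + \<alpha>) (?y M2) N2)
            - (?y' N1 M1 * zfac M1) * (zfac M2 * vir_dn \<beta> (?y' N2) M2))"
      by (simp add: algebra_simps)
    also have "\<dots> = q * ((?y M2 N2 * zfac N2) * (zfac N1 * vir_dn (\<beta> + \<alpha>) (?y M1) N1 - zfac M1 * vir_up \<beta> (?y' N1) M1)
            + (?y M1 N1 * zfac N1) * (zfac N2 * vir_up (\<beta> + \<alpha>) (?y M2) N2 - zfac M2 * vir_dn \<beta> (?y' N2) M2))"
      unfolding adj1 adj2 by (simp only: right_diff_distrib add_diff_eq)
    also have "\<dots> = comm_kernel \<alpha>0 a e i"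
      unfolding ycoef_vir_dn[OF M(1) N(1)] ycoef_vir_up[OF M(2) N(2)] C by (simp add: algebra_simps)
    finally have dn: "zfac N1 * zfac N2 * (q * ?y M2 N2 * vir_dn (\<beta> + \<alpha>) (?y M1) N1 + q * ?y M1 N1 * vir_up (\<beta> + \<alpha>) (?y M2) N2)
       - zfac M1 * zfac M2 * (q * ?y' N2 M2 * vir_up \<beta> (?y' N1) M1 + q * ?y' N1 M1 * vir_dn \<beta> (?y' N2) M2)
       = comm_kernel \<alpha>0 a e i" .
    have "zfac N1 * zfac N2 * (q * ?y M2 N2 * vir_up (\<beta> + \<alpha>) (?y M1) N1 + q * ?y M1 N1 * vir_dn (\<beta> + \<alpha>) (?y M2) N2)
       - zfac M1 * zfac M2 * (q * ?y' N2 M2 * vir_dn \<beta> (?y' N1) M1 + q * ?y' N1 M1 * vir_up \<beta> (?y' N2) M2)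
       = q * ((?y M2 N2 * zfac N2) * (zfac N1 * vir_up (\<beta> + \<alpha>) (?y M1) N1)
            - (?y' N2 M2 * zfac M2) * (zfac M1 * vir_dn \<beta> (?y' N1) M1)
            + (?y M1 N1 * zfac N1) * (zfac N2 * vir_dn (\<beta> + \<alpha>) (?y M2) N2)
            - (?y' N1 M1 * zfac M1) * (zfac M2 * vir_up \<beta> (?y' N2) M2))"
      by (simp add: algebra_simps)
    also have "\<dots> = q * ((?y M2 N2 * zfac N2) * (zfac N1 * vir_up (\<beta> + \<alpha>) (?y M1) N1 - zfac M1 * vir_dn \<beta> (?y' N1) M1)
            + (?y M1 N1 * zfac N1) * (zfac N2 * vir_dn (\<beta> + \<alpha>) (?y M2) N2 - zfac M2 * vir_up \<beta> (?y' N2) M2))"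
      unfolding adj1 adj2 by (simp only: right_diff_distrib add_diff_eq)
    also have "\<dots> = comm_kernel \<alpha>0 a e i"
      unfolding ycoef_vir_up[OF M(1) N(1)] ycoef_vir_dn[OF M(2) N(2)] C by (simp add: algebra_simps)
    finally have up: "zfac N1 * zfac N2 * (q * ?y M2 N2 * vir_up (\<beta> + \<alpha>) (?y M1) N1 + q * ?y M1 N1 * vir_dn (\<beta> + \<alpha>) (?y M2) N2)
       - zfac M1 * zfac M2 * (q * ?y' N2 M2 * vir_dn \<beta> (?y' N1) M1 + q * ?y' N1 M1 * vir_up \<beta> (?y' N2) M2)
       = comm_kernel \<alpha>0 a e i" .
    have w: "tweight i = zfac N1 * zfac N2" "tweight e = zfac M1 * zfac M2"
      by (simp_all add: tweight_def e i)
    have "A_dn \<alpha>0 (\<lambda>i. of_real (phi_kernel \<alpha>0 a (-1) e i)) i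
        = of_real (q * ?y M2 N2 * vir_dn (\<beta> + \<alpha>) (?y M1) N1 + q * ?y M1 N1 * vir_up (\<beta> + \<alpha>) (?y M2) N2)"
      by (subst i, subst A_dn_eq, subst dn1, subst dn2) simp
    moreover have "A_up \<alpha>0 (\<lambda>e. of_real (phi_kernel \<alpha>0 (-a) 1 i e)) e
        = of_real (q * ?y' N2 M2 * vir_up \<beta> (?y' N1) M1 + q * ?y' N1 M1 * vir_dn \<beta> (?y' N2) M2)"
      by (subst e, subst A_up_eq, subst dn3, subst dn4) simp
    moreover have "A_up \<alpha>0 (\<lambda>i. of_real (phi_kernel \<alpha>0 a 1 e i)) i
        = of_real (q * ?y M2 N2 * vir_up (\<beta> + \<alpha>) (?y M1) N1 + q * ?y M1 N1 * vir_dn (\<beta> + \<alpha>) (?y M2) N2)"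
      by (subst i, subst A_up_eq, subst up1, subst up2) simp
    moreover have "A_dn \<alpha>0 (\<lambda>e. of_real (phi_kernel \<alpha>0 (-a) (-1) i e)) e
        = of_real (q * ?y' N2 M2 * vir_dn \<beta> (?y' N1) M1 + q * ?y' N1 M1 * vir_up \<beta> (?y' N2) M2)"
      by (subst e, subst A_dn_eq, subst up3, subst up4) simp
    ultimately show ?thesis
      unfolding w dn[symmetric] using up[unfolded dn[symmetric]]
      by (simp only: of_real_mult[symmetric] of_real_diff[symmetric])
  qed
  then show ?dn ?up by auto
qed

section \<open>Adjoints of the free generators\<close>

text \<open>The component of type \<open>'x\<close> is a spectator, so that one development serves
  the first tensor factor directly and the second after a swap.\<close>

definition cre1 :: "nat \<Rightarrow> (fidx \<times> 'x \<Rightarrow> complex) \<Rightarrow> fidx \<times> 'x \<Rightarrow> complex" where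
  "cre1 k f = (\<lambda>((j, N), x). cre k (\<lambda>M. f ((j, M), x)) N)"

definition ann1 :: "nat \<Rightarrow> (fidx \<times> 'x \<Rightarrow> complex) \<Rightarrow> fidx \<times> 'x \<Rightarrow> complex" where
  "ann1 k f = (\<lambda>((j, N), x). ann k (\<lambda>M. f ((j, M), x)) N)"

definition weight1 :: "('x \<Rightarrow> complex) \<Rightarrow> fidx \<times> 'x \<Rightarrow> complex" where
  "weight1 w = (\<lambda>((j, N), x). of_real (zfac N) * w x)"

text \<open>Reindex by adding a part k: the ratio of the weights is exactly the coefficient in
  \<open>ann\<close>. As an equivalence of \<open>has_sum\<close> it transports convergence along
  with the value.\<close>

lemma has_sum_cre1:
  "((\<lambda>i. cre1 k f i * g i * weight1 w i) has_sum S) UNIV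
     \<longleftrightarrow> ((\<lambda>i. f i * ann1 k g i * weight1 w i) has_sum S) UNIV"
proof -
  define \<phi> :: "fidx \<times> 'a \<Rightarrow> fidx \<times> 'a" where "\<phi> = (\<lambda>((j, N), x). ((j, add_mset k N), x))"
  let ?h = "\<lambda>i. cre1 k f i * g i * weight1 w i"
  have inj: "inj \<phi>" by (auto simp: \<phi>_def inj_on_def)
  have "(?h has_sum S) UNIV \<longleftrightarrow> (?h has_sum S) (range \<phi>)"
  proof (rule has_sum_cong_neutral)
    fix i assume i: "i \<in> UNIV - range \<phi>"
    obtain j N x where e: "i = ((j, N), x)" by (metis prod.collapse)
    have "k \<notin># N"
    proof
      assume "k \<in># N"
      then have "i = \<phi> ((j, N - {#k#}), x)" by (simp add: e \<phi>_def)
      with i show False by blast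
    qed
    then show "?h i = 0" by (simp add: e cre1_def cre_def)
  qed auto
  also have "\<dots> \<longleftrightarrow> ((?h \<circ> \<phi>) has_sum S) UNIV"
    by (rule has_sum_reindex[OF inj])
  also have "?h \<circ> \<phi> = (\<lambda>i. f i * ann1 k g i * weight1 w i)"
    by (auto simp: fun_eq_iff \<phi>_def cre1_def cre_def ann1_def ann_def weight1_def zfac_add_mset)
  finally show ?thesis .
qed

lemma has_sum_ann1:
  "((\<lambda>i. ann1 k f i * g i * weight1 w i) has_sum S) UNIV
     \<longleftrightarrow> ((\<lambda>i. f i * cre1 k g i * weight1 w i) has_sum S) UNIV"
  using has_sum_cre1[of k g f w S] by (simp add: mult.commute)

lemma has_sum_finite_support:
  fixes h :: "'x \<Rightarrow> complex"
  assumes "finite {i. f i \<noteq> 0}" "\<And>i. f i = 0 \<Longrightarrow> h i = 0"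
  shows "(h has_sum (\<Sum>i | f i \<noteq> 0. h i)) UNIV"
  by (rule has_sum_finite_neutralI) (use assms in auto)

lemma has_sum_finite_sum:
  fixes h :: "'k \<Rightarrow> 'x \<Rightarrow> complex"
  assumes "finite A" "\<And>k. k \<in> A \<Longrightarrow> (h k has_sum s k) X"
  shows "((\<lambda>x. \<Sum>k\<in>A. h k x) has_sum (\<Sum>k\<in>A. s k)) X"
  using assms by (induction A rule: finite_induct) (auto intro: has_sum_add)

definition up1 :: "real \<Rightarrow> (fidx \<times> 'x \<Rightarrow> complex) \<Rightarrow> fidx \<times> 'x \<Rightarrow> complex" where
  "up1 \<alpha>0 f = (\<lambda>((j, N), x). vir_up (of_real (of_int j * \<alpha>0)) (\<lambda>M. f ((j, M), x)) N)"

definition dn1 :: "real \<Rightarrow> (fidx \<times> 'x \<Rightarrow> complex) \<Rightarrow> fidx \<times> 'x \<Rightarrow> complex" where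
  "dn1 \<alpha>0 f = (\<lambda>((j, N), x). vir_dn (of_real (of_int j * \<alpha>0)) (\<lambda>M. f ((j, M), x)) N)"

definition charge :: "real \<Rightarrow> fidx \<times> 'x \<Rightarrow> complex" where
  "charge \<alpha>0 i = of_real (of_int (fst (fst i)) * \<alpha>0)"

lemma up1_upto:
  assumes "sum_mset (snd (fst i)) \<le> K"
  shows "up1 \<alpha>0 f i = charge \<alpha>0 i * cre1 1 f i + (\<Sum>k=1..K. cre1 (k + 1) (ann1 k f) i)"
  using assms by (cases i; cases "fst i") (simp add: up1_def cre1_def ann1_def charge_def vir_up_upto)

lemma dn1_upto:
  assumes "sum_mset (snd (fst i)) \<le> K"
  shows "dn1 \<alpha>0 f i = charge \<alpha>0 i * ann1 1 f i + (\<Sum>k=1..K. cre1 k (ann1 (k + 1) f) i)"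
  using assms by (cases i; cases "fst i") (simp add: dn1_def cre1_def ann1_def charge_def vir_dn_upto)

lemma ann1_eq_0:
  fixes f :: "fidx \<times> 'x \<Rightarrow> complex"
  assumes "\<And>i. f i \<noteq> 0 \<Longrightarrow> sum_mset (snd (fst i)) \<le> K" "k > K"
  shows "ann1 k f = (\<lambda>i. 0)"
proof
  fix i :: "fidx \<times> 'x"
  obtain j N x where e: "i = ((j, N), x)" by (metis prod.collapse)
  have "f ((j, add_mset k N), x) = 0"
    using assms(1)[of "((j, add_mset k N), x)"] assms(2) by auto
  then show "ann1 k f i = 0" by (simp add: ann1_def ann_def e)
qed

lemma cre1_0: "cre1 k (\<lambda>i. 0) = (\<lambda>i. 0)"
  by (auto simp: cre1_def cre_def)

text \<open>Unlike in \<open>up1_upto\<close>, the cut-off comes from the support of f. It is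
  uniform in i, so the sum over k can be exchanged with an infinite sum over i.\<close>

lemma up1_support:
  assumes "\<And>i. f i \<noteq> 0 \<Longrightarrow> sum_mset (snd (fst i)) \<le> K"
  shows "up1 \<alpha>0 f i = charge \<alpha>0 i * cre1 1 f i + (\<Sum>k=1..K. cre1 (k + 1) (ann1 k f) i)"
proof -
  have "(\<Sum>k=1..K + sum_mset (snd (fst i)). cre1 (k + 1) (ann1 k f) i)
      = (\<Sum>k=1..K. cre1 (k + 1) (ann1 k f) i)"
    by (rule sum.mono_neutral_right) (auto simp: ann1_eq_0[OF assms] cre1_0)
  then show ?thesis by (simp only: up1_upto[of i "K + sum_mset (snd (fst i))"] le_add2)
qed

lemma dn1_support:
  assumes "\<And>i. f i \<noteq> 0 \<Longrightarrow> sum_mset (snd (fst i)) \<le> K"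
  shows "dn1 \<alpha>0 f i = charge \<alpha>0 i * ann1 1 f i + (\<Sum>k=1..K. cre1 k (ann1 (k + 1) f) i)"
proof -
  have "(\<Sum>k=1..K + sum_mset (snd (fst i)). cre1 k (ann1 (k + 1) f) i)
      = (\<Sum>k=1..K. cre1 k (ann1 (k + 1) f) i)"
    by (rule sum.mono_neutral_right) (auto simp: ann1_eq_0[OF assms] cre1_0)
  then show ?thesis by (simp only: dn1_upto[of i "K + sum_mset (snd (fst i))"] le_add2)
qed

lemma ann1_charge: "ann1 k (\<lambda>i. charge \<alpha>0 i * g i) = (\<lambda>i. charge \<alpha>0 i * ann1 k g i)"
  by (auto simp: fun_eq_iff ann1_def ann_def charge_def)

lemma cre1_charge: "cre1 k (\<lambda>i. charge \<alpha>0 i * g i) = (\<lambda>i. charge \<alpha>0 i * cre1 k g i)"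
  by (auto simp: fun_eq_iff cre1_def cre_def charge_def)

lemma finite_support_bound:
  assumes "finite {i. (f :: fidx \<times> 'x \<Rightarrow> complex) i \<noteq> 0}"
  obtains K where "\<And>i. f i \<noteq> 0 \<Longrightarrow> sum_mset (snd (fst i)) \<le> K"
proof
  fix i assume "f i \<noteq> 0"
  then show "sum_mset (snd (fst i)) \<le> (\<Sum>i | f i \<noteq> 0. sum_mset (snd (fst i)))"
    using assms by (intro member_le_sum) auto
qed

text \<open>Adjointness with finite support on one side only: g stays arbitrary because it will be
  the image of a field.\<close>

lemma has_sum_up1:
  assumes "finite {i. f i \<noteq> 0}"
  shows "((\<lambda>i. up1 \<alpha>0 f i * g i * weight1 w i) has_sum
     (\<Sum>i | f i \<noteq> 0. f i * dn1 \<alpha>0 g i * weight1 w i)) UNIV"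
proof -
  obtain K where K: "\<And>i. f i \<noteq> 0 \<Longrightarrow> sum_mset (snd (fst i)) \<le> K"
    using finite_support_bound[OF assms] by blast
  have 1: "((\<lambda>i. cre1 1 f i * (charge \<alpha>0 i * g i) * weight1 w i) has_sum
      (\<Sum>i | f i \<noteq> 0. f i * (charge \<alpha>0 i * ann1 1 g i) * weight1 w i)) UNIV"
    unfolding has_sum_cre1 ann1_charge by (rule has_sum_finite_support) (use assms in auto)
  have 2: "((\<lambda>i. cre1 (k + 1) (ann1 k f) i * g i * weight1 w i) has_sum
      (\<Sum>i | f i \<noteq> 0. f i * cre1 k (ann1 (k + 1) g) i * weight1 w i)) UNIV" for k
    unfolding has_sum_cre1 has_sum_ann1 by (rule has_sum_finite_support) (use assms in auto)
  have "((\<lambda>i. cre1 1 f i * (charge \<alpha>0 i * g i) * weight1 w i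
         + (\<Sum>k=1..K. cre1 (k + 1) (ann1 k f) i * g i * weight1 w i)) has_sum
      (\<Sum>i | f i \<noteq> 0. f i * (charge \<alpha>0 i * ann1 1 g i) * weight1 w i)
       + (\<Sum>k=1..K. \<Sum>i | f i \<noteq> 0. f i * cre1 k (ann1 (k + 1) g) i * weight1 w i)) UNIV"
    by (intro has_sum_add 1 has_sum_finite_sum finite_atLeastAtMost 2)
  also have "(\<lambda>i. cre1 1 f i * (charge \<alpha>0 i * g i) * weight1 w i
         + (\<Sum>k=1..K. cre1 (k + 1) (ann1 k f) i * g i * weight1 w i))
      = (\<lambda>i. up1 \<alpha>0 f i * g i * weight1 w i)"
    by (simp add: up1_support[OF K] algebra_simps sum_distrib_left)
  also have "(\<Sum>i | f i \<noteq> 0. f i * (charge \<alpha>0 i * ann1 1 g i) * weight1 w i)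
       + (\<Sum>k=1..K. \<Sum>i | f i \<noteq> 0. f i * cre1 k (ann1 (k + 1) g) i * weight1 w i)
     = (\<Sum>i | f i \<noteq> 0. f i * dn1 \<alpha>0 g i * weight1 w i)"
    unfolding sum.swap[of _ "{i. f i \<noteq> 0}"] sum.distrib[symmetric]
    by (intro sum.cong refl) (simp add: dn1_upto[OF K] distrib_right distrib_left sum_distrib_right sum_distrib_left)
  finally show ?thesis .
qed

lemma has_sum_dn1:
  assumes "finite {i. f i \<noteq> 0}"
  shows "((\<lambda>i. dn1 \<alpha>0 f i * g i * weight1 w i) has_sum
     (\<Sum>i | f i \<noteq> 0. f i * up1 \<alpha>0 g i * weight1 w i)) UNIV"
proof -
  obtain K where K: "\<And>i. f i \<noteq> 0 \<Longrightarrow> sum_mset (snd (fst i)) \<le> K"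
    using finite_support_bound[OF assms] by blast
  have 1: "((\<lambda>i. ann1 1 f i * (charge \<alpha>0 i * g i) * weight1 w i) has_sum
      (\<Sum>i | f i \<noteq> 0. f i * (charge \<alpha>0 i * cre1 1 g i) * weight1 w i)) UNIV"
    unfolding has_sum_ann1 cre1_charge by (rule has_sum_finite_support) (use assms in auto)
  have 2: "((\<lambda>i. cre1 k (ann1 (k + 1) f) i * g i * weight1 w i) has_sum
      (\<Sum>i | f i \<noteq> 0. f i * cre1 (k + 1) (ann1 k g) i * weight1 w i)) UNIV" for k
    unfolding has_sum_cre1 has_sum_ann1 by (rule has_sum_finite_support) (use assms in auto)
  have "((\<lambda>i. ann1 1 f i * (charge \<alpha>0 i * g i) * weight1 w i
         + (\<Sum>k=1..K. cre1 k (ann1 (k + 1) f) i * g i * weight1 w i)) has_sum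
      (\<Sum>i | f i \<noteq> 0. f i * (charge \<alpha>0 i * cre1 1 g i) * weight1 w i)
       + (\<Sum>k=1..K. \<Sum>i | f i \<noteq> 0. f i * cre1 (k + 1) (ann1 k g) i * weight1 w i)) UNIV"
    by (intro has_sum_add 1 has_sum_finite_sum finite_atLeastAtMost 2)
  also have "(\<lambda>i. ann1 1 f i * (charge \<alpha>0 i * g i) * weight1 w i
         + (\<Sum>k=1..K. cre1 k (ann1 (k + 1) f) i * g i * weight1 w i))
      = (\<lambda>i. dn1 \<alpha>0 f i * g i * weight1 w i)"
    by (simp add: dn1_support[OF K] algebra_simps sum_distrib_left)
  also have "(\<Sum>i | f i \<noteq> 0. f i * (charge \<alpha>0 i * cre1 1 g i) * weight1 w i)
       + (\<Sum>k=1..K. \<Sum>i | f i \<noteq> 0. f i * cre1 (k + 1) (ann1 k g) i * weight1 w i)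
     = (\<Sum>i | f i \<noteq> 0. f i * up1 \<alpha>0 g i * weight1 w i)"
    unfolding sum.swap[of _ "{i. f i \<noteq> 0}"] sum.distrib[symmetric]
    by (intro sum.cong refl) (simp add: up1_upto[OF K] distrib_right distrib_left sum_distrib_right sum_distrib_left)
  finally show ?thesis .
qed

abbreviation wt :: "tidx \<Rightarrow> complex" where "wt i \<equiv> complex_of_real (tweight i)"

lemma wt_eq: "wt i = weight1 (\<lambda>p. of_real (zfac (snd p))) i"
  by (auto simp: tweight_def weight1_def split: prod.splits)

lemma wt_swap: "wt (prod.swap i) = wt i"
  by (simp add: tweight_def)

lemma A_dn_split: "A_dn \<alpha>0 g i = dn1 \<alpha>0 g i + up1 \<alpha>0 (g \<circ> prod.swap) (prod.swap i)"
  by (cases i; cases "fst i"; cases "snd i") (simp add: A_dn_eq dn1_def up1_def)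

lemma A_up_split: "A_up \<alpha>0 g i = up1 \<alpha>0 g i + dn1 \<alpha>0 (g \<circ> prod.swap) (prod.swap i)"
  by (cases i; cases "fst i"; cases "snd i") (simp add: A_up_eq dn1_def up1_def)

lemma has_sum_swap_factors:
  fixes f g :: tvec
  assumes "finite {i. f i \<noteq> 0}"
    and T: "\<And>f g :: tvec. finite {i. f i \<noteq> 0} \<Longrightarrow> ((\<lambda>i. T f i * g i * wt i) has_sum
     (\<Sum>i | f i \<noteq> 0. f i * T' g i * wt i)) UNIV"
  shows "((\<lambda>i. T (f \<circ> prod.swap) (prod.swap i) * g i * wt i) has_sum
     (\<Sum>i | f i \<noteq> 0. f i * T' (g \<circ> prod.swap) (prod.swap i) * wt i)) UNIV"
proof -
  let ?f = "f \<circ> prod.swap" and ?g = "g \<circ> prod.swap"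
  have S: "{i. ?f i \<noteq> 0} = prod.swap ` {i. f i \<noteq> 0}" by force
  have "((\<lambda>i. T ?f i * ?g i * wt i) has_sum (\<Sum>i | ?f i \<noteq> 0. ?f i * T' ?g i * wt i)) (range prod.swap)"
    using T[of ?f ?g] assms(1) unfolding S by simp
  then have "(((\<lambda>i. T ?f i * ?g i * wt i) \<circ> prod.swap) has_sum
      (\<Sum>i | ?f i \<noteq> 0. ?f i * T' ?g i * wt i)) UNIV"
    by (subst (asm) has_sum_reindex) auto
  also have "(\<Sum>i | ?f i \<noteq> 0. ?f i * T' ?g i * wt i) = (\<Sum>i | f i \<noteq> 0. f i * T' ?g (prod.swap i) * wt i)"
    unfolding S by (subst sum.reindex) (auto simp: wt_swap)
  finally show ?thesis by (simp add: o_def wt_swap)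
qed

lemma has_sum_A_up:
  assumes "finite {i. f i \<noteq> 0}"
  shows "((\<lambda>i. A_up \<alpha>0 f i * g i * wt i) has_sum (\<Sum>i | f i \<noteq> 0. f i * A_dn \<alpha>0 g i * wt i)) UNIV"
  unfolding A_up_split A_dn_split distrib_right distrib_left sum.distrib
  by (intro has_sum_add has_sum_swap_factors[where T = "dn1 \<alpha>0" and T' = "up1 \<alpha>0"] assms)
     (simp_all add: wt_eq has_sum_up1 has_sum_dn1 assms)

lemma has_sum_A_dn:
  assumes "finite {i. f i \<noteq> 0}"
  shows "((\<lambda>i. A_dn \<alpha>0 f i * g i * wt i) has_sum (\<Sum>i | f i \<noteq> 0. f i * A_up \<alpha>0 g i * wt i)) UNIV"
  unfolding A_up_split A_dn_split distrib_right distrib_left sum.distrib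
  by (intro has_sum_add has_sum_swap_factors[where T = "up1 \<alpha>0" and T' = "dn1 \<alpha>0"] assms)
     (simp_all add: wt_eq has_sum_up1 has_sum_dn1 assms)

lemma vir_dn_sum: "vir_dn \<beta> (\<lambda>M. \<Sum>e\<in>S. c e * k e M) N = (\<Sum>e\<in>S. c e * vir_dn \<beta> (k e) N)"
  and vir_up_sum: "vir_up \<beta> (\<lambda>M. \<Sum>e\<in>S. c e * k e M) N = (\<Sum>e\<in>S. c e * vir_up \<beta> (k e) N)"
  unfolding vir_dn_def vir_up_def ann_sum cre_sum ann_mult cre_mult
  by (subst sum.swap, simp add: sum_distrib_left sum.distrib[symmetric] algebra_simps)+

lemma A_dn_sum: "A_dn \<alpha>0 (\<lambda>i. \<Sum>e\<in>S. c e * k e i) i = (\<Sum>e\<in>S. c e * A_dn \<alpha>0 (k e) i)"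
  and A_up_sum: "A_up \<alpha>0 (\<lambda>i. \<Sum>e\<in>S. c e * k e i) i = (\<Sum>e\<in>S. c e * A_up \<alpha>0 (k e) i)"
  by (cases i; cases "fst i"; cases "snd i";
      simp add: A_dn_eq A_up_eq vir_dn_sum vir_up_sum sum.distrib[symmetric] distrib_left)+

text \<open>Operators in different tensor factors commute: pointwise, one is a finite combination of
  evaluations with fixed coefficients, and such sums pull out of the other. The cross terms of the
  free parts pair \<open>L_1\<close> with \<open>L_1\<close> and \<open>L_-1\<close> with
  \<open>L_-1\<close>.\<close>

lemma vir_commute:
  "vir_dn \<beta> (\<lambda>M. vir_dn \<gamma> (\<lambda>M'. F M M') N') N = vir_dn \<gamma> (\<lambda>M'. vir_dn \<beta> (\<lambda>M. F M M') N) N'"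
  "vir_up \<beta> (\<lambda>M. vir_up \<gamma> (\<lambda>M'. F M M') N') N = vir_up \<gamma> (\<lambda>M'. vir_up \<beta> (\<lambda>M. F M M') N) N'"
proof -
  have dn: "\<exists>(S :: nat set) c h. \<forall>f. vir_dn \<beta> f N = (\<Sum>k\<in>S. c k * f (h k))" for \<beta> :: 'a and N
  proof (intro exI allI)
    \<comment> \<open>The slot k = 0 holds the charge term.\<close>
    show "vir_dn \<beta> f N = (\<Sum>k\<in>{0..sum_mset N}. (if k = 0 then \<beta> * of_nat (count N 1 + 1)
          else of_bool (k \<in># N) * of_nat ((k + 1) * (count (N - {#k#}) (k + 1) + 1)))
        * f (if k = 0 then add_mset 1 N else add_mset (k + 1) (N - {#k#})))" for f
      by (subst sum.atLeast_Suc_atMost) (simp_all add: vir_dn_def ann_def cre_def mult.assoc)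
  qed
  have up: "\<exists>(S :: nat set) c h. \<forall>f. vir_up \<beta> f N = (\<Sum>k\<in>S. c k * f (h k))" for \<beta> :: 'a and N
  proof (intro exI allI)
    show "vir_up \<beta> f N = (\<Sum>k\<in>{0..sum_mset N}. (if k = 0 then \<beta> * of_bool (1 \<in># N)
          else of_bool (k + 1 \<in># N) * of_nat (k * (count (N - {#k + 1#}) k + 1)))
        * f (if k = 0 then N - {#1#} else add_mset k (N - {#k + 1#})))" for f
      by (subst sum.atLeast_Suc_atMost) (simp_all add: vir_up_def ann_def cre_def mult.assoc)
  qed
  obtain S :: "nat set" and c h where "\<forall>f. vir_dn \<beta> f N = (\<Sum>k\<in>S. c k * f (h k))"
    using dn[of \<beta> N] by (elim exE)
  then have 1: "vir_dn \<beta> f N = (\<Sum>k\<in>S. c k * f (h k))" for f by (rule spec)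
  show "vir_dn \<beta> (\<lambda>M. vir_dn \<gamma> (\<lambda>M'. F M M') N') N = vir_dn \<gamma> (\<lambda>M'. vir_dn \<beta> (\<lambda>M. F M M') N) N'"
    unfolding 1 vir_dn_sum ..
  obtain S :: "nat set" and c h where "\<forall>f. vir_up \<beta> f N = (\<Sum>k\<in>S. c k * f (h k))"
    using up[of \<beta> N] by (elim exE)
  then have 1: "vir_up \<beta> f N = (\<Sum>k\<in>S. c k * f (h k))" for f by (rule spec)
  show "vir_up \<beta> (\<lambda>M. vir_up \<gamma> (\<lambda>M'. F M M') N') N = vir_up \<gamma> (\<lambda>M'. vir_up \<beta> (\<lambda>M. F M M') N) N'"
    unfolding 1 vir_up_sum ..
qed

lemma vir_dn_add: "vir_dn \<beta> (\<lambda>M. f M + g M) N = vir_dn \<beta> f N + vir_dn \<beta> g N"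
  and vir_up_add: "vir_up \<beta> (\<lambda>M. f M + g M) N = vir_up \<beta> f N + vir_up \<beta> g N"
  unfolding vir_dn_def vir_up_def ann_add cre_add by (simp_all add: sum.distrib algebra_simps)

text \<open>The second factor enters with opposite sign. Both factors carry charge j, so the squared
  charges cancel and only the levels remain.\<close>

lemma A_commutator:
  "A_dn \<alpha>0 (A_up \<alpha>0 f) ((j, N1), (j, N2)) - A_up \<alpha>0 (A_dn \<alpha>0 f) ((j, N1), (j, N2))
     = 2 * (of_nat (sum_mset N1) - of_nat (sum_mset N2)) * f ((j, N1), (j, N2))"
proof -
  let ?\<beta> = "complex_of_real (of_int j * \<alpha>0)"
  have 1: "vir_dn ?\<beta> (\<lambda>M. vir_up ?\<beta> (\<lambda>M. f ((j, M), (j, N2))) M) N1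
     - vir_up ?\<beta> (\<lambda>M. vir_dn ?\<beta> (\<lambda>M. f ((j, M), (j, N2))) M) N1
     = (?\<beta> * ?\<beta> + 2 * of_nat (sum_mset N1)) * f ((j, N1), (j, N2))"
    by (rule vir_commutator[of ?\<beta> "\<lambda>M. f ((j, M), (j, N2))"])
  have 2: "vir_dn ?\<beta> (\<lambda>M. vir_up ?\<beta> (\<lambda>M. f ((j, N1), (j, M))) M) N2
     - vir_up ?\<beta> (\<lambda>M. vir_dn ?\<beta> (\<lambda>M. f ((j, N1), (j, M))) M) N2
     = (?\<beta> * ?\<beta> + 2 * of_nat (sum_mset N2)) * f ((j, N1), (j, N2))"
    by (rule vir_commutator[of ?\<beta> "\<lambda>M. f ((j, N1), (j, M))"])
  show ?thesis
    unfolding A_dn_eq A_up_eq vir_dn_add vir_up_add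
    using 1 2 vir_commute(1)[of ?\<beta> ?\<beta> "\<lambda>M M'. f ((j, M), (j, M'))" N2 N1]
      vir_commute(2)[of ?\<beta> ?\<beta> "\<lambda>M M'. f ((j, M), (j, M'))" N2 N1]
    by (simp add: algebra_simps)
qed

text \<open>Apply \<open>ycoef_adjoint\<close> in each factor: \<Phi>_(-a,-s) is the adjoint of
  \<Phi>_(a,s), at the level of matrix elements.\<close>

lemma kernel_adjoint:
  assumes "good e" "good i"
  shows "phi_kernel \<alpha>0 a s e i * tweight i = phi_kernel \<alpha>0 (-a) (-s) i e * tweight e"
proof -
  obtain j M1 M2 where e: "e = ((j, M1), (j, M2))" and M: "0 \<notin># M1" "0 \<notin># M2"
    using assms(1) unfolding good_def by (metis prod.collapse)
  obtain k N1 N2 where i: "i = ((k, N1), (k, N2))" and N: "0 \<notin># N1" "0 \<notin># N2"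
    using assms(2) unfolding good_def by (metis prod.collapse)
  have "(ycoef (of_int a * \<alpha>0) M1 N1 * zfac N1) * (ycoef (of_int a * \<alpha>0) M2 N2 * zfac N2)
      = (ycoef (-(of_int a * \<alpha>0)) N1 M1 * zfac M1) * (ycoef (-(of_int a * \<alpha>0)) N2 M2 * zfac M2)"
    using ycoef_adjoint[OF M(1) N(1)] ycoef_adjoint[OF M(2) N(2)] by metis
  moreover have "of_bool (k = j + a \<and> k = j + a \<and>
       s = int (sum_mset M1) - int (sum_mset N1) - int (sum_mset M2) + int (sum_mset N2))
     = (of_bool (j = k + - a \<and> j = k + - a \<and>
       - s = int (sum_mset N1) - int (sum_mset M1) - int (sum_mset N2) + int (sum_mset M2)) :: real)"
    by auto
  ultimately show ?thesis
    unfolding phi_kernel_def tweight_def by (simp add: e i mult_ac)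
qed

section \<open>Commutativity of the fields\<close>

definition lev :: "nat \<Rightarrow> nat multiset set" where
  "lev n = {N. 0 \<notin># N \<and> sum_mset N = n}"

lemma finite_lev: "finite (lev n)"
proof (induction n rule: less_induct)
  case (less n)
  have "lev n \<subseteq> insert {#} (\<Union>k\<in>{1..n}. add_mset k ` lev (n - k))"
  proof
    fix N assume N: "N \<in> lev n"
    show "N \<in> insert {#} (\<Union>k\<in>{1..n}. add_mset k ` lev (n - k))"
    proof (cases N)
      case (add k N')
      then have "k \<in> {1..n}" "N' \<in> lev (n - k)" using N by (auto simp: lev_def Suc_le_eq)
      then show ?thesis using add by blast
    qed simp
  qed
  then show ?case by (rule finite_subset) (use less in auto)
qed

lemma sum_lev_add_mset:
  assumes "k > 0"
  shows "(\<Sum>N\<in>lev n. of_bool (k \<in># N) * F N) = (if n < k then 0 else \<Sum>N\<in>lev (n - k). F (add_mset k N) :: real)"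
proof (cases "n < k")
  case True
  then have "k \<notin># N" if "N \<in> lev n" for N
    using that member_le_sum_mset[of k N] by (auto simp: lev_def)
  then show ?thesis using True by simp
next
  case False
  have "(\<Sum>N\<in>lev n. of_bool (k \<in># N) * F N) = (\<Sum>N\<in>{N \<in> lev n. k \<in># N}. F N)"
    by (rule sum.mono_neutral_cong_right) (auto simp: finite_lev)
  also have "\<dots> = (\<Sum>N\<in>lev (n - k). F (add_mset k N))"
  proof (rule sum.reindex_bij_witness[of _ "add_mset k" "\<lambda>N. N - {#k#}"])
    fix N assume N: "N \<in> {N \<in> lev n. k \<in># N}"
    then have "sum_mset (N - {#k#}) + k = sum_mset N" by (intro sum_mset_minus_single) simp
    then show "N - {#k#} \<in> lev (n - k)" using N by (auto simp: lev_def dest: in_diffD)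
  qed (use False assms in \<open>auto simp: lev_def\<close>)
  finally show ?thesis using False by simp
qed

section \<open>Generating functions in the intermediate level\<close>

definition shift :: "nat \<Rightarrow> (nat \<Rightarrow> real) \<Rightarrow> nat \<Rightarrow> real" where
  "shift k g n = (if n < k then 0 else g (n - k))"

text \<open>The level-\<open>n\<close> contribution to the inner product of \<open>Y\<^sub>\<alpha> e\<^sub>M\<close> and \<open>Y\<^sub>\<alpha>' e\<^sub>M'\<close>.\<close>
definition gram :: "real \<Rightarrow> real \<Rightarrow> nat multiset \<Rightarrow> nat multiset \<Rightarrow> nat \<Rightarrow> real" where
  "gram \<alpha> \<alpha>' M M' n = (\<Sum>N\<in>lev n. ycoef \<alpha> M N * ycoef \<alpha>' M' N * zfac N)"

lemma gram_commute: "gram \<alpha> \<alpha>' M M' = gram \<alpha>' \<alpha> M' M"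
  by (simp add: gram_def fun_eq_iff mult_ac)

text \<open>J_-k is moved left through Y_\<alpha>, which costs -\<alpha>, and then across the inner
  product, where it becomes J_k and lowers the level by k; this gives the shifts. The factor 1
  matches the rule \<open>lin\<close> of \<open>reflected\<close>.\<close>

lemma gram_add_mset:
  assumes "k > 0"
  shows "gram \<alpha> \<alpha>' (add_mset k M) M' = (\<lambda>n. 1 * (\<alpha>' * shift k (gram \<alpha> \<alpha>' M M') n + (- \<alpha>) * gram \<alpha> \<alpha>' M M' n)
     + real (k * count M' k) * shift k (gram \<alpha> \<alpha>' M (M' - {#k#})) n)"
proof
  fix n
  have "gram \<alpha> \<alpha>' (add_mset k M) M' n
     = (\<Sum>N\<in>lev n. of_bool (k \<in># N) * (ycoef \<alpha> M (N - {#k#}) * ycoef \<alpha>' M' N * zfac N)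
          - \<alpha> * (ycoef \<alpha> M N * ycoef \<alpha>' M' N * zfac N))"
    unfolding gram_def by (intro sum.cong) (auto simp: lev_def ycoef_create algebra_simps)
  also have "\<dots> = (\<Sum>N\<in>lev n. of_bool (k \<in># N) * (ycoef \<alpha> M (N - {#k#}) * ycoef \<alpha>' M' N * zfac N))
      - \<alpha> * gram \<alpha> \<alpha>' M M' n"
    by (simp only: sum_subtractf gram_def sum_distrib_left)
  also have "(\<Sum>N\<in>lev n. of_bool (k \<in># N) * (ycoef \<alpha> M (N - {#k#}) * ycoef \<alpha>' M' N * zfac N))
     = (if n < k then 0 else
        \<Sum>N\<in>lev (n - k). ycoef \<alpha> M N * ycoef \<alpha>' M' (add_mset k N) * zfac (add_mset k N))"
    by (subst sum_lev_add_mset[OF assms]) simp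
  also have "(\<Sum>N\<in>lev (n - k). ycoef \<alpha> M N * ycoef \<alpha>' M' (add_mset k N) * zfac (add_mset k N))
     = (\<Sum>N\<in>lev (n - k). real (k * count M' k) * (ycoef \<alpha> M N * ycoef \<alpha>' (M' - {#k#}) N * zfac N)
          + \<alpha>' * (ycoef \<alpha> M N * ycoef \<alpha>' M' N * zfac N))"
  proof (rule sum.cong)
    fix N assume N: "N \<in> lev (n - k)"
    have "ycoef \<alpha> M N * ycoef \<alpha>' M' (add_mset k N) * zfac (add_mset k N)
       = ycoef \<alpha> M N * (real (k * (count N k + 1)) * ycoef \<alpha>' M' (add_mset k N)) * zfac N"
      by (simp only: zfac_add_mset mult_ac)
    also have "real (k * (count N k + 1)) * ycoef \<alpha>' M' (add_mset k N)
       = real (k * count M' k) * ycoef \<alpha>' (M' - {#k#}) N + \<alpha>' * ycoef \<alpha>' M' N"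
      using N assms by (intro ycoef_annihilate) (auto simp: lev_def)
    finally show "ycoef \<alpha> M N * ycoef \<alpha>' M' (add_mset k N) * zfac (add_mset k N)
       = real (k * count M' k) * (ycoef \<alpha> M N * ycoef \<alpha>' (M' - {#k#}) N * zfac N)
          + \<alpha>' * (ycoef \<alpha> M N * ycoef \<alpha>' M' N * zfac N)"
      by (simp add: algebra_simps)
  qed simp
  also have "\<dots> = real (k * count M' k) * gram \<alpha> \<alpha>' M (M' - {#k#}) (n - k) + \<alpha>' * gram \<alpha> \<alpha>' M M' (n - k)"
    by (simp only: sum.distrib gram_def sum_distrib_left)
  finally show "gram \<alpha> \<alpha>' (add_mset k M) M' n = 1 * (\<alpha>' * shift k (gram \<alpha> \<alpha>' M M') n + (- \<alpha>) * gram \<alpha> \<alpha>' M M' n)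
     + real (k * count M' k) * shift k (gram \<alpha> \<alpha>' M (M' - {#k#})) n"
    by (auto simp: shift_def)
qed

text \<open>\<open>reflected b g g' w\<close> says that, as generating functions, \<open>g = p b\<close> and \<open>g' = x\<^sup>w p(1/x) b\<close> for
  one polynomial \<open>p\<close>.\<close>
inductive reflected :: "(nat \<Rightarrow> real) \<Rightarrow> (nat \<Rightarrow> real) \<Rightarrow> (nat \<Rightarrow> real) \<Rightarrow> int \<Rightarrow> bool" for b where
  base: "reflected b b b 0"
| lin: "reflected b g g' w \<Longrightarrow> reflected b h h' w \<Longrightarrow>
    reflected b (\<lambda>n. c * g n + d * h n) (\<lambda>n. c * g' n + d * h' n) w"
| shiftl: "reflected b g g' w \<Longrightarrow> reflected b (shift k g) g' (w + int k)"
| shiftr: "reflected b g g' w \<Longrightarrow> reflected b g (shift k g') (w + int k)"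

text \<open>These are the coefficients of (1 - x)^(-\<gamma>), the exponential of \<gamma> times the
  sum of x^k / k, expanded over partitions.\<close>

definition vacuum :: "real \<Rightarrow> nat \<Rightarrow> real" where
  "vacuum \<gamma> n = (\<Sum>N\<in>lev n. \<gamma> ^ size N / zfac N)"

lemma gram_empty: "gram \<alpha> \<alpha>' {#} {#} = vacuum (\<alpha> * \<alpha>')"
  unfolding gram_def vacuum_def
proof (intro ext sum.cong refl)
  fix n N assume "N \<in> lev n"
  then have N: "0 \<notin># N" by (simp add: lev_def)
  then show "ycoef \<alpha> {#} N * ycoef \<alpha>' {#} N * zfac N = (\<alpha> * \<alpha>') ^ size N / zfac N"
    using zfac_pos[OF N] by (simp add: ycoef_empty power_mult_distrib field_simps)
qed

text \<open>Replacing (\<alpha>, \<alpha>') by (-\<alpha>', -\<alpha>) keeps the product, hence the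
  vacuum series. It turns the recursion factor \<alpha>' x^k - \<alpha> into \<alpha>' - \<alpha>
  x^k, its reflection in degree k; the contraction of two parts k gives x^k, its own reflection in
  degree 2k.\<close>

lemma reflected_gram:
  assumes "0 \<notin># M" "0 \<notin># M'"
  shows "reflected (vacuum (\<alpha> * \<alpha>')) (gram \<alpha> \<alpha>' M M') (gram (-\<alpha>') (-\<alpha>) M M')
     (int (sum_mset M) + int (sum_mset M'))"
  using assms
proof (induction M arbitrary: M')
  case empty
  then show ?case
  proof (induction M')
    case empty
    show ?case
      using reflected.base[of "vacuum (\<alpha> * \<alpha>')"] by (simp add: gram_empty mult.commute)
  next
    case (add k M')
    have k: "k > 0" using add.prems by auto
    \<comment> \<open>The arguments are exchanged because \<open>gram_add_mset\<close> adds parts to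
      the first partition.\<close>
    have IH: "reflected (vacuum (\<alpha> * \<alpha>')) (gram \<alpha>' \<alpha> M' {#}) (gram (-\<alpha>) (-\<alpha>') M' {#}) (int (sum_mset M'))"
      using add by (simp add: gram_commute[of _ _ M'])
    have "reflected (vacuum (\<alpha> * \<alpha>'))
       (\<lambda>n. \<alpha> * shift k (gram \<alpha>' \<alpha> M' {#}) n + (- \<alpha>') * gram \<alpha>' \<alpha> M' {#} n)
       (\<lambda>n. \<alpha> * gram (-\<alpha>) (-\<alpha>') M' {#} n + (- \<alpha>') * shift k (gram (-\<alpha>) (-\<alpha>') M' {#}) n)
       (int (sum_mset M') + int k)"
      by (intro reflected.intros IH)
    then show ?case
      by (simp add: gram_commute[of _ _ "{#}"] gram_add_mset[OF k] algebra_simps)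
  qed
next
  case (add k M)
  have k: "k > 0" and M: "0 \<notin># M" using add.prems by auto
  have IH: "reflected (vacuum (\<alpha> * \<alpha>')) (gram \<alpha> \<alpha>' M M') (gram (-\<alpha>') (-\<alpha>) M M')
     (int (sum_mset M) + int (sum_mset M'))"
    by (rule add.IH) (use M add.prems in auto)
  have 1: "reflected (vacuum (\<alpha> * \<alpha>'))
     (\<lambda>n. \<alpha>' * shift k (gram \<alpha> \<alpha>' M M') n + (- \<alpha>) * gram \<alpha> \<alpha>' M M' n)
     (\<lambda>n. \<alpha>' * gram (-\<alpha>') (-\<alpha>) M M' n + (- \<alpha>) * shift k (gram (-\<alpha>') (-\<alpha>) M M') n)
     (int (sum_mset M) + int (sum_mset M') + int k)"
    by (intro reflected.intros IH)
  show ?case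
  proof (cases "k \<in># M'")
    case False
    then have c: "count M' k = 0" by (simp add: not_in_iff)
    from 1 show ?thesis
      by (simp add: gram_add_mset[OF k] c algebra_simps)
  next
    case True
    have "reflected (vacuum (\<alpha> * \<alpha>')) (gram \<alpha> \<alpha>' M (M' - {#k#})) (gram (-\<alpha>') (-\<alpha>) M (M' - {#k#}))
       (int (sum_mset M) + int (sum_mset (M' - {#k#})))"
      by (rule add.IH) (use M add.prems in \<open>auto dest: in_diffD\<close>)
    then have "reflected (vacuum (\<alpha> * \<alpha>')) (shift k (gram \<alpha> \<alpha>' M (M' - {#k#})))
       (shift k (gram (-\<alpha>') (-\<alpha>) M (M' - {#k#})))
       (int (sum_mset M) + int (sum_mset (M' - {#k#})) + int k + int k)"
      by (intro reflected.intros)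
    moreover have "int (sum_mset M) + int (sum_mset (M' - {#k#})) + int k + int k
       = int (sum_mset M) + int (sum_mset M') + int k"
      using sum_mset_minus_single[OF True] by simp
    ultimately have 2: "reflected (vacuum (\<alpha> * \<alpha>')) (shift k (gram \<alpha> \<alpha>' M (M' - {#k#})))
       (shift k (gram (-\<alpha>') (-\<alpha>) M (M' - {#k#}))) (int (sum_mset M) + int (sum_mset M') + int k)"
      by simp
    have "reflected (vacuum (\<alpha> * \<alpha>')) (gram \<alpha> \<alpha>' (add_mset k M) M') (gram (-\<alpha>') (-\<alpha>) (add_mset k M) M')
       (int (sum_mset M) + int (sum_mset M') + int k)"
      using reflected.lin[OF 1 2, of 1 "real (k * count M' k)"]
      unfolding gram_add_mset[OF k] by (simp add: algebra_simps)
    then show ?thesis by (simp add: algebra_simps)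
  qed
qed

section \<open>Square-summable sequences and their correlations\<close>

definition l2 :: "(nat \<Rightarrow> real) \<Rightarrow> bool" where
  "l2 f \<longleftrightarrow> (\<lambda>n. (f n)\<^sup>2) summable_on UNIV"

lemma l2_lin: assumes "l2 f" "l2 g" shows "l2 (\<lambda>n. c * f n + d * g n)"
  unfolding l2_def
proof (rule summable_on_comparison_test)
  show "(\<lambda>n. 2 * c\<^sup>2 * (f n)\<^sup>2 + 2 * d\<^sup>2 * (g n)\<^sup>2) summable_on UNIV"
    using assms unfolding l2_def by (intro summable_on_add summable_on_cmult_right)
  fix n
  have "0 \<le> (c * f n - d * g n)\<^sup>2" by simp
  then show "(c * f n + d * g n)\<^sup>2 \<le> 2 * c\<^sup>2 * (f n)\<^sup>2 + 2 * d\<^sup>2 * (g n)\<^sup>2"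
    by (simp add: power2_eq_square algebra_simps)
qed simp

lemma l2_shift: assumes "l2 f" shows "l2 (shift k f)"
proof -
  have "(\<lambda>n. (shift k f n)\<^sup>2) summable_on UNIV \<longleftrightarrow> (\<lambda>n. (shift k f n)\<^sup>2) summable_on (range (\<lambda>n. n + k))"
  proof (rule summable_on_cong_neutral)
    fix n assume n: "n \<in> UNIV - range (\<lambda>n. n + k)"
    have "n < k"
    proof (rule ccontr)
      assume "\<not> n < k"
      then have "n = (n - k) + k" by simp
      with n show False by blast
    qed
    then show "(shift k f n)\<^sup>2 = 0" by (simp add: shift_def)
  qed auto
  also have "\<dots> \<longleftrightarrow> ((\<lambda>n. (shift k f n)\<^sup>2) \<circ> (\<lambda>n. n + k)) summable_on UNIV"
    by (rule summable_on_reindex) auto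
  finally show ?thesis using assms by (simp add: l2_def o_def shift_def)
qed

lemma l2_reflected: "reflected b g g' w \<Longrightarrow> l2 b \<Longrightarrow> l2 g \<and> l2 g'"
  by (induction rule: reflected.induct) (auto intro: l2_lin l2_shift)

definition diag :: "int \<Rightarrow> (nat \<times> nat) set" where
  "diag D = {(m, n). int m - int n = D}"

text \<open>The coefficient of x^D in f(x) g(1/x). It is an infinite sum even for one D, which is
  why square summability is used.\<close>

definition corr :: "(nat \<Rightarrow> real) \<Rightarrow> (nat \<Rightarrow> real) \<Rightarrow> int \<Rightarrow> real" where
  "corr f g D = (\<Sum>\<^sub>\<infinity>p\<in>diag D. f (fst p) * g (snd p))"

lemma corr_summable:
  assumes "l2 f" "l2 g"
  shows "(\<lambda>p. f (fst p) * g (snd p)) summable_on diag D"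
proof -
  have "(\<lambda>n. (f n)\<^sup>2) summable_on (fst ` diag D)" "(\<lambda>n. (g n)\<^sup>2) summable_on (snd ` diag D)"
    using assms unfolding l2_def by (meson summable_on_subset_banach subset_UNIV)+
  then have "(\<lambda>p. (f (fst p))\<^sup>2) summable_on diag D" "(\<lambda>p. (g (snd p))\<^sup>2) summable_on diag D"
    by (subst (asm) summable_on_reindex; force simp: diag_def inj_on_def o_def)+
  then have "(\<lambda>p. (f (fst p))\<^sup>2 + (g (snd p))\<^sup>2) summable_on diag D"
    by (rule summable_on_add)
  then have "(\<lambda>p. norm (f (fst p) * g (snd p))) summable_on diag D"
  proof (rule Infinite_Sum.abs_summable_on_comparison_test')
    fix p
    have "0 \<le> (\<bar>f (fst p)\<bar> - \<bar>g (snd p)\<bar>)\<^sup>2" by simp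
    then have "2 * (\<bar>f (fst p)\<bar> * \<bar>g (snd p)\<bar>) \<le> (f (fst p))\<^sup>2 + (g (snd p))\<^sup>2"
      by (simp add: power2_diff)
    moreover have "0 \<le> \<bar>f (fst p)\<bar> * \<bar>g (snd p)\<bar>" by simp
    ultimately show "norm (f (fst p) * g (snd p)) \<le> (f (fst p))\<^sup>2 + (g (snd p))\<^sup>2"
      unfolding real_norm_def abs_mult by linarith
  qed
  then show ?thesis by (rule abs_summable_summable)
qed

lemma corr_commute: "corr f g D = corr g f (- D)"
  unfolding corr_def
  by (rule infsum_reindex_bij_witness[of _ prod.swap prod.swap]) (auto simp: diag_def)

lemma corr_lin:
  assumes "l2 f" "l2 g" "l2 h"
  shows "corr (\<lambda>n. c * f n + d * g n) h D = c * corr f h D + d * corr g h D"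
proof -
  have "corr (\<lambda>n. c * f n + d * g n) h D
     = (\<Sum>\<^sub>\<infinity>p\<in>diag D. c * (f (fst p) * h (snd p)) + d * (g (fst p) * h (snd p)))"
    unfolding corr_def by (intro infsum_cong) (simp add: algebra_simps)
  also have "\<dots> = c * corr f h D + d * corr g h D"
    unfolding corr_def using corr_summable[OF assms(1,3)] corr_summable[OF assms(2,3)]
    by (simp add: infsum_add summable_on_cmult_right infsum_cmult_right)
  finally show ?thesis .
qed

lemma corr_shift: "corr (shift k f) g D = corr f g (D - int k)"
proof -
  have "corr (shift k f) g D
      = (\<Sum>\<^sub>\<infinity>p\<in>{p \<in> diag D. k \<le> fst p}. shift k f (fst p) * g (snd p))"
    unfolding corr_def by (rule infsum_cong_neutral) (auto simp: shift_def)
  also have "\<dots> = corr f g (D - int k)"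
    unfolding corr_def
    by (rule infsum_reindex_bij_witness[of _ "\<lambda>(m, n). (m + k, n)" "\<lambda>(m, n). (m - k, n)"])
       (auto simp: diag_def shift_def)
  finally show ?thesis .
qed

lemma corr_lin_right:
  assumes "l2 f" "l2 g" "l2 h"
  shows "corr h (\<lambda>n. c * f n + d * g n) D = c * corr h f D + d * corr h g D"
  using corr_lin[OF assms, of c d "- D"] by (simp add: corr_commute[of h])

lemma corr_shift_right: "corr g (shift k f) D = corr g f (D + int k)"
  using corr_shift[of k f g "- D"] by (simp add: corr_commute[of g] algebra_simps)

text \<open>For g = p b and h = q b the left side is the coefficient of x^D in p(x) q(1/x) b(x)
  b(1/x). The product b(x) b(1/x) is invariant under x -> 1/x, and this substitution reflects p and
  q up to the power x^(w - v).\<close>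

lemma corr_reflected:
  assumes "reflected b g g' w" "reflected b h h' v" "l2 b"
  shows "corr g h D = corr g' h' (w - v - D)"
  using assms(1)
proof (induction arbitrary: D rule: reflected.induct)
  case base
  show ?case using assms(2)
  proof (induction arbitrary: D rule: reflected.induct)
    case base
    show ?case using corr_commute[of b b D] by simp
  next
    case (lin g g' w h h' c d)
    have "l2 g" "l2 g'" "l2 h" "l2 h'" using lin assms(3) l2_reflected by blast+
    then show ?case using lin assms(3) by (simp add: corr_lin_right)
  next
    case (shiftl g g' w k)
    have "0 - (w + int k) - D = 0 - w - (D + int k)" by simp
    then show ?case unfolding corr_shift_right using shiftl.IH[of "D + int k"] by (simp only:)
  next
    case (shiftr g g' w k)
    have "0 - (w + int k) - D + int k = 0 - w - D" by simp
    then show ?case unfolding corr_shift_right using shiftr.IH[of D] by (simp only:)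
  qed
next
  case (lin g g' w f f' c d)
  have "l2 h" "l2 h'" using assms(2,3) l2_reflected by blast+
  moreover have "l2 g" "l2 g'" "l2 f" "l2 f'" using lin assms(3) l2_reflected by blast+
  ultimately show ?case using lin by (simp add: corr_lin)
next
  case (shiftl g g' w k)
  have "w + int k - v - D = w - v - (D - int k)" by simp
  then show ?case unfolding corr_shift using shiftl.IH[of "D - int k"] by (simp only:)
next
  case (shiftr g g' w k)
  have "w + int k - v - D - int k = w - v - D" by simp
  then show ?case unfolding corr_shift using shiftr.IH[of D] by (simp only:)
qed

text \<open>The equation x F' = \<gamma> x/(1 - x) F for F = (1 - x)^(-\<gamma>). On partitions:
  mark a part k, weighted by its size, and remove it.\<close>

lemma vacuum_rec: "real n * vacuum \<gamma> n = \<gamma> * (\<Sum>k<n. vacuum \<gamma> k)"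
proof -
  let ?t = "\<lambda>N. \<gamma> ^ size N / zfac N"
  have "real n * vacuum \<gamma> n = (\<Sum>N\<in>lev n. real (sum_mset N) * ?t N)"
    unfolding vacuum_def sum_distrib_left by (intro sum.cong) (auto simp: lev_def)
  also have "\<dots> = (\<Sum>N\<in>lev n. \<Sum>k=1..n. of_bool (k \<in># N) * (real (k * count N k) * ?t N))"
  proof (rule sum.cong)
    fix N assume "N \<in> lev n"
    then have "real (sum_mset N) = real (\<Sum>k=1..n. k * count N k)"
      using sum_mset_eq_sum_count[of N n] by (simp add: lev_def)
    also have "\<dots> * ?t N = (\<Sum>k=1..n. of_bool (k \<in># N) * (real (k * count N k) * ?t N))"
      unfolding of_nat_sum sum_distrib_right by (intro sum.cong) (auto simp: not_in_iff)
    finally show "real (sum_mset N) * ?t N = \<dots>" .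
  qed simp
  also have "\<dots> = (\<Sum>k=1..n. \<Sum>N\<in>lev n. of_bool (k \<in># N) * (real (k * count N k) * ?t N))"
    by (rule sum.swap)
  also have "\<dots> = (\<Sum>k=1..n. \<gamma> * vacuum \<gamma> (n - k))"
  proof (rule sum.cong)
    fix k assume k: "k \<in> {1..n}"
    have "(\<Sum>N\<in>lev n. of_bool (k \<in># N) * (real (k * count N k) * ?t N))
       = (\<Sum>N\<in>lev (n - k). real (k * count (add_mset k N) k) * ?t (add_mset k N))"
      using k by (subst sum_lev_add_mset) auto
    also have "\<dots> = (\<Sum>N\<in>lev (n - k). \<gamma> * ?t N)"
    proof (rule sum.cong)
      fix N
      define c where "c = real (k * (count N k + 1))"
      have "c \<noteq> 0" using k unfolding c_def of_nat_eq_0_iff by simp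
      moreover have "real (k * count (add_mset k N) k) = c" by (simp add: c_def)
      moreover have "?t (add_mset k N) = \<gamma> * \<gamma> ^ size N / (c * zfac N)"
        by (simp add: zfac_add_mset c_def)
      ultimately show "real (k * count (add_mset k N) k) * ?t (add_mset k N) = \<gamma> * ?t N"
        by (simp only: times_divide_eq_right mult_divide_mult_cancel_left[OF \<open>c \<noteq> 0\<close>])
    qed simp
    finally show "(\<Sum>N\<in>lev n. of_bool (k \<in># N) * (real (k * count N k) * ?t N)) = \<gamma> * vacuum \<gamma> (n - k)"
      by (simp only: vacuum_def sum_distrib_left)
  qed simp
  also have "\<dots> = (\<Sum>k<n. \<gamma> * vacuum \<gamma> k)"
    by (rule sum.reindex_bij_witness[of _ "\<lambda>k. n - k" "\<lambda>k. n - k"]) auto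
  finally show ?thesis by (simp only: sum_distrib_left)
qed

lemma vacuum_Suc: "real (Suc n) * vacuum \<gamma> (Suc n) = (real n + \<gamma>) * vacuum \<gamma> n"
  using vacuum_rec[of n \<gamma>] unfolding vacuum_rec[of "Suc n"] by (simp add: algebra_simps)

lemma vacuum_pos: "\<gamma> > 0 \<Longrightarrow> vacuum \<gamma> n > 0"
proof (induction n)
  case 0
  have "lev 0 = {{#}}" unfolding lev_def by (auto intro: multiset_nonemptyE)
  then show ?case by (simp add: vacuum_def)
next
  case (Suc n)
  then have "real (Suc n) * vacuum \<gamma> (Suc n) > 0"
    unfolding vacuum_Suc by simp
  then show ?case by (simp add: zero_less_mult_iff)
qed

text \<open>The coefficients behave like n^(\<gamma> - 1), so their squares are summable for
  \<gamma> < 1/2. Raabe's test detects this as the limit 2 - 2\<gamma> exceeding 1.\<close>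

lemma l2_vacuum_pos:
  assumes "0 < \<gamma>" "\<gamma> < 1 / 2"
  shows "l2 (vacuum \<gamma>)"
proof -
  let ?f = "\<lambda>n. (vacuum \<gamma> n)\<^sup>2"
  have ratio: "?f n / ?f (Suc n) = ((real n + 1) / (real n + \<gamma>))\<^sup>2" for n
  proof -
    have "vacuum \<gamma> n / vacuum \<gamma> (Suc n) = (real n + 1) / (real n + \<gamma>)"
      using vacuum_Suc[of n \<gamma>] vacuum_pos[OF assms(1), of n] vacuum_pos[OF assms(1), of "Suc n"] assms(1)
      by (simp add: divide_simps mult_ac add_ac)
    then show ?thesis by (simp add: power_divide[symmetric])
  qed
  have "(\<lambda>n. real n * (((real n + 1) / (real n + \<gamma>))\<^sup>2 - 1)) \<longlonglongrightarrow> 2 - 2 * \<gamma>"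
    by real_asymp
  then have "(\<lambda>n. ereal (of_nat n * (?f n / ?f (Suc n) - 1))) \<longlonglongrightarrow> ereal (2 - 2 * \<gamma>)"
    unfolding ratio by simp
  then have "liminf (\<lambda>n. ereal (of_nat n * (?f n / ?f (Suc n) - 1))) = ereal (2 - 2 * \<gamma>)"
    by (intro lim_imp_Liminf) auto
  moreover have "1 < ereal (2 - 2 * \<gamma>)" using assms by simp
  ultimately have gt: "1 < liminf (\<lambda>n. ereal (of_nat n * (?f n / ?f (Suc n) - 1)))" by (simp only:)
  have "?f n > 0" for n using vacuum_pos[OF assms(1), of n] by simp
  then have "summable ?f"
    by (intro raabes_test_convergence[OF _ gt] always_eventually) simp
  then show ?thesis
    unfolding l2_def by (intro norm_summable_imp_summable_on) simp
qed

lemma l2_vacuum: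
  assumes "\<bar>\<gamma>\<bar> < 1 / 2"
  shows "l2 (vacuum \<gamma>)"
proof -
  \<comment> \<open>A midpoint, positive even for \<gamma> = 0, where Raabe's test could not divide
    by the coefficients; \<open>vacuum\<close> at \<delta> dominates termwise and covers negative
    \<gamma>.\<close>
  define \<delta> where "\<delta> = (\<bar>\<gamma>\<bar> + 1 / 2) / 2"
  have \<delta>: "0 < \<delta>" "\<delta> < 1 / 2" "\<bar>\<gamma>\<bar> \<le> \<delta>" using assms by (auto simp: \<delta>_def)
  have "\<bar>vacuum \<gamma> n\<bar> \<le> vacuum \<delta> n" for n
  proof -
    have "\<bar>vacuum \<gamma> n\<bar> \<le> (\<Sum>N\<in>lev n. \<bar>\<gamma> ^ size N / zfac N\<bar>)"
      unfolding vacuum_def by (rule sum_abs)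
    also have "\<dots> \<le> vacuum \<delta> n"
      unfolding vacuum_def abs_divide power_abs
      by (intro sum_mono frac_le power_mono) (use \<delta> in \<open>auto simp: lev_def zfac_pos zfac_nonneg\<close>)
    finally show ?thesis .
  qed
  then have "(vacuum \<gamma> n)\<^sup>2 \<le> (vacuum \<delta> n)\<^sup>2" for n
    by (metis abs_ge_zero power2_abs power_mono)
  then show ?thesis
    using l2_vacuum_pos[OF \<delta>(1,2)] unfolding l2_def
    by (elim summable_on_comparison_test) auto
qed

lemma l2_gram:
  assumes "\<bar>\<alpha> * \<alpha>'\<bar> < 1 / 2" "0 \<notin># M" "0 \<notin># M'"
  shows "l2 (gram \<alpha> \<alpha>' M M')"
  using l2_reflected[OF reflected_gram[OF assms(2,3)] l2_vacuum[OF assms(1)]] ..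

section \<open>Sums over pairs of intermediate partitions\<close>

definition lev_pairs :: "int \<Rightarrow> (nat multiset \<times> nat multiset) set" where
  "lev_pairs D = {(N1, N2). 0 \<notin># N1 \<and> 0 \<notin># N2 \<and> int (sum_mset N1) - int (sum_mset N2) = D}"

lemma bij_lev_pairs:
  "bij_betw snd (Sigma (diag D) (\<lambda>p. lev (fst p) \<times> lev (snd p))) (lev_pairs D)"
  by (rule bij_betwI[of _ _ _ "\<lambda>(N1, N2). ((sum_mset N1, sum_mset N2), (N1, N2))"])
     (auto simp: diag_def lev_pairs_def lev_def)

lemma sum_lev_times:
  "(\<Sum>x\<in>lev m \<times> lev n. q1 (fst x) * q2 (snd x)) = (\<Sum>N\<in>lev m. q1 N) * (\<Sum>N\<in>lev n. q2 N :: real)"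
  by (simp add: sum_product sum.cartesian_product case_prod_beta)

text \<open>With nonnegative terms the totals of the finite level blocks decide summability; with
  signed terms cancellation inside a block could hide a divergence.\<close>

lemma summable_lev_pairs_nonneg:
  assumes "\<And>N. 0 \<le> q1 N" "\<And>N. 0 \<le> (q2 N :: real)"
    and "l2 (\<lambda>n. \<Sum>N\<in>lev n. q1 N)" "l2 (\<lambda>n. \<Sum>N\<in>lev n. q2 N)"
  shows "(\<lambda>x. q1 (fst x) * q2 (snd x)) summable_on lev_pairs D"
proof -
  have "(\<lambda>y. q1 (fst (snd y)) * q2 (snd (snd y))) summable_on Sigma (diag D) (\<lambda>p. lev (fst p) \<times> lev (snd p))"
  proof (rule summable_on_SigmaI)
    show "((\<lambda>y. q1 (fst (snd (x, y))) * q2 (snd (snd (x, y)))) has_sum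
       (\<Sum>N\<in>lev (fst x). q1 N) * (\<Sum>N\<in>lev (snd x). q2 N)) (lev (fst x) \<times> lev (snd x))" for x
      by (rule has_sum_finiteI) (auto simp: finite_lev sum_lev_times)
  qed (use assms corr_summable[OF assms(3,4)] in auto)
  then show ?thesis
    using summable_on_reindex_bij_betw[OF bij_lev_pairs, of "\<lambda>x. q1 (fst x) * q2 (snd x)"] by simp
qed

lemma has_sum_lev_pairs:
  assumes "(\<lambda>x. q1 (fst x) * q2 (snd x) :: real) summable_on lev_pairs D"
  shows "((\<lambda>x. q1 (fst x) * q2 (snd x)) has_sum
     corr (\<lambda>n. \<Sum>N\<in>lev n. q1 N) (\<lambda>n. \<Sum>N\<in>lev n. q2 N) D) (lev_pairs D)"
proof -
  obtain S where S: "((\<lambda>x. q1 (fst x) * q2 (snd x)) has_sum S) (lev_pairs D)"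
    using assms by (auto simp: summable_on_def)
  then have "((\<lambda>y. q1 (fst (snd y)) * q2 (snd (snd y))) has_sum S)
     (Sigma (diag D) (\<lambda>p. lev (fst p) \<times> lev (snd p)))"
    using has_sum_reindex_bij_betw[OF bij_lev_pairs, of "\<lambda>x. q1 (fst x) * q2 (snd x)"] by simp
  then have "((\<lambda>p. (\<Sum>N\<in>lev (fst p). q1 N) * (\<Sum>N\<in>lev (snd p). q2 N)) has_sum S) (diag D)"
  proof (rule has_sum_SigmaD)
    show "((\<lambda>y. q1 (fst (snd (x, y))) * q2 (snd (snd (x, y)))) has_sum
       (\<Sum>N\<in>lev (fst x). q1 N) * (\<Sum>N\<in>lev (snd x). q2 N)) (lev (fst x) \<times> lev (snd x))" for x
      by (rule has_sum_finiteI) (auto simp: finite_lev sum_lev_times)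
  qed
  then have "S = corr (\<lambda>n. \<Sum>N\<in>lev n. q1 N) (\<lambda>n. \<Sum>N\<in>lev n. q2 N) D"
    unfolding corr_def by (simp add: infsumI)
  with S show ?thesis by simp
qed

text \<open>The signed product is dominated, through 2|uv| <= u^2 + v^2, by the two diagonal cases.
  Their terms are nonnegative and their vacuum series have parameters \<alpha>^2 and \<alpha>'^2,
  whence a bound on each square.\<close>

lemma summable_gram_pairs:
  fixes \<alpha> \<alpha>' :: real
  assumes "\<alpha>\<^sup>2 < 1 / 2" "\<alpha>'\<^sup>2 < 1 / 2" "0 \<notin># M1" "0 \<notin># M2" "0 \<notin># M1'" "0 \<notin># M2'"
  shows "(\<lambda>x. (ycoef \<alpha> M1 (fst x) * ycoef \<alpha>' M1' (fst x) * zfac (fst x))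
     * (ycoef \<alpha> M2 (snd x) * ycoef \<alpha>' M2' (snd x) * zfac (snd x))) summable_on lev_pairs D"
proof -
  let ?r = "\<lambda>\<alpha> M1 M2 x. (ycoef \<alpha> M1 (fst x) * ycoef \<alpha> M1 (fst x) * zfac (fst x))
     * (ycoef \<alpha> M2 (snd x) * ycoef \<alpha> M2 (snd x) * zfac (snd x))"
  have r: "?r \<alpha> M1 M2 summable_on lev_pairs D"
    if "\<alpha>\<^sup>2 < 1 / 2" "0 \<notin># M1" "0 \<notin># M2" for \<alpha> M1 M2
  proof (rule summable_lev_pairs_nonneg)
    have "l2 (gram \<alpha> \<alpha> M M)" if "0 \<notin># M" for M
      using that \<open>\<alpha>\<^sup>2 < 1 / 2\<close> by (intro l2_gram) (auto simp: power2_eq_square)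
    then show "l2 (\<lambda>n. \<Sum>N\<in>lev n. ycoef \<alpha> M1 N * ycoef \<alpha> M1 N * zfac N)"
      "l2 (\<lambda>n. \<Sum>N\<in>lev n. ycoef \<alpha> M2 N * ycoef \<alpha> M2 N * zfac N)"
      using that(2,3) by (auto simp: gram_def[symmetric])
  qed (auto simp: zfac_nonneg)
  have "(\<lambda>x. ?r \<alpha> M1 M2 x + ?r \<alpha>' M1' M2' x) summable_on lev_pairs D"
    using assms by (intro summable_on_add r)
  then have "(\<lambda>x. norm ((ycoef \<alpha> M1 (fst x) * ycoef \<alpha>' M1' (fst x) * zfac (fst x))
     * (ycoef \<alpha> M2 (snd x) * ycoef \<alpha>' M2' (snd x) * zfac (snd x)))) summable_on lev_pairs D"
  proof (rule Infinite_Sum.abs_summable_on_comparison_test')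
    fix x :: "nat multiset \<times> nat multiset"
    define u v z where "u = ycoef \<alpha> M1 (fst x) * ycoef \<alpha> M2 (snd x)"
      and "v = ycoef \<alpha>' M1' (fst x) * ycoef \<alpha>' M2' (snd x)" and "z = zfac (fst x) * zfac (snd x)"
    have z: "z \<ge> 0" by (simp add: z_def zfac_nonneg)
    have "0 \<le> (\<bar>u\<bar> - \<bar>v\<bar>)\<^sup>2" by simp
    then have "2 * (\<bar>u\<bar> * \<bar>v\<bar>) \<le> u\<^sup>2 + v\<^sup>2" by (simp add: power2_diff)
    moreover have "0 \<le> \<bar>u\<bar> * \<bar>v\<bar>" by simp
    ultimately have "\<bar>u\<bar> * \<bar>v\<bar> * z \<le> (u\<^sup>2 + v\<^sup>2) * z"
      using z by (intro mult_right_mono) linarith+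
    then have "\<bar>u * v * z\<bar> \<le> u\<^sup>2 * z + v\<^sup>2 * z"
      using z by (simp add: abs_mult distrib_right)
    then show "norm ((ycoef \<alpha> M1 (fst x) * ycoef \<alpha>' M1' (fst x) * zfac (fst x))
     * (ycoef \<alpha> M2 (snd x) * ycoef \<alpha>' M2' (snd x) * zfac (snd x))) \<le> ?r \<alpha> M1 M2 x + ?r \<alpha>' M1' M2' x"
      by (simp add: u_def v_def z_def power2_eq_square mult_ac)
  qed
  then show ?thesis by (rule abs_summable_summable)
qed

lemma has_sum_kernel_product:
  fixes \<alpha>0 :: real and a a' :: int
  defines "\<alpha> \<equiv> of_int a * \<alpha>0" and "\<alpha>' \<equiv> of_int a' * \<alpha>0"
  assumes "\<alpha>\<^sup>2 < 1 / 2" "\<alpha>'\<^sup>2 < 1 / 2" "0 \<notin># M1" "0 \<notin># M2" "0 \<notin># M1'" "0 \<notin># M2'"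
    and j: "j + a = j' + a'"
    and \<Delta>: "int (sum_mset M1) - int (sum_mset M2) = \<Delta>" "int (sum_mset M1') - int (sum_mset M2') = \<Delta>"
  shows "((\<lambda>i. phi_kernel \<alpha>0 a s ((j, M1), (j, M2)) i * phi_kernel \<alpha>0 a' s ((j', M1'), (j', M2')) i * tweight i)
     has_sum corr (gram \<alpha> \<alpha>' M1 M1') (gram \<alpha> \<alpha>' M2 M2') (\<Delta> - s)) UNIV"
proof -
  let ?q1 = "\<lambda>N. ycoef \<alpha> M1 N * ycoef \<alpha>' M1' N * zfac N"
  let ?q2 = "\<lambda>N. ycoef \<alpha> M2 N * ycoef \<alpha>' M2' N * zfac N"
  let ?h = "\<lambda>i. phi_kernel \<alpha>0 a s ((j, M1), (j, M2)) i * phi_kernel \<alpha>0 a' s ((j', M1'), (j', M2')) i * tweight i"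
  define \<iota> :: "nat multiset \<times> nat multiset \<Rightarrow> tidx" where "\<iota> x = ((j + a, fst x), (j + a, snd x))" for x
  have inj: "inj \<iota>" by (auto simp: \<iota>_def inj_on_def prod_eq_iff)
  have "((\<lambda>x. ?q1 (fst x) * ?q2 (snd x)) has_sum
       corr (gram \<alpha> \<alpha>' M1 M1') (gram \<alpha> \<alpha>' M2 M2') (\<Delta> - s)) (lev_pairs (\<Delta> - s))"
    unfolding gram_def by (intro has_sum_lev_pairs summable_gram_pairs assms(3-8))
  also have "?this \<longleftrightarrow> ((?h \<circ> \<iota>) has_sum
       corr (gram \<alpha> \<alpha>' M1 M1') (gram \<alpha> \<alpha>' M2 M2') (\<Delta> - s)) (lev_pairs (\<Delta> - s))"
  proof (rule has_sum_cong)
    fix x assume "x \<in> lev_pairs (\<Delta> - s)"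
    then show "?q1 (fst x) * ?q2 (snd x) = (?h \<circ> \<iota>) x"
      using j \<Delta> by (auto simp: \<iota>_def phi_kernel_def tweight_def lev_pairs_def \<alpha>_def \<alpha>'_def)
  qed
  also have "\<dots> \<longleftrightarrow> (?h has_sum
       corr (gram \<alpha> \<alpha>' M1 M1') (gram \<alpha> \<alpha>' M2 M2') (\<Delta> - s)) (\<iota> ` lev_pairs (\<Delta> - s))"
    by (rule has_sum_reindex[symmetric]) (rule inj_on_subset[OF inj], simp)
  also have "\<dots> \<longleftrightarrow> (?h has_sum
       corr (gram \<alpha> \<alpha>' M1 M1') (gram \<alpha> \<alpha>' M2 M2') (\<Delta> - s)) UNIV"
  proof (rule has_sum_cong_neutral)
    fix i assume i: "i \<in> UNIV - \<iota> ` lev_pairs (\<Delta> - s)"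
    obtain k1 N1 k2 N2 where e: "i = ((k1, N1), (k2, N2))" by (metis prod.collapse)
    show "?h i = 0"
    proof (rule ccontr)
      assume nz: "?h i \<noteq> 0"
      then have "k1 = j + a" "k2 = j + a"
        "s = int (sum_mset M1) - int (sum_mset N1) - int (sum_mset M2) + int (sum_mset N2)"
        by (auto simp: e phi_kernel_def)
      moreover have "0 \<notin># N1" "0 \<notin># N2"
        using nz by (auto simp: e phi_kernel_def ycoef_eq_0)
      ultimately have "i = \<iota> (N1, N2)" "(N1, N2) \<in> lev_pairs (\<Delta> - s)"
        using \<Delta> by (auto simp: e \<iota>_def lev_pairs_def)
      with i show False by blast
    qed
  qed auto
  finally show ?thesis .
qed

lemma kernel_product_symmetric:
  fixes \<alpha>0 :: real
  assumes "(of_int a * \<alpha>0)\<^sup>2 < 1 / 2" "(of_int a' * \<alpha>0)\<^sup>2 < 1 / 2" "good e" "good e'"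
  shows "\<exists>S. ((\<lambda>i. phi_kernel \<alpha>0 a s e i * phi_kernel \<alpha>0 a' s e' i * tweight i) has_sum S) UNIV \<and>
    ((\<lambda>i. phi_kernel \<alpha>0 (-a') (-s) e i * phi_kernel \<alpha>0 (-a) (-s) e' i * tweight i) has_sum S) UNIV"
proof -
  obtain j M1 M2 where e: "e = ((j, M1), (j, M2))" and M: "0 \<notin># M1" "0 \<notin># M2"
    using assms(3) unfolding good_def by (metis prod.collapse)
  obtain j' M1' M2' where e': "e' = ((j', M1'), (j', M2'))" and M': "0 \<notin># M1'" "0 \<notin># M2'"
    using assms(4) unfolding good_def by (metis prod.collapse)
  define \<alpha> \<alpha>' where "\<alpha> = of_int a * \<alpha>0" and "\<alpha>' = of_int a' * \<alpha>0"
  show ?thesis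
  proof (cases "j + a = j' + a' \<and> int (sum_mset M1) - int (sum_mset M2) = int (sum_mset M1') - int (sum_mset M2')")
    case False
    \<comment> \<open>Such a mismatch of charge or level difference excludes a common intermediate
      state in either order of the fields.\<close>
    then have "phi_kernel \<alpha>0 a s e i * phi_kernel \<alpha>0 a' s e' i * tweight i = 0"
      "phi_kernel \<alpha>0 (-a') (-s) e i * phi_kernel \<alpha>0 (-a) (-s) e' i * tweight i = 0" for i
      by (auto simp: phi_kernel_def e e' split: prod.splits)
    then show ?thesis by (intro exI[of _ 0]) (simp add: has_sum_0)
  next
    case True
    define \<Delta> where "\<Delta> = int (sum_mset M1) - int (sum_mset M2)"
    have 1: "((\<lambda>i. phi_kernel \<alpha>0 a s e i * phi_kernel \<alpha>0 a' s e' i * tweight i)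
       has_sum corr (gram \<alpha> \<alpha>' M1 M1') (gram \<alpha> \<alpha>' M2 M2') (\<Delta> - s)) UNIV"
      unfolding e e' \<alpha>_def \<alpha>'_def using True assms M M'
      by (intro has_sum_kernel_product) (auto simp: \<Delta>_def)
    have 2: "((\<lambda>i. phi_kernel \<alpha>0 (-a') (-s) e i * phi_kernel \<alpha>0 (-a) (-s) e' i * tweight i)
       has_sum corr (gram (of_int (-a') * \<alpha>0) (of_int (-a) * \<alpha>0) M1 M1')
         (gram (of_int (-a') * \<alpha>0) (of_int (-a) * \<alpha>0) M2 M2') (\<Delta> - (- s))) UNIV"
      unfolding e e' using True assms M M'
      by (intro has_sum_kernel_product) (auto simp: \<Delta>_def)
    have "\<bar>\<alpha> * \<alpha>'\<bar> < 1 / 2"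
    proof -
      have "0 \<le> (\<bar>\<alpha>\<bar> - \<bar>\<alpha>'\<bar>)\<^sup>2" by simp
      then have "2 * (\<bar>\<alpha>\<bar> * \<bar>\<alpha>'\<bar>) \<le> \<alpha>\<^sup>2 + \<alpha>'\<^sup>2" by (simp add: power2_diff)
      also have "\<dots> < 1" using assms(1,2) by (simp add: \<alpha>_def \<alpha>'_def)
      finally show ?thesis by (simp add: abs_mult)
    qed
    then have "corr (gram \<alpha> \<alpha>' M1 M1') (gram \<alpha> \<alpha>' M2 M2') (\<Delta> - s)
       = corr (gram (-\<alpha>') (-\<alpha>) M1 M1') (gram (-\<alpha>') (-\<alpha>) M2 M2')
          (int (sum_mset M1) + int (sum_mset M1') - (int (sum_mset M2) + int (sum_mset M2')) - (\<Delta> - s))"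
      by (intro corr_reflected[where b = "vacuum (\<alpha> * \<alpha>')"] reflected_gram M M' l2_vacuum)
    \<comment> \<open>Both pairs have level difference \<Delta>, so the degrees differ by 2\<Delta>
      and the reflected index is the one of mode -s.\<close>
    also have "int (sum_mset M1) + int (sum_mset M1') - (int (sum_mset M2) + int (sum_mset M2')) - (\<Delta> - s)
       = \<Delta> - (- s)" using True by (simp add: \<Delta>_def)
    finally show ?thesis using 1 2 by (auto simp: \<alpha>_def \<alpha>'_def)
  qed
qed

text \<open>Weak commutativity: as \<Phi>_(a,s) has transpose \<Phi>_(-a,-s), the sums stand for f
  paired with \<Phi>_(-a,-s) \<Phi>_(a',s) g and with the product in the other order. The common S
  asserts convergence and equality together.\<close>

lemma Phi_product_symmetric:
  assumes "(of_int a * \<alpha>0)\<^sup>2 < 1 / 2" "(of_int a' * \<alpha>0)\<^sup>2 < 1 / 2" "inD f" "inD g"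
  shows "\<exists>S. ((\<lambda>i. Phi \<alpha>0 a s f i * Phi \<alpha>0 a' s g i * wt i) has_sum S) UNIV \<and>
    ((\<lambda>i. Phi \<alpha>0 (-a') (-s) f i * Phi \<alpha>0 (-a) (-s) g i * wt i) has_sum S) UNIV"
proof -
  let ?F = "{e. f e \<noteq> 0}" and ?G = "{e. g e \<noteq> 0}"
  have fin: "finite ?F" "finite ?G" using assms by (auto simp: inD_def)
  let ?h = "\<lambda>e e' i. phi_kernel \<alpha>0 a s e i * phi_kernel \<alpha>0 a' s e' i * tweight i"
  let ?h' = "\<lambda>e e' i. phi_kernel \<alpha>0 (-a') (-s) e i * phi_kernel \<alpha>0 (-a) (-s) e' i * tweight i"
  define S where "S e e' = infsum (?h e e') UNIV" for e e'
  have S: "(?h e e' has_sum S e e') UNIV \<and> (?h' e e' has_sum S e e') UNIV"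
    if "e \<in> ?F" "e' \<in> ?G" for e e'
  proof -
    have "good e" "good e'" using that inD_good[OF assms(3)] inD_good[OF assms(4)] by auto
    from kernel_product_symmetric[OF assms(1,2) this, of s]
    obtain S' where S': "(?h e e' has_sum S') UNIV" "(?h' e e' has_sum S') UNIV"
      by (elim exE conjE)
    moreover have "S e e' = S'" unfolding S_def using S'(1) by (rule infsumI)
    ultimately show ?thesis by simp
  qed
  have expand: "Phi \<alpha>0 b t f i * Phi \<alpha>0 b' t g i * wt i
     = (\<Sum>e\<in>?F. \<Sum>e'\<in>?G. f e * g e' * of_real (phi_kernel \<alpha>0 b t e i * phi_kernel \<alpha>0 b' t e' i * tweight i))" for b b' t i
    unfolding Phi_eq_sum_kernel[OF assms(3)] Phi_eq_sum_kernel[OF assms(4)]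
    by (simp add: sum_distrib_left sum_distrib_right mult_ac) (rule sum.swap)
  let ?S = "\<Sum>e\<in>?F. \<Sum>e'\<in>?G. f e * g e' * of_real (S e e')"
  have "((\<lambda>i. Phi \<alpha>0 a s f i * Phi \<alpha>0 a' s g i * wt i) has_sum ?S) UNIV"
    unfolding expand using S by (intro has_sum_finite_sum fin has_sum_cmult_right has_sum_of_real) blast
  moreover have "((\<lambda>i. Phi \<alpha>0 (-a') (-s) f i * Phi \<alpha>0 (-a) (-s) g i * wt i) has_sum ?S) UNIV"
    unfolding expand using S by (intro has_sum_finite_sum fin has_sum_cmult_right has_sum_of_real) blast
  ultimately show ?thesis by blast
qed

section \<open>The Lorentz relations\<close>

text \<open>The matrix elements of \<open>ell\<close> are real, so conjugating the first vector at
  the outset replaces the inner product by a symmetric bilinear form.\<close>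

definition bil :: "tvec \<Rightarrow> tvec \<Rightarrow> complex" where
  "bil f g = (\<Sum>\<^sub>\<infinity>i. f i * g i * wt i)"

definition A_op :: "real \<Rightarrow> int \<Rightarrow> tvec \<Rightarrow> tvec" where
  "A_op \<alpha>0 s = (if s = 1 then A_dn \<alpha>0 else A_up \<alpha>0)"

definition V_op :: "real \<Rightarrow> int \<Rightarrow> int \<Rightarrow> tvec \<Rightarrow> tvec" where
  "V_op \<alpha>0 a s \<Psi> i = Phi \<alpha>0 a s \<Psi> i + Phi \<alpha>0 (-a) s \<Psi> i"

definition grade :: "tidx \<Rightarrow> int" where
  "grade i = int (sum_mset (snd (fst i))) - int (sum_mset (snd (snd i)))"

lemma ell_pm1:
  assumes "s \<in> {-1, 1}"
  shows "ell \<alpha>0 a lam s \<Psi> i = A_op \<alpha>0 s \<Psi> i + of_real lam * V_op \<alpha>0 a s \<Psi> i"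
  using assms by (auto simp: ell_def A_op_def V_op_def A_dn_def A_up_def)

lemma ell_0:
  assumes "inD \<Psi>"
  shows "ell \<alpha>0 a lam 0 \<Psi> i = of_int (grade i) * \<Psi> i"
proof -
  obtain j1 N1 j2 N2 where i: "i = ((j1, N1), (j2, N2))" by (metis prod.collapse)
  show ?thesis
  proof (cases "\<Psi> i = 0")
    case False
    then have "j1 = j2" using inD_good[OF assms False] by (simp add: good_def i)
    then show ?thesis
      by (simp add: ell_def lift1_def lift2_def Lop_0 i grade_def algebra_simps)
  next
    case True
    then show ?thesis by (simp add: ell_def lift1_def lift2_def Lop_0 i)
  qed
qed

lemma inD_grade: "inD \<Psi> \<Longrightarrow> inD (\<lambda>i. of_int (grade i) * \<Psi> i)"
  unfolding inD_def by (auto elim!: rev_finite_subset)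

lemma kernel_grade: "phi_kernel \<alpha>0 a s e i \<noteq> 0 \<Longrightarrow> grade e = grade i + s"
  by (auto simp: phi_kernel_def grade_def split: prod.splits)

lemma Phi_grade:
  assumes "inD \<Psi>"
  shows "Phi \<alpha>0 a s (\<lambda>i. of_int (grade i) * \<Psi> i) i = of_int (grade i + s) * Phi \<alpha>0 a s \<Psi> i"
proof -
  have "Phi \<alpha>0 a s (\<lambda>i. of_int (grade i) * \<Psi> i) i
     = (\<Sum>e | of_int (grade e) * \<Psi> e \<noteq> 0. of_int (grade e) * \<Psi> e * complex_of_real (phi_kernel \<alpha>0 a s e i))"
    by (rule Phi_eq_sum_kernel[OF inD_grade[OF assms]])
  also have "\<dots> = (\<Sum>e | \<Psi> e \<noteq> 0. of_int (grade e) * \<Psi> e * complex_of_real (phi_kernel \<alpha>0 a s e i))"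
    using assms by (intro sum.mono_neutral_left) (auto simp: inD_def)
  also have "\<dots> = (\<Sum>e | \<Psi> e \<noteq> 0. of_int (grade i + s) * (\<Psi> e * complex_of_real (phi_kernel \<alpha>0 a s e i)))"
  proof (rule sum.cong)
    fix e
    show "of_int (grade e) * \<Psi> e * complex_of_real (phi_kernel \<alpha>0 a s e i)
        = of_int (grade i + s) * (\<Psi> e * complex_of_real (phi_kernel \<alpha>0 a s e i))"
      using kernel_grade[of \<alpha>0 a s e i] by (cases "phi_kernel \<alpha>0 a s e i = 0") simp_all
  qed simp
  finally show ?thesis by (simp only: sum_distrib_left Phi_eq_sum_kernel[OF assms])
qed

lemma A_op_grade:
  assumes "s \<in> {-1, 1}"
  shows "A_op \<alpha>0 s (\<lambda>i. of_int (grade i) * \<Psi> i) i = of_int (grade i + s) * A_op \<alpha>0 s \<Psi> i"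
proof -
  obtain j1 N1 j2 N2 where i: "i = ((j1, N1), (j2, N2))" by (metis prod.collapse)
  have dn: "vir_dn \<beta> (\<lambda>M. of_int (grade (F M)) * \<Psi> (F M)) N = of_int c * vir_dn \<beta> (\<lambda>M. \<Psi> (F M)) N"
    if "\<And>M. sum_mset M = sum_mset N + 1 \<Longrightarrow> grade (F M) = c" for F N \<beta> c
    by (rule vir_dn_scaled) (simp add: that)
  have up: "vir_up \<beta> (\<lambda>M. of_int (grade (F M)) * \<Psi> (F M)) N = of_int c * vir_up \<beta> (\<lambda>M. \<Psi> (F M)) N"
    if "\<And>M. sum_mset M + 1 = sum_mset N \<Longrightarrow> grade (F M) = c" for F N \<beta> c
    by (rule vir_up_scaled) (simp add: that)
  consider "s = 1" | "s = -1" using assms by blast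
  then show ?thesis
  proof cases
    case 1
    have "vir_dn \<beta> (\<lambda>M. of_int (grade ((j1, M), (j2, N2))) * \<Psi> ((j1, M), (j2, N2))) N1
       = of_int (grade i + s) * vir_dn \<beta> (\<lambda>M. \<Psi> ((j1, M), (j2, N2))) N1" for \<beta>
      by (rule dn) (simp add: grade_def i 1)
    moreover have "vir_up \<beta> (\<lambda>M. of_int (grade ((j1, N1), (j2, M))) * \<Psi> ((j1, N1), (j2, M))) N2
       = of_int (grade i + s) * vir_up \<beta> (\<lambda>M. \<Psi> ((j1, N1), (j2, M))) N2" for \<beta>
      by (rule up) (simp add: grade_def i 1)
    ultimately have "A_dn \<alpha>0 (\<lambda>i. of_int (grade i) * \<Psi> i) i = of_int (grade i + s) * A_dn \<alpha>0 \<Psi> i"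
      by (simp only: i A_dn_eq distrib_left)
    then show ?thesis by (simp add: A_op_def 1)
  next
    case 2
    have "vir_up \<beta> (\<lambda>M. of_int (grade ((j1, M), (j2, N2))) * \<Psi> ((j1, M), (j2, N2))) N1
       = of_int (grade i + s) * vir_up \<beta> (\<lambda>M. \<Psi> ((j1, M), (j2, N2))) N1" for \<beta>
      by (rule up) (simp add: grade_def i 2)
    moreover have "vir_dn \<beta> (\<lambda>M. of_int (grade ((j1, N1), (j2, M))) * \<Psi> ((j1, N1), (j2, M))) N2
       = of_int (grade i + s) * vir_dn \<beta> (\<lambda>M. \<Psi> ((j1, N1), (j2, M))) N2" for \<beta>
      by (rule dn) (simp add: grade_def i 2)
    ultimately have "A_up \<alpha>0 (\<lambda>i. of_int (grade i) * \<Psi> i) i = of_int (grade i + s) * A_up \<alpha>0 \<Psi> i"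
      by (simp only: i A_up_eq distrib_left)
    then show ?thesis by (simp add: A_op_def 2)
  qed
qed

lemma has_sum_A_op:
  assumes "finite {i. f i \<noteq> 0}" "s \<in> {-1, 1}"
  shows "((\<lambda>i. A_op \<alpha>0 s f i * g i * wt i) has_sum (\<Sum>i | f i \<noteq> 0. f i * A_op \<alpha>0 (-s) g i * wt i)) UNIV"
  using assms(2) has_sum_A_dn[OF assms(1)] has_sum_A_up[OF assms(1)] by (auto simp: A_op_def)

lemma has_sum_Phi_finite:
  assumes "inD f" "inD g"
  shows "((\<lambda>i. Phi \<alpha>0 a s f i * g i * wt i) has_sum
     (\<Sum>i | f i \<noteq> 0. f i * Phi \<alpha>0 (-a) (-s) g i * wt i)) UNIV"
proof -
  let ?F = "{e. f e \<noteq> 0}" and ?G = "{e. g e \<noteq> 0}"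
  have fin: "finite ?F" "finite ?G" using assms by (auto simp: inD_def)
  have "((\<lambda>i. Phi \<alpha>0 a s f i * g i * wt i) has_sum (\<Sum>i\<in>?G. Phi \<alpha>0 a s f i * g i * wt i)) UNIV"
    by (rule has_sum_finite_support) (use fin in auto)
  also have "(\<Sum>i\<in>?G. Phi \<alpha>0 a s f i * g i * wt i)
     = (\<Sum>i\<in>?G. \<Sum>e\<in>?F. f e * g i * of_real (phi_kernel \<alpha>0 a s e i * tweight i))"
    unfolding Phi_eq_sum_kernel[OF assms(1)] by (simp add: sum_distrib_right sum_distrib_left mult_ac)
  also have "\<dots> = (\<Sum>i\<in>?G. \<Sum>e\<in>?F. f e * g i * of_real (phi_kernel \<alpha>0 (-a) (-s) i e * tweight e))"
    using inD_good[OF assms(1)] inD_good[OF assms(2)]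
    by (intro sum.cong refl arg_cong2[of _ _ _ _ "(*)"] arg_cong[of _ _ of_real] kernel_adjoint) auto
  also have "\<dots> = (\<Sum>e\<in>?F. \<Sum>i\<in>?G. f e * g i * of_real (phi_kernel \<alpha>0 (-a) (-s) i e * tweight e))"
    by (rule sum.swap)
  also have "\<dots> = (\<Sum>e\<in>?F. f e * Phi \<alpha>0 (-a) (-s) g e * wt e)"
    unfolding Phi_eq_sum_kernel[OF assms(2)]
    by (simp add: sum_distrib_right sum_distrib_left mult_ac)
  finally show ?thesis .
qed

lemma has_sum_ell_finite:
  assumes "inD f" "inD g" "s \<in> {-1, 1}"
  shows "((\<lambda>i. ell \<alpha>0 a lam s f i * g i * wt i) has_sum
     (\<Sum>i | f i \<noteq> 0. f i * ell \<alpha>0 a lam (-s) g i * wt i)) UNIV"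
proof -
  have "finite {i. f i \<noteq> 0}" using assms by (simp add: inD_def)
  note A = has_sum_A_op[OF this assms(3), of \<alpha>0 g]
  have V: "((\<lambda>i. of_real lam * (Phi \<alpha>0 a s f i * g i * wt i + Phi \<alpha>0 (-a) s f i * g i * wt i)) has_sum
    of_real lam * ((\<Sum>i | f i \<noteq> 0. f i * Phi \<alpha>0 (-a) (-s) g i * wt i)
      + (\<Sum>i | f i \<noteq> 0. f i * Phi \<alpha>0 (-(-a)) (-s) g i * wt i))) UNIV"
    by (intro has_sum_cmult_right has_sum_add has_sum_Phi_finite assms(1,2))
  have s: "-s \<in> {-1, 1}" using assms(3) by auto
  show ?thesis
    using has_sum_add[OF A V]
    by (simp add: ell_pm1[OF assms(3)] ell_pm1[OF s] V_op_def algebra_simps sum.distrib sum_distrib_left)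
qed

text \<open>\<open>ell\<close> at s lowers the grade by s, and \<open>ell\<close> at 0 multiplies by
  the grade. Weighting g by its grade stays in the domain, so the other generator can be moved off
  f.\<close>

lemma ell_0_commutator:
  assumes "inD f" "inD g" "s \<in> {-1, 1}"
  shows "bil (ell \<alpha>0 a lam 0 f) (ell \<alpha>0 a lam s g) - bil (ell \<alpha>0 a lam (-s) f) (ell \<alpha>0 a lam 0 g)
     = - of_int s * bil f (ell \<alpha>0 a lam s g)"
proof -
  let ?F = "{i. f i \<noteq> 0}" and ?l = "ell \<alpha>0 a lam"
  have fin: "finite ?F" using assms by (simp add: inD_def)
  have s: "-s \<in> {-1, 1}" using assms(3) by auto
  have "((\<lambda>i. ?l 0 f i * ?l s g i * wt i) has_sum (\<Sum>i\<in>?F. ?l 0 f i * ?l s g i * wt i)) UNIV"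
    by (rule has_sum_finite_support) (use fin ell_0[OF assms(1)] in auto)
  then have 1: "bil (?l 0 f) (?l s g) = (\<Sum>i\<in>?F. of_int (grade i) * f i * ?l s g i * wt i)"
    by (simp add: bil_def infsumI ell_0[OF assms(1)])
  have "((\<lambda>i. f i * ?l s g i * wt i) has_sum (\<Sum>i\<in>?F. f i * ?l s g i * wt i)) UNIV"
    by (rule has_sum_finite_support) (use fin in auto)
  then have 2: "bil f (?l s g) = (\<Sum>i\<in>?F. f i * ?l s g i * wt i)"
    by (simp add: bil_def infsumI)
  have "?l 0 g = (\<lambda>i. of_int (grade i) * g i)" using ell_0[OF assms(2)] by blast
  then have "bil (?l (-s) f) (?l 0 g) = (\<Sum>i\<in>?F. f i * ?l s (\<lambda>i. of_int (grade i) * g i) i * wt i)"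
    using has_sum_ell_finite[OF assms(1) inD_grade[OF assms(2)] s, of \<alpha>0 a lam]
    by (simp add: bil_def infsumI)
  also have "\<dots> = (\<Sum>i\<in>?F. of_int (grade i) * f i * ?l s g i * wt i + of_int s * (f i * ?l s g i * wt i))"
  proof (rule sum.cong)
    fix i
    have "?l s (\<lambda>i. of_int (grade i) * g i) i = of_int (grade i + s) * ?l s g i"
      unfolding ell_pm1[OF assms(3)] V_op_def A_op_grade[OF assms(3)] Phi_grade[OF assms(2)]
      by (simp only: distrib_left mult.left_commute)
    then show "f i * ?l s (\<lambda>i. of_int (grade i) * g i) i * wt i
       = of_int (grade i) * f i * ?l s g i * wt i + of_int s * (f i * ?l s g i * wt i)"
      by (simp add: algebra_simps)
  qed simp
  finally show ?thesis unfolding 1 2 by (simp add: sum.distrib sum_distrib_left sum_negf)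
qed

text \<open>The weak form of [A_s, \<Phi>_(a,-s)], with the generator applied to the infinite field
  image, where it is pointwise finite. The right side is free of s.\<close>

lemma Phi_A_commutator:
  assumes "inD f" "inD g" "s \<in> {-1, 1}"
  shows "(\<Sum>i | f i \<noteq> 0. f i * A_op \<alpha>0 s (Phi \<alpha>0 a (-s) g) i * wt i)
     - (\<Sum>e | g e \<noteq> 0. g e * A_op \<alpha>0 (-s) (Phi \<alpha>0 (-a) s f) e * wt e)
     = (\<Sum>i | f i \<noteq> 0. \<Sum>e | g e \<noteq> 0. f i * g e * of_real (comm_kernel \<alpha>0 a e i))"
proof -
  let ?F = "{e. f e \<noteq> 0}" and ?G = "{e. g e \<noteq> 0}"
  have lin: "A_op \<alpha>0 t (Phi \<alpha>0 b u \<Psi>) i = (\<Sum>e | \<Psi> e \<noteq> 0. \<Psi> e * A_op \<alpha>0 t (\<lambda>i. of_real (phi_kernel \<alpha>0 b u e i)) i)"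
    if "inD \<Psi>" for t b u \<Psi> i
  proof -
    have "Phi \<alpha>0 b u \<Psi> = (\<lambda>i. \<Sum>e | \<Psi> e \<noteq> 0. \<Psi> e * of_real (phi_kernel \<alpha>0 b u e i))"
      using Phi_eq_sum_kernel[OF that] by blast
    then show ?thesis by (simp add: A_op_def A_dn_sum A_up_sum)
  qed
  have 1: "(\<Sum>i\<in>?F. f i * A_op \<alpha>0 s (Phi \<alpha>0 a (-s) g) i * wt i)
     = (\<Sum>i\<in>?F. \<Sum>e\<in>?G. f i * g e * (wt i * A_op \<alpha>0 s (\<lambda>i. of_real (phi_kernel \<alpha>0 a (-s) e i)) i))"
    unfolding lin[OF assms(2)] by (simp add: sum_distrib_left sum_distrib_right mult_ac)
  have "(\<Sum>e\<in>?G. g e * A_op \<alpha>0 (-s) (Phi \<alpha>0 (-a) s f) e * wt e)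
     = (\<Sum>e\<in>?G. \<Sum>i\<in>?F. f i * g e * (wt e * A_op \<alpha>0 (-s) (\<lambda>e. of_real (phi_kernel \<alpha>0 (-a) s i e)) e))"
    unfolding lin[OF assms(1)] by (simp add: sum_distrib_left sum_distrib_right mult_ac)
  also have "\<dots> = (\<Sum>i\<in>?F. \<Sum>e\<in>?G. f i * g e * (wt e * A_op \<alpha>0 (-s) (\<lambda>e. of_real (phi_kernel \<alpha>0 (-a) s i e)) e))"
    by (rule sum.swap)
  finally have 2: "(\<Sum>e\<in>?G. g e * A_op \<alpha>0 (-s) (Phi \<alpha>0 (-a) s f) e * wt e) = \<dots>" .
  have "wt i * A_op \<alpha>0 s (\<lambda>i. of_real (phi_kernel \<alpha>0 a (-s) e i)) i
      - wt e * A_op \<alpha>0 (-s) (\<lambda>e. of_real (phi_kernel \<alpha>0 (-a) s i e)) e = of_real (comm_kernel \<alpha>0 a e i)"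
    if "i \<in> ?F" "e \<in> ?G" for i e
  proof -
    have "good e" "good i" using that inD_good[OF assms(1)] inD_good[OF assms(2)] by auto
    from comm_kernel_eq[OF this] show ?thesis using assms(3) by (auto simp: A_op_def)
  qed
  then show ?thesis
    unfolding 1 2 sum_subtractf[symmetric] right_diff_distrib[symmetric]
    by (intro sum.cong refl) auto
qed

lemma ell_pm1_commutator:
  assumes "inD f" "inD g" "(of_int a * \<alpha>0)\<^sup>2 < 1 / 2"
  shows "bil (ell \<alpha>0 a lam (-1) f) (ell \<alpha>0 a lam (-1) g) - bil (ell \<alpha>0 a lam 1 f) (ell \<alpha>0 a lam 1 g)
     = 2 * bil f (ell \<alpha>0 a lam 0 g)"
proof -
  let ?F = "{i. f i \<noteq> 0}" and ?G = "{i. g i \<noteq> 0}" and ?l = "ell \<alpha>0 a lam"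
  let ?A = "A_op \<alpha>0" and ?P = "Phi \<alpha>0" and ?lam = "complex_of_real lam"
  have fin: "finite ?F" "finite ?G" using assms by (simp_all add: inD_def)
  have a: "(of_int (-a) * \<alpha>0)\<^sup>2 < 1 / 2" using assms(3) by simp
  \<comment> \<open>X and Z are the cross terms with the field on g and on f respectively, the free
    generator having been moved onto the field image.\<close>
  define X where "X b s = (\<Sum>i\<in>?F. f i * ?A s (?P b (-s) g) i * wt i)" for b s
  define Z where "Z b s = (\<Sum>e\<in>?G. g e * ?A s (?P b (-s) f) e * wt e)" for b s
  define B where "B s = (\<Sum>i\<in>?F. f i * ?A s (?A (-s) g) i * wt i)" for s
  have XZ: "X b 1 - Z (-b) (-1) = X b (-1) - Z (-b) 1" for b
    using Phi_A_commutator[OF assms(1,2), of 1 \<alpha>0 b] Phi_A_commutator[OF assms(1,2), of "-1" \<alpha>0 b]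
    by (simp add: X_def Z_def)
  obtain S1 where S1: "((\<lambda>i. ?P a (-1) f i * ?P a (-1) g i * wt i) has_sum S1) UNIV"
    "((\<lambda>i. ?P (-a) 1 f i * ?P (-a) 1 g i * wt i) has_sum S1) UNIV"
    using Phi_product_symmetric[OF assms(3,3,1,2), of "-1"] by auto
  obtain S2 where S2: "((\<lambda>i. ?P a (-1) f i * ?P (-a) (-1) g i * wt i) has_sum S2) UNIV"
    "((\<lambda>i. ?P a 1 f i * ?P (-a) 1 g i * wt i) has_sum S2) UNIV"
    using Phi_product_symmetric[OF assms(3) a assms(1,2), of "-1"] by auto
  obtain S3 where S3: "((\<lambda>i. ?P (-a) (-1) f i * ?P a (-1) g i * wt i) has_sum S3) UNIV"
    "((\<lambda>i. ?P (-a) 1 f i * ?P a 1 g i * wt i) has_sum S3) UNIV"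
    using Phi_product_symmetric[OF a assms(3,1,2), of "-1"] by auto
  obtain S4 where S4: "((\<lambda>i. ?P (-a) (-1) f i * ?P (-a) (-1) g i * wt i) has_sum S4) UNIV"
    "((\<lambda>i. ?P a 1 f i * ?P a 1 g i * wt i) has_sum S4) UNIV"
    using Phi_product_symmetric[OF a a assms(1,2), of "-1"] by auto
  have bil_eq: "bil (?l s f) (?l s g) = B (-s) + ?lam * (X a (-s) + X (-a) (-s)) + ?lam * (Z a (-s) + Z (-a) (-s))
       + ?lam * ?lam * (S1 + S2 + S3 + S4)" if s: "s \<in> {-1, 1}" for s
  proof -
    have AA: "((\<lambda>i. ?A s f i * ?A s g i * wt i) has_sum B (-s)) UNIV"
      using has_sum_A_op[OF fin(1) s, of \<alpha>0 "?A s g"] by (simp add: B_def)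
    have AP: "((\<lambda>i. ?A s f i * ?P b s g i * wt i) has_sum X b (-s)) UNIV" for b
      using has_sum_A_op[OF fin(1) s, of \<alpha>0 "?P b s g"] by (simp add: X_def)
    have PA: "((\<lambda>i. ?P b s f i * ?A s g i * wt i) has_sum Z b (-s)) UNIV" for b
      using has_sum_A_op[OF fin(2) s, of \<alpha>0 "?P b s f"] by (simp add: Z_def mult_ac)
    have PP: "((\<lambda>i. ?P a s f i * ?P a s g i * wt i + ?P a s f i * ?P (-a) s g i * wt i
        + ?P (-a) s f i * ?P a s g i * wt i + ?P (-a) s f i * ?P (-a) s g i * wt i)
        has_sum (S1 + S2 + S3 + S4)) UNIV"
    proof -
      consider "s = 1" | "s = -1" using s by blast
      then show ?thesis
      proof cases
        case 1
        \<comment> \<open>Passing from s = -1 to s = 1 exchanges the sums for (a, a) and (-a, -a)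
          and fixes the mixed ones. Hence only the combination of both fields has an order
          \<lambda>^2 part independent of s.\<close>
        have "S1 + S2 + S3 + S4 = S4 + S2 + S3 + S1" by simp
        then show ?thesis unfolding 1 by (simp only:) (intro has_sum_add S1 S2 S3 S4)
      next
        case 2
        show ?thesis unfolding 2 by (intro has_sum_add S1 S2 S3 S4)
      qed
    qed
    have "((\<lambda>i. ?A s f i * ?A s g i * wt i
        + ?lam * (?A s f i * ?P a s g i * wt i + ?A s f i * ?P (-a) s g i * wt i)
        + ?lam * (?P a s f i * ?A s g i * wt i + ?P (-a) s f i * ?A s g i * wt i)
        + ?lam * ?lam * (?P a s f i * ?P a s g i * wt i + ?P a s f i * ?P (-a) s g i * wt i
        + ?P (-a) s f i * ?P a s g i * wt i + ?P (-a) s f i * ?P (-a) s g i * wt i)) has_sum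
      B (-s) + ?lam * (X a (-s) + X (-a) (-s)) + ?lam * (Z a (-s) + Z (-a) (-s))
       + ?lam * ?lam * (S1 + S2 + S3 + S4)) UNIV"
      by (rule has_sum_add[OF has_sum_add[OF has_sum_add[OF AA
            has_sum_cmult_right[OF has_sum_add[OF AP AP]]] has_sum_cmult_right[OF has_sum_add[OF PA PA]]]
            has_sum_cmult_right[OF PP]])
    also have "(\<lambda>i. ?A s f i * ?A s g i * wt i
        + ?lam * (?A s f i * ?P a s g i * wt i + ?A s f i * ?P (-a) s g i * wt i)
        + ?lam * (?P a s f i * ?A s g i * wt i + ?P (-a) s f i * ?A s g i * wt i)
        + ?lam * ?lam * (?P a s f i * ?P a s g i * wt i + ?P a s f i * ?P (-a) s g i * wt i
        + ?P (-a) s f i * ?P a s g i * wt i + ?P (-a) s f i * ?P (-a) s g i * wt i))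
      = (\<lambda>i. ?l s f i * ?l s g i * wt i)"
      by (simp add: ell_pm1[OF s] V_op_def algebra_simps)
    finally show ?thesis by (simp add: bil_def infsumI)
  qed
  have "B 1 - B (-1) = (\<Sum>i\<in>?F. f i * (?A 1 (?A (-1) g) i - ?A (-1) (?A 1 g) i) * wt i)"
    by (simp add: B_def sum_subtractf algebra_simps)
  also have "\<dots> = (\<Sum>i\<in>?F. 2 * (f i * ?l 0 g i * wt i))"
  proof (rule sum.cong)
    fix i assume "i \<in> ?F"
    then have "good i" using inD_good[OF assms(1)] by auto
    then obtain j N1 N2 where i: "i = ((j, N1), (j, N2))"
      unfolding good_def by (metis prod.collapse)
    have "?A 1 (?A (-1) g) i - ?A (-1) (?A 1 g) i = 2 * ?l 0 g i"
      unfolding i using A_commutator[of \<alpha>0 g j N1 N2]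
      by (simp add: A_op_def ell_0[OF assms(2)] grade_def algebra_simps)
    then show "f i * (?A 1 (?A (-1) g) i - ?A (-1) (?A 1 g) i) * wt i = 2 * (f i * ?l 0 g i * wt i)"
      by simp
  qed simp
  also have "\<dots> = 2 * bil f (?l 0 g)"
  proof -
    have "((\<lambda>i. f i * ?l 0 g i * wt i) has_sum (\<Sum>i\<in>?F. f i * ?l 0 g i * wt i)) UNIV"
      by (rule has_sum_finite_support) (use fin in auto)
    then show ?thesis by (simp add: bil_def infsumI sum_distrib_left)
  qed
  finally have B: "B 1 - B (-1) = 2 * bil f (?l 0 g)" .
  have "X a 1 + X (-a) 1 + (Z a 1 + Z (-a) 1) = X a (-1) + X (-a) (-1) + (Z a (-1) + Z (-a) (-1))"
    using XZ[of a] XZ[of "-a", unfolded minus_minus] by algebra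
  then have "?lam * (X a 1 + X (-a) 1) + ?lam * (Z a 1 + Z (-a) 1)
     = ?lam * (X a (-1) + X (-a) (-1)) + ?lam * (Z a (-1) + Z (-a) (-1))"
    by (simp only: distrib_left[symmetric])
  then show ?thesis using B bil_eq[of 1] bil_eq[of "-1"] by (simp add: algebra_simps)
qed

lemma cnj_ell:
  assumes "inD \<Psi>" "m \<in> {-1, 0, 1}"
  shows "cnj (ell \<alpha>0 a lam m \<Psi> i) = ell \<alpha>0 a lam m (\<lambda>i. cnj (\<Psi> i)) i"
proof -
  have inD: "inD (\<lambda>i. cnj (\<Psi> i))" using assms(1) by (simp add: inD_def)
  have Phi: "cnj (Phi \<alpha>0 b s \<Psi> i) = Phi \<alpha>0 b s (\<lambda>i. cnj (\<Psi> i)) i" for b s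
    by (simp add: Phi_eq_sum_kernel[OF assms(1)] Phi_eq_sum_kernel[OF inD])
  have vir: "cnj (vir_dn (of_real \<beta>) f N) = vir_dn (of_real \<beta>) (\<lambda>M. cnj (f M)) N"
    "cnj (vir_up (of_real \<beta>) f N) = vir_up (of_real \<beta>) (\<lambda>M. cnj (f M)) N" for \<beta> f N
    by (simp_all add: vir_dn_def vir_up_def ann_def cre_def)
  have A: "cnj (A_op \<alpha>0 s \<Psi> i) = A_op \<alpha>0 s (\<lambda>i. cnj (\<Psi> i)) i" for s
    by (cases i; cases "fst i"; cases "snd i")
       (simp add: A_op_def A_dn_eq A_up_eq vir del: of_real_mult)
  show ?thesis
  proof (cases "m = 0")
    case True
    then show ?thesis by (simp add: ell_0[OF assms(1)] ell_0[OF inD])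
  next
    case False
    then have "m \<in> {-1, 1}" using assms(2) by auto
    then show ?thesis by (simp add: ell_pm1 A Phi V_op_def)
  qed
qed

theorem mainTheorem5:
  fixes \<alpha>0 :: real and a :: int and lam :: real and m n :: int and \<Psi>1 \<Psi>2 :: tvec
  assumes "0 < \<bar>\<alpha>0\<bar>" and "\<bar>\<alpha>0\<bar> \<le> 1"
    and "\<bar>of_int a * \<alpha>0\<bar> < 1 / sqrt 2"
    and "m \<in> {-1, 0, 1}" and "n \<in> {-1, 0, 1}"
    and "inD \<Psi>1" and "inD \<Psi>2"
  shows "tinner (ell \<alpha>0 a lam (-m) \<Psi>1) (ell \<alpha>0 a lam n \<Psi>2)
           - tinner (ell \<alpha>0 a lam (-n) \<Psi>1) (ell \<alpha>0 a lam m \<Psi>2)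
         = of_int (m - n) * tinner \<Psi>1 (ell \<alpha>0 a lam (m + n) \<Psi>2)"
proof -
  let ?f = "\<lambda>i. cnj (\<Psi>1 i)" and ?l = "ell \<alpha>0 a lam"
  have f: "inD ?f" using assms(6) by (simp add: inD_def)
  have "\<bar>of_int a * \<alpha>0\<bar>\<^sup>2 < (1 / sqrt 2)\<^sup>2"
    using assms(3) by (intro power_strict_mono) auto
  then have a: "(of_int a * \<alpha>0)\<^sup>2 < 1 / 2" by (simp add: power_divide)
  have tin: "tinner (?l k \<Psi>1) g = bil (?l k ?f) g" if "k \<in> {-1, 0, 1}" for k g
    unfolding tinner_def bil_def tweight_def cnj_ell[OF assms(6) that] ..
  have tin': "tinner \<Psi>1 g = bil ?f g" for g
    unfolding tinner_def bil_def tweight_def ..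
  have mn: "-m \<in> {-1, 0, 1}" "-n \<in> {-1, 0, 1}" using assms(4,5) by auto
  note pm = ell_pm1_commutator[OF f assms(7) a, of lam]
  note z = ell_0_commutator[OF f assms(7), of _ \<alpha>0 a lam]
  \<comment> \<open>Both sides change sign when m and n are exchanged, and vanish for m = n. The
    pair 1, -1 is \<open>pm\<close>; the pairs containing 0 are \<open>z\<close>.\<close>
  have "bil (?l (-m) ?f) (?l n \<Psi>2) - bil (?l (-n) ?f) (?l m \<Psi>2)
         = of_int (m - n) * bil ?f (?l (m + n) \<Psi>2)"
    using assms(4,5) pm z[of 1] z[of "-1"] by (auto simp: algebra_simps)
  then show ?thesis by (simp only: tin[OF mn(1)] tin[OF mn(2)] tin')
qed

end
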